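(* Let $R$ and $C$ be two disjoint copies of $\mathbb N$, let $I\subseteq R\times C$, and let $G$ be the bipartite graph with vertex classes $C$ and $R$ whose edges are the pairs $\{r,c\}$ with $(r,c)\in I$. Let $p\in[1,\infty]\setminus\{2,4,6,\dots\}$. If $S^p_I$ has the real metric unconditional approximation property, then the distance of any two vertices $c\in C$ and $r\in R$ is asymptotically infinite in $G$: for every $c\in C$, $r\in R$ and every $N$, one can delete a finite number of edges from $G$ so that the distance from $c$ to $r$ in the remaining graph is at least $N$.
   Context: For $1\le p<\infty$, $S^p$ is the Schatten-von-Neumann class of compact operators $x\colon\ell^2_C\to\ell^2_R$ with $\|x\|_p^p=\operatorname{tr}(x^*x)^{p/2}<\infty$; $S^\infty$ is the space of compact operators with the operator norm. $S^p_I$ is the closed subspace of those $x\in S^p$ whose matrix coefficients $x_{rc}$ vanish for $(r,c)\notin I$. Let $X$ be a separable Banach space. An approximating sequence on $X$ is a sequence $(T_k)$ of finite rank operators on $X$ with $\|T_kx-x\|\to0$ for every $x\in X$. Put $\Delta T_1=T_1$ and $\Delta T_k=T_k-T_{k-1}$ for $k\ge2$. The real unconditional constant of $(T_k)$ is the least $D$ such that $\|\sum_{k=1}^n\epsilon_k\Delta T_k\|\le D$ for all $n$ and all $\epsilon_k\in\{-1,1\}$. $X$ has the real metric unconditional approximation property if for every $\delta>0$ it has an approximating sequence with real unconditional constant at most $1+\delta$. The distance of two vertices in a graph is the minimal length (number of edges) of a path joining them, and is infinite if there is no such path. *)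

theory Defs
  imports "HOL-Analysis.Analysis" "HOL-Library.Extended_Nat"
begin

section \<open>The complex Hilbert space of square-summable families\<close>

definition square_summable :: "('a \<Rightarrow> complex) \<Rightarrow> bool" where
  "square_summable v \<longleftrightarrow> (\<lambda>i. (cmod (v i))\<^sup>2) summable_on UNIV"

lemma square_summable_0: "square_summable (\<lambda>_. 0)"
  by (simp add: square_summable_def)

lemma square_summable_add:
  assumes "square_summable v" "square_summable w"
  shows "square_summable (\<lambda>i. v i + w i)"
  unfolding square_summable_def
proof (rule summable_on_comparison_test)
  show "(\<lambda>i. 2 * (cmod (v i))\<^sup>2 + 2 * (cmod (w i))\<^sup>2) summable_on UNIV"
    using assms by (intro summable_on_add summable_on_cmult_right) (auto simp: square_summable_def)
next
  fix i
  have "(cmod (v i + w i))\<^sup>2 \<le> (cmod (v i) + cmod (w i))\<^sup>2"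
    by (intro power_mono norm_triangle_ineq norm_ge_zero)
  also have "\<dots> \<le> 2 * (cmod (v i))\<^sup>2 + 2 * (cmod (w i))\<^sup>2"
    using zero_le_power2[of "cmod (v i) - cmod (w i)"]
    by (simp add: power2_eq_square algebra_simps)
  finally show "(cmod (v i + w i))\<^sup>2 \<le> 2 * (cmod (v i))\<^sup>2 + 2 * (cmod (w i))\<^sup>2" .
qed auto

lemma square_summable_mult:
  assumes "square_summable v"
  shows "square_summable (\<lambda>i. a * v i)"
  using summable_on_cmult_right[of "\<lambda>i. (cmod (v i))\<^sup>2" UNIV "(cmod a)\<^sup>2"] assms
  by (simp add: square_summable_def norm_mult power_mult_distrib)

lemma square_summable_cnj_mult:
  assumes "square_summable v" "square_summable w"
  shows "(\<lambda>i. cnj (v i) * w i) summable_on UNIV"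
proof -
  have "(\<lambda>i. norm (cnj (v i) * w i)) summable_on UNIV"
  proof (rule summable_on_comparison_test)
    show "(\<lambda>i. (cmod (v i))\<^sup>2 + (cmod (w i))\<^sup>2) summable_on UNIV"
      using assms by (intro summable_on_add) (auto simp: square_summable_def)
  next
    fix i
    show "norm (cnj (v i) * w i) \<le> (cmod (v i))\<^sup>2 + (cmod (w i))\<^sup>2"
    proof -
      have "2 * (cmod (v i) * cmod (w i)) \<le> (cmod (v i))\<^sup>2 + (cmod (w i))\<^sup>2"
        using sum_squares_bound[of "cmod (v i)" "cmod (w i)"] by (simp only: mult.assoc)
      moreover have "0 \<le> cmod (v i) * cmod (w i)" by simp
      ultimately have "cmod (v i) * cmod (w i) \<le> (cmod (v i))\<^sup>2 + (cmod (w i))\<^sup>2"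
        by linarith
      then show ?thesis by (simp only: norm_mult complex_mod_cnj)
    qed
  qed auto
  then show ?thesis by (rule abs_summable_summable)
qed

typedef 'a ell2 = "{v :: 'a \<Rightarrow> complex. square_summable v}"
  morphisms ell2_nth Abs_ell2
  using square_summable_0 by blast

setup_lifting type_definition_ell2

lift_definition cinner :: "'a ell2 \<Rightarrow> 'a ell2 \<Rightarrow> complex" is
  "\<lambda>v w. \<Sum>\<^sub>\<infinity>i. cnj (v i) * w i" .

lift_definition scaleC_ell2 :: "complex \<Rightarrow> 'a ell2 \<Rightarrow> 'a ell2" is
  "\<lambda>a v i. a * v i"
  by (rule square_summable_mult)

lift_definition unit_ell2 :: "'a \<Rightarrow> 'a ell2" is
  "\<lambda>i j. if j = i then 1 else 0"
proof -
  fix i :: 'a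
  have "finite {j. (cmod (if j = i then 1 else 0))\<^sup>2 \<noteq> 0}"
    by (rule finite_subset[of _ "{i}"]) auto
  then have "(\<lambda>j. (cmod (if j = i then 1 else 0))\<^sup>2) summable_on UNIV"
    using summable_on_cong_neutral[of UNIV "{i}" "\<lambda>j. (cmod (if j = i then 1 else 0))\<^sup>2"
        "\<lambda>j. (cmod (if j = i then 1 else 0))\<^sup>2"]
    by simp
  then show "square_summable (\<lambda>j. if j = i then 1 else 0)"
    by (simp add: square_summable_def)
qed

instantiation ell2 :: (type) real_inner
begin

lift_definition zero_ell2 :: "'a ell2" is "\<lambda>_. 0" by (rule square_summable_0)

lift_definition plus_ell2 :: "'a ell2 \<Rightarrow> 'a ell2 \<Rightarrow> 'a ell2" is
  "\<lambda>v w i. v i + w i" by (rule square_summable_add)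

lift_definition uminus_ell2 :: "'a ell2 \<Rightarrow> 'a ell2" is
  "\<lambda>v i. - v i" by (simp add: square_summable_def)

lift_definition minus_ell2 :: "'a ell2 \<Rightarrow> 'a ell2 \<Rightarrow> 'a ell2" is
  "\<lambda>v w i. v i - w i"
  using square_summable_add square_summable_mult[of _ "-1"] by force

definition scaleR_ell2 :: "real \<Rightarrow> 'a ell2 \<Rightarrow> 'a ell2" where
  "scaleR_ell2 r v = scaleC_ell2 (complex_of_real r) v"

definition inner_ell2 :: "'a ell2 \<Rightarrow> 'a ell2 \<Rightarrow> real" where
  "inner_ell2 v w = Re (cinner v w)"

definition norm_ell2 :: "'a ell2 \<Rightarrow> real" where
  "norm_ell2 v = sqrt (inner v v)"

definition sgn_ell2 :: "'a ell2 \<Rightarrow> 'a ell2" where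
  "sgn_ell2 v = scaleR (inverse (norm v)) v"

definition dist_ell2 :: "'a ell2 \<Rightarrow> 'a ell2 \<Rightarrow> real" where
  "dist_ell2 v w = norm (v - w)"

definition uniformity_ell2 :: "('a ell2 \<times> 'a ell2) filter" where
  "uniformity_ell2 = (INF e\<in>{0<..}. principal {(v, w). dist v w < e})"

definition open_ell2 :: "'a ell2 set \<Rightarrow> bool" where
  "open_ell2 U \<longleftrightarrow> (\<forall>v\<in>U. eventually (\<lambda>(v', w). v' = v \<longrightarrow> w \<in> U) uniformity)"

lemma cinner_self_aux:
  "inner v v = (\<Sum>\<^sub>\<infinity>i. (cmod (ell2_nth v i))\<^sup>2)"
proof -
  have s: "(\<lambda>i. (cmod (ell2_nth v i))\<^sup>2) summable_on UNIV"
    using ell2_nth[of v] by (simp add: square_summable_def)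
  have "cinner v v = (\<Sum>\<^sub>\<infinity>i. complex_of_real ((cmod (ell2_nth v i))\<^sup>2))"
    unfolding cinner.rep_eq by (intro infsum_cong) (metis complex_norm_square mult.commute)
  also have "\<dots> = complex_of_real (\<Sum>\<^sub>\<infinity>i. (cmod (ell2_nth v i))\<^sup>2)"
    by (rule infsumI) (simp only: has_sum_of_real_iff has_sum_infsum[OF s])
  finally show ?thesis by (simp add: inner_ell2_def)
qed

instance
proof
  fix u v w :: "'a ell2" and r s :: real
  show "u + v + w = u + (v + w)" by transfer (simp add: add.assoc)
  show "u + v = v + u" by transfer (simp add: add.commute)
  show "0 + u = u" by transfer simp
  show "- u + u = 0" by transfer simp
  show "u - v = u + - v" by transfer simp
  show "r *\<^sub>R (u + v) = r *\<^sub>R u + r *\<^sub>R v"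
    unfolding scaleR_ell2_def by transfer (simp add: algebra_simps)
  show "(r + s) *\<^sub>R u = r *\<^sub>R u + s *\<^sub>R u"
    unfolding scaleR_ell2_def by transfer (simp add: algebra_simps)
  show "r *\<^sub>R s *\<^sub>R u = (r * s) *\<^sub>R u"
    unfolding scaleR_ell2_def by transfer (simp add: algebra_simps)
  show "1 *\<^sub>R u = u"
    unfolding scaleR_ell2_def by transfer simp
  show "dist u v = norm (u - v)" by (rule dist_ell2_def)
  show "sgn u = inverse (norm u) *\<^sub>R u" by (rule sgn_ell2_def)
  show "uniformity = (INF e\<in>{0<..}. principal {(v, w :: 'a ell2). dist v w < e})"
    by (rule uniformity_ell2_def)
  show "open U \<longleftrightarrow> (\<forall>v\<in>U. \<forall>\<^sub>F (v', w) in uniformity. v' = v \<longrightarrow> w \<in> U)" for U :: "'a ell2 set"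
    by (rule open_ell2_def)
  show "norm u = sqrt (inner u u)" by (rule norm_ell2_def)
  have cnj: "cinner v u = cnj (cinner u v)" for u v :: "'a ell2"
    unfolding cinner.rep_eq
    by (subst infsum_cnj[symmetric]) (simp add: mult.commute)
  show "inner u v = inner v u"
    unfolding inner_ell2_def by (subst cnj) simp
  have sm: "(\<lambda>i. cnj (ell2_nth u i) * ell2_nth v i) summable_on UNIV" for u v :: "'a ell2"
    using ell2_nth[of u] ell2_nth[of v] by (auto intro: square_summable_cnj_mult)
  have "cinner (u + v) w = cinner u w + cinner v w"
    unfolding cinner.rep_eq plus_ell2.rep_eq
    by (subst infsum_add[symmetric, OF sm sm]) (simp add: algebra_simps)
  then show "inner (u + v) w = inner u w + inner v w"
    by (simp add: inner_ell2_def)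
  have "cinner (scaleC_ell2 (of_real r) u) w = of_real r * cinner u w"
    unfolding cinner.rep_eq scaleC_ell2.rep_eq
    by (subst infsum_cmult_right'[symmetric]) (simp add: mult.assoc)
  then show "inner (r *\<^sub>R u) w = r * inner u w"
    by (simp add: inner_ell2_def scaleR_ell2_def)
  show "0 \<le> inner u u"
    unfolding cinner_self_aux by (rule infsum_nonneg) simp
  show "inner u u = 0 \<longleftrightarrow> u = 0"
  proof
    assume z: "inner u u = 0"
    have s: "(\<lambda>i. (cmod (ell2_nth u i))\<^sup>2) summable_on UNIV"
      using ell2_nth[of u] by (simp add: square_summable_def)
    have "(cmod (ell2_nth u i))\<^sup>2 = 0" for i
      by (rule nonneg_infsum_le_0D[OF _ s]) (use z cinner_self_aux[of u] in auto)
    then show "u = 0" by (simp add: ell2_nth_inject[symmetric] zero_ell2.rep_eq fun_eq_iff)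
  next
    assume "u = 0"
    then show "inner u u = 0" unfolding cinner_self_aux by (simp add: zero_ell2.rep_eq)
  qed
qed

end

section \<open>Schatten classes\<close>

text \<open>
  Operators are elements of the library type of bounded real-linear maps, with its operator norm;
  complex linearity is imposed by \<open>clinear_op\<close>. The operator norm of a complex-linear map is the
  same over both scalar fields.
\<close>

type_synonym ('c, 'r) ell2_op = "'c ell2 \<Rightarrow>\<^sub>L 'r ell2"

definition clinear_op :: "('c, 'r) ell2_op \<Rightarrow> bool" where
  "clinear_op x \<longleftrightarrow> (\<forall>a v. x (scaleC_ell2 a v) = scaleC_ell2 a (x v))"

definition compact_op :: "('c, 'r) ell2_op \<Rightarrow> bool" where
  "compact_op x \<longleftrightarrow> clinear_op x \<and> compact (closure (blinfun_apply x ` cball 0 1))"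

definition scaleC_op :: "complex \<Rightarrow> ('c, 'r) ell2_op \<Rightarrow> ('c, 'r) ell2_op" where
  "scaleC_op a x = Blinfun (\<lambda>v. scaleC_ell2 a (x v))"

lemma norm_scaleC_ell2: "norm (scaleC_ell2 a v) = cmod a * norm v"
proof -
  have "inner (scaleC_ell2 a v) (scaleC_ell2 a v) = (cmod a)\<^sup>2 * inner v v"
    unfolding cinner_self_aux scaleC_ell2.rep_eq
    by (subst infsum_cmult_right'[symmetric]) (simp add: norm_mult power_mult_distrib)
  then show ?thesis
    by (simp add: norm_eq_sqrt_inner real_sqrt_mult)
qed

lemma bounded_linear_scaleC_ell2: "bounded_linear (scaleC_ell2 a)"
proof (rule bounded_linear_intro)
  fix v w :: "'a ell2" and r :: real
  show "scaleC_ell2 a (v + w) = scaleC_ell2 a v + scaleC_ell2 a w"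
    by transfer (simp add: algebra_simps)
  show "scaleC_ell2 a (r *\<^sub>R v) = r *\<^sub>R scaleC_ell2 a v"
    unfolding scaleR_ell2_def by transfer (simp add: algebra_simps)
  show "norm (scaleC_ell2 a v) \<le> norm v * cmod a"
    by (simp add: norm_scaleC_ell2)
qed

lemma scaleC_op_apply: "scaleC_op a x v = scaleC_ell2 a (x v)"
  unfolding scaleC_op_def
  by (subst bounded_linear_Blinfun_apply)
    (auto intro: bounded_linear_compose[OF bounded_linear_scaleC_ell2 blinfun.bounded_linear_right])

lemma vector_space_scaleC_op: "vector_space scaleC_op"
proof (unfold_locales; rule blinfun_eqI)
  fix a b :: complex and x y :: "('c, 'r) ell2_op" and v
  show "scaleC_op a (x + y) v = (scaleC_op a x + scaleC_op a y) v"
    unfolding scaleC_op_apply blinfun.add_left by transfer (simp add: algebra_simps)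
  show "scaleC_op (a + b) x v = (scaleC_op a x + scaleC_op b x) v"
    unfolding scaleC_op_apply blinfun.add_left by transfer (simp add: algebra_simps)
  show "scaleC_op a (scaleC_op b x) v = scaleC_op (a * b) x v"
    unfolding scaleC_op_apply by transfer (simp add: algebra_simps)
  show "scaleC_op 1 x v = x v"
    unfolding scaleC_op_apply by transfer simp
qed

definition coefficient :: "('c, 'r) ell2_op \<Rightarrow> 'r \<Rightarrow> 'c \<Rightarrow> complex" where
  "coefficient x r c = cinner (unit_ell2 r) (x (unit_ell2 c))"

definition adjoint_op :: "('c, 'r) ell2_op \<Rightarrow> ('r, 'c) ell2_op" where
  "adjoint_op x = (THE y :: ('r, 'c) ell2_op. \<forall>v w. cinner (x v) w = cinner v (y w))"

definition orthonormal_basis :: "('i \<Rightarrow> 'a ell2) \<Rightarrow> bool" where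
  "orthonormal_basis e \<longleftrightarrow>
     (\<forall>i j. cinner (e i) (e j) = (if i = j then 1 else 0)) \<and>
     (\<forall>v. (\<forall>i. cinner (e i) v = 0) \<longrightarrow> v = 0)"

text \<open>
  The power \<open>t\<close> to the exponent \<open>s > 0\<close> of a compact positive operator \<open>t\<close>, by functional calculus:
  by the spectral theorem, \<open>t\<close> has an orthonormal basis of eigenvectors (indexed by \<open>'a\<close>, like every
  orthonormal basis of \<open>'a ell2\<close>), and the operator described does not depend on its choice.
  Note that \<open>0 powr s = 0\<close>.
\<close>

definition power_op :: "('a, 'a) ell2_op \<Rightarrow> real \<Rightarrow> ('a, 'a) ell2_op" where
  "power_op t s = (THE y. clinear_op y \<and>
     (\<exists>(e :: 'a \<Rightarrow> 'a ell2) (l :: 'a \<Rightarrow> real). orthonormal_basis e \<and>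
        (\<forall>i. 0 \<le> l i \<and> t (e i) = l i *\<^sub>R e i \<and> y (e i) = (l i powr s) *\<^sub>R e i)))"

text \<open>The trace of a positive operator, with values in \<open>[0,\<infinity>]\<close>.\<close>

definition trace_pos :: "('a, 'a) ell2_op \<Rightarrow> ennreal" where
  "trace_pos y = (\<Sum>\<^sub>\<infinity>i. ennreal (Re (coefficient y i i)))"

definition schatten_trace :: "real \<Rightarrow> ('c, 'r) ell2_op \<Rightarrow> ennreal" where
  "schatten_trace p x = trace_pos (power_op (adjoint_op x o\<^sub>L x) (p / 2))"

definition schatten_class :: "ereal \<Rightarrow> ('c, 'r) ell2_op set" where
  "schatten_class p =
     {x. compact_op x \<and> (p \<noteq> \<infinity> \<longrightarrow> schatten_trace (real_of_ereal p) x < \<infinity>)}"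

definition schatten_norm :: "ereal \<Rightarrow> ('c, 'r) ell2_op \<Rightarrow> real" where
  "schatten_norm p x =
     (if p = \<infinity> then norm x
      else enn2real (schatten_trace (real_of_ereal p) x) powr (1 / real_of_ereal p))"

definition schatten_class_on :: "ereal \<Rightarrow> ('r \<times> 'c) set \<Rightarrow> ('c, 'r) ell2_op set" where
  "schatten_class_on p I =
     {x \<in> schatten_class p. \<forall>r c. (r, c) \<notin> I \<longrightarrow> coefficient x r c = 0}"

section \<open>The real metric unconditional approximation property\<close>

text \<open>
  A complex normed space is given by its scalar multiplication \<open>sc\<close>, its carrier \<open>X\<close> and its
  norm \<open>N\<close>; operators on it are considered on \<open>X\<close> only.
\<close>

definition opnorm_on :: "'a set \<Rightarrow> ('a \<Rightarrow> real) \<Rightarrow> ('a \<Rightarrow> 'a) \<Rightarrow> ennreal" where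
  "opnorm_on X N S = (SUP x\<in>{x \<in> X. N x \<le> 1}. ennreal (N (S x)))"

definition bounded_operator_on ::
  "(complex \<Rightarrow> 'a \<Rightarrow> 'a) \<Rightarrow> 'a::real_vector set \<Rightarrow> ('a \<Rightarrow> real) \<Rightarrow> ('a \<Rightarrow> 'a) \<Rightarrow> bool" where
  "bounded_operator_on sc X N S \<longleftrightarrow>
     S ` X \<subseteq> X \<and>
     (\<forall>x\<in>X. \<forall>y\<in>X. S (x + y) = S x + S y) \<and>
     (\<forall>a. \<forall>x\<in>X. S (sc a x) = sc a (S x)) \<and>
     opnorm_on X N S < \<infinity>"

definition finite_rank_on ::
  "(complex \<Rightarrow> 'a \<Rightarrow> 'a) \<Rightarrow> 'a::real_vector set \<Rightarrow> ('a \<Rightarrow> 'a) \<Rightarrow> bool" where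
  "finite_rank_on sc X S \<longleftrightarrow> (\<exists>B. finite B \<and> S ` X \<subseteq> module.span sc B)"

text \<open>Sequences \<open>T\<close> are indexed from \<open>1\<close>; the value \<open>T 0\<close> is irrelevant.\<close>

definition approximating_sequence ::
  "(complex \<Rightarrow> 'a \<Rightarrow> 'a) \<Rightarrow> 'a::real_vector set \<Rightarrow> ('a \<Rightarrow> real) \<Rightarrow> (nat \<Rightarrow> 'a \<Rightarrow> 'a) \<Rightarrow> bool"
where
  "approximating_sequence sc X N T \<longleftrightarrow>
     (\<forall>k\<ge>1. bounded_operator_on sc X N (T k) \<and> finite_rank_on sc X (T k)) \<and>
     (\<forall>x\<in>X. (\<lambda>k. N (T k x - x)) \<longlonglongrightarrow> 0)"

definition Delta :: "(nat \<Rightarrow> 'a \<Rightarrow> 'a::real_vector) \<Rightarrow> nat \<Rightarrow> 'a \<Rightarrow> 'a" where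
  "Delta T k x = (if k = 1 then T 1 x else T k x - T (k - 1) x)"

definition real_unconditional_const ::
  "'a::real_vector set \<Rightarrow> ('a \<Rightarrow> real) \<Rightarrow> (nat \<Rightarrow> 'a \<Rightarrow> 'a) \<Rightarrow> ennreal" where
  "real_unconditional_const X N T = (LEAST D. \<forall>n. \<forall>\<epsilon> :: nat \<Rightarrow> real. (\<forall>k. \<epsilon> k \<in> {-1, 1}) \<longrightarrow>
     opnorm_on X N (\<lambda>x. \<Sum>k=1..n. \<epsilon> k *\<^sub>R Delta T k x) \<le> D)"

lemma real_unconditional_const_le_iff:
  "real_unconditional_const X N T \<le> D \<longleftrightarrow>
     (\<forall>n. \<forall>\<epsilon> :: nat \<Rightarrow> real. (\<forall>k. \<epsilon> k \<in> {-1, 1}) \<longrightarrow>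
       opnorm_on X N (\<lambda>x. \<Sum>k=1..n. \<epsilon> k *\<^sub>R Delta T k x) \<le> D)"
proof -
  let ?f = "\<lambda>(n, \<epsilon>). opnorm_on X N (\<lambda>x. \<Sum>k=1..n. \<epsilon> k *\<^sub>R Delta T k x)"
  let ?S = "SUP q\<in>UNIV \<times> {\<epsilon> :: nat \<Rightarrow> real. \<forall>k. \<epsilon> k \<in> {-1, 1}}. ?f q"
  have iff: "(\<forall>n. \<forall>\<epsilon> :: nat \<Rightarrow> real. (\<forall>k. \<epsilon> k \<in> {-1, 1}) \<longrightarrow>
       opnorm_on X N (\<lambda>x. \<Sum>k=1..n. \<epsilon> k *\<^sub>R Delta T k x) \<le> E) \<longleftrightarrow> ?S \<le> E" for E
    unfolding SUP_le_iff by auto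
  have "real_unconditional_const X N T = ?S"
    unfolding real_unconditional_const_def iff by (rule Least_equality) auto
  then show ?thesis unfolding iff by simp
qed

definition real_metric_uap ::
  "(complex \<Rightarrow> 'a \<Rightarrow> 'a) \<Rightarrow> 'a::real_vector set \<Rightarrow> ('a \<Rightarrow> real) \<Rightarrow> bool" where
  "real_metric_uap sc X N \<longleftrightarrow>
     (\<forall>\<delta>>0. \<exists>T. approximating_sequence sc X N T \<and>
        real_unconditional_const X N T \<le> ennreal (1 + \<delta>))"

section \<open>Distances in bipartite graphs\<close>

text \<open>A graph is given by its set of edges, and an edge by the set of its two endpoints.\<close>

definition path_between :: "'v set set \<Rightarrow> 'v \<Rightarrow> 'v list \<Rightarrow> 'v \<Rightarrow> bool" where
  "path_between E u vs w \<longleftrightarrow>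
     vs \<noteq> [] \<and> hd vs = u \<and> last vs = w \<and> distinct vs \<and>
     (\<forall>i. Suc i < length vs \<longrightarrow> {vs ! i, vs ! Suc i} \<in> E)"

definition graph_dist :: "'v set set \<Rightarrow> 'v \<Rightarrow> 'v \<Rightarrow> enat" where
  "graph_dist E u w = (INF vs\<in>{vs. path_between E u vs w}. enat (length vs - 1))"

text \<open>The vertices \<open>c \<in> C\<close> and \<open>r \<in> R\<close> are \<open>Inl c\<close> and \<open>Inr r\<close>.\<close>

definition bipartite_edges :: "('r \<times> 'c) set \<Rightarrow> ('c + 'r) set set" where
  "bipartite_edges I = {{Inl c, Inr r} | r c. (r, c) \<in> I}"

definition asymptotically_infinite_dist :: "'v set set \<Rightarrow> 'v \<Rightarrow> 'v \<Rightarrow> bool" where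
  "asymptotically_infinite_dist E u w \<longleftrightarrow>
     (\<forall>N :: nat. \<exists>F. finite F \<and> F \<subseteq> E \<and> enat N \<le> graph_dist (E - F) u w)"

end

theory Submission
  imports Defs
begin

text \<open>
  If the conclusion fails, choose a pair \<open>(c, r)\<close> joined by short paths that survive every finite
  deletion of edges, with shortest possible paths. By minimality there are infinitely many such
  paths, all of the same odd length \<open>n \<ge> 3\<close>, that pairwise share only their ends. Fixing one of them
  and letting the other go to infinity gives cycles of length \<open>2n\<close> in the graph.

  For an approximating sequence with constant \<open>1 + \<delta>\<close>, the operators \<open>2T\<^sub>k - 1\<close> have norm at most
  \<open>1 + \<delta>\<close>. Averaging over conjugations with diagonal unitaries replaces them by Schur multipliers.
  As \<open>T\<^sub>k\<close> has finite rank, the multiplier is close to \<open>1\<close> on the fixed half of the cycle and close to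
  \<open>-1\<close> on the far half. Since \<open>n\<close> is odd, this change of signs turns the matrix \<open>1 + tS\<close>, where
  \<open>S\<close> is the cyclic shift of order \<open>n\<close>, into \<open>1 - tS\<close>. Hence \<open>1 + tS\<close> and \<open>1 - tS\<close> have the same
  Schatten norm for all \<open>t\<close> in \<open>(0, 1)\<close>; expanding in powers of \<open>t\<close> shows that this forces \<open>p\<close> to be
  an even integer.
\<close>

section \<open>Square-summable families\<close>

text \<open>Operators are tested only by pairings \<open>cinner (u i) (x (v i))\<close> with finite
  orthonormal families u and v: for finite p, the p-th power of the Schatten norm is the supremum of
  the p-th power sums of these pairings. Conjugation by diagonal unitaries merely rotates singular
  vectors, so the bounds are uniform in it, and the averaging takes place on scalars, after pairing
  with a norming matrix of 1 - tS. Unconditionality bounds 2T_k - T_m instead of 2T_k - 1; on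
  finitely many entries the difference disappears as m grows. The order of choice matters: the fixed
  half of the cycle, then k with the multiplier near 1 on it, then a far half outside the finite set
  of entries on which T_k is still large. The matrix 1 + tS is circulant, with singular values |1 +
  t w| for the n-th roots of unity w. Summing over w cancels every odd power of t below the n-th, so
  the n-th binomial coefficient of p/2 decides. For p infinite there is no power sum; there t = 1/2
  is used: 1 + S/2 has norm 3/2, but 1 - S/2 has a smaller one, since -1 is not an n-th root of
  unity for odd n.\<close>

lemma cinner_summable:
  "(\<lambda>i. cnj (ell2_nth v i) * ell2_nth w i) summable_on UNIV"
  using ell2_nth[of v] ell2_nth[of w] by (auto intro: square_summable_cnj_mult)

lemma cinner_has_sum:
  "((\<lambda>i. cnj (ell2_nth v i) * ell2_nth w i) has_sum cinner v w) UNIV"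
  unfolding cinner.rep_eq by (rule has_sum_infsum[OF cinner_summable])

lemma cinner_commute: "cinner v w = cnj (cinner w v)"
  unfolding cinner.rep_eq
  by (subst infsum_cnj[symmetric]) (simp add: mult.commute)

lemma cinner_add_right: "cinner u (v + w) = cinner u v + cinner u w"
  unfolding cinner.rep_eq plus_ell2.rep_eq
  by (subst infsum_add[symmetric, OF cinner_summable cinner_summable]) (simp add: algebra_simps)

lemma cinner_scaleC_right: "cinner u (scaleC_ell2 a v) = a * cinner u v"
  unfolding cinner.rep_eq scaleC_ell2.rep_eq
  by (subst infsum_cmult_right'[symmetric]) (simp add: mult_ac)

lemma cinner_add_left: "cinner (v + w) u = cinner v u + cinner w u"
  using cinner_add_right[of u v w] by (metis cinner_commute complex_cnj_add)

lemma cinner_scaleC_left: "cinner (scaleC_ell2 a v) u = cnj a * cinner v u"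
  using cinner_scaleC_right[of u a v] by (metis cinner_commute complex_cnj_mult)

lemma cinner_zero_right [simp]: "cinner u 0 = 0"
  using cinner_add_right[of u 0 0] by simp

lemma cinner_zero_left [simp]: "cinner 0 u = 0"
  using cinner_add_left[of 0 0 u] by simp

lemma scaleC_minus1: "scaleC_ell2 (-1) v = - v"
  by transfer auto

lemma cinner_minus_right: "cinner u (- v) = - cinner u v"
  using cinner_scaleC_right[of u "-1" v] by (simp add: scaleC_minus1)

lemma cinner_minus_left: "cinner (- v) u = - cinner v u"
  using cinner_scaleC_left[of "-1" v u] by (simp add: scaleC_minus1)

lemma cinner_diff_right: "cinner u (v - w) = cinner u v - cinner u w"
  by (metis add_uminus_conv_diff cinner_add_right cinner_minus_right)

lemma cinner_sum_right: "cinner u (\<Sum>i\<in>F. f i) = (\<Sum>i\<in>F. cinner u (f i))"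
  by (induction F rule: infinite_finite_induct) (auto simp: cinner_add_right)

lemma cinner_sum_left: "cinner (\<Sum>i\<in>F. f i) u = (\<Sum>i\<in>F. cinner (f i) u)"
  by (induction F rule: infinite_finite_induct) (auto simp: cinner_add_left)

lemma cinner_self: "cinner v v = complex_of_real ((norm v)\<^sup>2)"
proof -
  have "Im (cinner v v) = 0"
    using arg_cong[OF cinner_commute[of v v], of Im] by simp
  moreover have "Re (cinner v v) = (norm v)\<^sup>2"
    by (simp add: inner_ell2_def[symmetric] power2_norm_eq_inner)
  ultimately show ?thesis by (simp add: complex_eq_iff)
qed

text \<open>The real inner product is the real part of \<open>cinner\<close>, so its Cauchy-Schwarz
  inequality applies once w is rotated by a phase that makes \<open>cinner v w\<close> real and
  nonnegative.\<close>

lemma cinner_norm_le: "cmod (cinner v w) \<le> norm v * norm w"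
proof -
  let ?a = "cnj (sgn (cinner v w))"
  have "complex_of_real (cmod (cinner v w)) = ?a * cinner v w"
  proof (cases "cinner v w = 0")
    case False
    have "?a * cinner v w = cinner v w * cnj (cinner v w) / complex_of_real (cmod (cinner v w))"
      by (simp add: sgn_eq)
    also have "\<dots> = complex_of_real (cmod (cinner v w)) * complex_of_real (cmod (cinner v w))
        / complex_of_real (cmod (cinner v w))"
      by (simp only: complex_norm_square[symmetric] power2_eq_square of_real_mult)
    finally show ?thesis using False by simp
  qed simp
  then have "cmod (cinner v w) = Re (cinner v (scaleC_ell2 ?a w))"
    by (metis Re_complex_of_real cinner_scaleC_right)
  also have "\<dots> \<le> norm v * norm (scaleC_ell2 ?a w)"
    by (metis inner_ell2_def norm_cauchy_schwarz)
  also have "\<dots> \<le> norm v * norm w"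
    by (intro mult_left_mono) (auto simp: norm_scaleC_ell2 norm_sgn)
  finally show ?thesis .
qed

lemma cinner_ext_right: "(\<And>v. cinner v u = cinner v w) \<Longrightarrow> u = w"
proof -
  assume "\<And>v. cinner v u = cinner v w"
  then have "cinner (u - w) (u - w) = 0" by (simp add: cinner_diff_right)
  then show "u = w" by (simp add: cinner_self)
qed

lemma cinner_unit_left [simp]: "cinner (unit_ell2 r) v = ell2_nth v r"
proof -
  have "((\<lambda>i. cnj (ell2_nth (unit_ell2 r) i) * ell2_nth v i) has_sum ell2_nth v r) UNIV"
    by (rule has_sum_finite_neutralI[of "{r}"]) (auto simp: unit_ell2.rep_eq)
  with cinner_has_sum show ?thesis using has_sum_unique by blast
qed

lemma cinner_unit_right: "cinner v (unit_ell2 r) = cnj (ell2_nth v r)"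
  by (metis cinner_commute cinner_unit_left)

lemma cinner_unit_unit: "cinner (unit_ell2 i) (unit_ell2 j) = (if i = j then 1 else 0)"
  by (simp add: unit_ell2.rep_eq)

lemma norm_unit [simp]: "norm (unit_ell2 i) = 1"
proof -
  have "complex_of_real ((norm (unit_ell2 i))\<^sup>2) = 1"
    by (simp only: cinner_self[symmetric] cinner_unit_unit) simp
  then show ?thesis
    using norm_ge_zero[of "unit_ell2 i"] by (simp add: power2_eq_1_iff del: of_real_power)
qed

lemma ell2_eqI: "(\<And>i. ell2_nth v i = ell2_nth w i) \<Longrightarrow> v = w"
  by (simp add: ell2_nth_inject[symmetric] fun_eq_iff)

lemma norm_square_has_sum: "((\<lambda>i. (cmod (ell2_nth v i))\<^sup>2) has_sum (norm v)\<^sup>2) UNIV"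
proof -
  have s: "(\<lambda>i. (cmod (ell2_nth v i))\<^sup>2) summable_on UNIV"
    using ell2_nth[of v] by (simp add: square_summable_def)
  have "(norm v)\<^sup>2 = infsum (\<lambda>i. (cmod (ell2_nth v i))\<^sup>2) UNIV"
    by (simp add: power2_norm_eq_inner cinner_self_aux)
  with s show ?thesis by (simp only: has_sum_infsum)
qed

lemma scaleC_add_right: "scaleC_ell2 a (v + w) = scaleC_ell2 a v + scaleC_ell2 a w"
  by transfer (simp add: algebra_simps)

lemma scaleC_scaleC: "scaleC_ell2 a (scaleC_ell2 b v) = scaleC_ell2 (a * b) v"
  by transfer (simp add: algebra_simps)

lemma scaleC_zero_right [simp]: "scaleC_ell2 a 0 = 0"
  by transfer simp

lemma bounded_linear_cinner: "bounded_linear (cinner v)"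
proof (rule bounded_linear_intro)
  show "cinner v (u + w) = cinner v u + cinner v w" for u w by (rule cinner_add_right)
  show "cinner v (r *\<^sub>R u) = r *\<^sub>R cinner v u" for r u
    by (simp add: scaleR_ell2_def cinner_scaleC_right scaleR_conv_of_real)
  show "cmod (cinner v u) \<le> norm u * norm v" for u
    using cinner_norm_le[of v u] by (simp add: mult.commute)
qed

section \<open>Orthonormal families, Bessel's inequality and completeness\<close>

definition orthonormal_on :: "'i set \<Rightarrow> ('i \<Rightarrow> 'a ell2) \<Rightarrow> bool" where
  "orthonormal_on J e \<longleftrightarrow> (\<forall>i\<in>J. \<forall>j\<in>J. cinner (e i) (e j) = (if i = j then 1 else 0))"

lemma orthonormal_basis_on: "orthonormal_basis e \<Longrightarrow> orthonormal_on J e"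
  by (simp add: orthonormal_basis_def orthonormal_on_def)

lemma orthonormal_on_subset: "orthonormal_on J e \<Longrightarrow> K \<subseteq> J \<Longrightarrow> orthonormal_on K e"
  unfolding orthonormal_on_def by blast

lemma orthonormal_on_unit: "orthonormal_on J unit_ell2"
  by (simp add: orthonormal_on_def cinner_unit_unit del: cinner_unit_left)

lemma norm_orthonormal_combination:
  assumes "finite F" "orthonormal_on F e"
  shows "(norm (\<Sum>i\<in>F. scaleC_ell2 (a i) (e i)))\<^sup>2 = (\<Sum>i\<in>F. (cmod (a i))\<^sup>2)"
proof -
  let ?v = "\<Sum>i\<in>F. scaleC_ell2 (a i) (e i)"
  have "complex_of_real ((norm ?v)\<^sup>2) = cinner ?v ?v" by (simp add: cinner_self)
  also have "\<dots> = (\<Sum>i\<in>F. \<Sum>j\<in>F. cnj (a i) * (a j * cinner (e i) (e j)))"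
    by (simp only: cinner_sum_left cinner_scaleC_left sum_distrib_left cinner_sum_right cinner_scaleC_right)
       (subst sum.swap, simp add: mult_ac)
  also have "\<dots> = (\<Sum>i\<in>F. \<Sum>j\<in>F. if i = j then cnj (a i) * a i else 0)"
    using assms(2) unfolding orthonormal_on_def by (intro sum.cong) auto
  also have "\<dots> = (\<Sum>i\<in>F. complex_of_real ((cmod (a i))\<^sup>2))"
    using assms(1) by (simp add: complex_norm_square mult.commute del: of_real_power)
  finally show ?thesis by (metis of_real_eq_iff of_real_sum)
qed

lemma bessel:
  assumes "finite F" "orthonormal_on F e"
  shows "(\<Sum>i\<in>F. (cmod (cinner (e i) v))\<^sup>2) \<le> (norm v)\<^sup>2"
proof -
  let ?S = "\<Sum>i\<in>F. (cmod (cinner (e i) v))\<^sup>2"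
  let ?w = "\<Sum>i\<in>F. scaleC_ell2 (cinner (e i) v) (e i)"
  have w: "(norm ?w)\<^sup>2 = ?S" by (rule norm_orthonormal_combination[OF assms])
  have "cinner ?w v = (\<Sum>i\<in>F. complex_of_real ((cmod (cinner (e i) v))\<^sup>2))"
    by (simp add: cinner_sum_left cinner_scaleC_left complex_norm_square mult.commute del: of_real_power)
  then have "cinner ?w v = complex_of_real ?S" by simp
  then have "?S = inner ?w v" by (simp add: inner_ell2_def)
  moreover have "0 \<le> (norm (v - ?w))\<^sup>2" by simp
  ultimately show ?thesis
    using w by (simp add: power2_norm_eq_inner inner_diff_left inner_diff_right inner_commute)
qed

lemma bessel_summable:
  assumes "orthonormal_on J e"
  shows "(\<lambda>i. (cmod (cinner (e i) v))\<^sup>2) summable_on J"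
    and "(\<Sum>\<^sub>\<infinity>i\<in>J. (cmod (cinner (e i) v))\<^sup>2) \<le> (norm v)\<^sup>2"
proof -
  have b: "(\<Sum>i\<in>F. (cmod (cinner (e i) v))\<^sup>2) \<le> (norm v)\<^sup>2" if "finite F" "F \<subseteq> J" for F
    using bessel[OF that(1) orthonormal_on_subset[OF assms that(2)]] .
  show s: "(\<lambda>i. (cmod (cinner (e i) v))\<^sup>2) summable_on J"
    by (rule nonneg_bdd_above_summable_on) (auto intro!: bdd_aboveI[where M = "(norm v)\<^sup>2"] b)
  show "(\<Sum>\<^sub>\<infinity>i\<in>J. (cmod (cinner (e i) v))\<^sup>2) \<le> (norm v)\<^sup>2"
    by (rule infsum_le_finite_sums[OF s]) (auto intro: b)
qed

text \<open>The squared distance from v to a finite partial sum is the tail of the series for the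
  squared norm.\<close>

lemma unit_expansion: "((\<lambda>i. scaleC_ell2 (ell2_nth v i) (unit_ell2 i)) has_sum v) UNIV"
proof -
  let ?P = "\<lambda>F. \<Sum>i\<in>F. scaleC_ell2 (ell2_nth v i) (unit_ell2 i)"
  have nrm: "(norm (?P F - v))\<^sup>2 = (norm v)\<^sup>2 - (\<Sum>i\<in>F. (cmod (ell2_nth v i))\<^sup>2)" if "finite F" for F
  proof -
    have "(norm (?P F))\<^sup>2 = (\<Sum>i\<in>F. (cmod (ell2_nth v i))\<^sup>2)"
      by (rule norm_orthonormal_combination[OF that orthonormal_on_unit])
    moreover have "cinner (?P F) v = complex_of_real (\<Sum>i\<in>F. (cmod (ell2_nth v i))\<^sup>2)"
      by (simp add: cinner_sum_left cinner_scaleC_left complex_norm_square mult.commute del: of_real_power)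
    then have "inner (?P F) v = (\<Sum>i\<in>F. (cmod (ell2_nth v i))\<^sup>2)"
      by (simp add: inner_ell2_def)
    ultimately show ?thesis
      by (simp add: power2_norm_eq_inner inner_diff_left inner_diff_right inner_commute)
  qed
  have "((\<lambda>F. (norm v)\<^sup>2 - (\<Sum>i\<in>F. (cmod (ell2_nth v i))\<^sup>2)) \<longlongrightarrow> (norm v)\<^sup>2 - (norm v)\<^sup>2)
      (finite_subsets_at_top UNIV)"
    using norm_square_has_sum[of v] unfolding has_sum_def by (intro tendsto_intros)
  moreover have "\<forall>\<^sub>F F in finite_subsets_at_top UNIV.
      (norm v)\<^sup>2 - (\<Sum>i\<in>F. (cmod (ell2_nth v i))\<^sup>2) = (norm (?P F - v))\<^sup>2"
    by (intro eventually_finite_subsets_at_top_weakI) (simp add: nrm)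
  ultimately have "((\<lambda>F. (norm (?P F - v))\<^sup>2) \<longlongrightarrow> (norm v)\<^sup>2 - (norm v)\<^sup>2) (finite_subsets_at_top UNIV)"
    by (rule Lim_transform_eventually)
  then have "((\<lambda>F. sqrt ((norm (?P F - v))\<^sup>2)) \<longlongrightarrow> sqrt ((norm v)\<^sup>2 - (norm v)\<^sup>2)) (finite_subsets_at_top UNIV)"
    by (rule tendsto_real_sqrt)
  then have "((\<lambda>F. norm (?P F - v)) \<longlongrightarrow> 0) (finite_subsets_at_top UNIV)" by simp
  then have "((\<lambda>F. ?P F - v) \<longlongrightarrow> 0) (finite_subsets_at_top UNIV)"
    by (rule tendsto_norm_zero_cancel)
  then show ?thesis unfolding has_sum_def using LIM_zero_cancel by blast
qed

lemma square_summable_boundedI: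
  assumes "\<And>F. finite F \<Longrightarrow> (\<Sum>i\<in>F. (cmod (v i))\<^sup>2) \<le> B"
  shows "square_summable v"
  unfolding square_summable_def
  by (rule nonneg_bdd_above_summable_on) (auto intro!: bdd_aboveI[where M = B] assms)

lemma norm_ell2_boundedI:
  assumes "\<And>F. finite F \<Longrightarrow> (\<Sum>i\<in>F. (cmod (ell2_nth v i))\<^sup>2) \<le> B\<^sup>2" "0 \<le> B"
  shows "norm v \<le> B"
proof -
  have "(norm v)\<^sup>2 \<le> B\<^sup>2"
    by (rule has_sum_le_finite_sums[OF norm_square_has_sum]) (auto intro: assms)
  then show ?thesis using assms(2) by (simp add: abs_le_square_iff[symmetric])
qed

text \<open>The candidate is the coordinatewise limit. The Cauchy estimate on finite sets of
  coordinates, uniform in the set, yields both its square-summability and the convergence in norm.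
  This supplies the maximizing vector in the spectral theorem.\<close>

lemma ell2_Cauchy_convergent:
  fixes X :: "nat \<Rightarrow> 'a ell2"
  assumes "Cauchy X"
  shows "convergent X"
proof -
  have coord: "cmod (ell2_nth (v - w) i) \<le> norm (v - w)" for v w :: "'a ell2" and i
    using cinner_norm_le[of "unit_ell2 i" "v - w"] by simp
  have "Cauchy (\<lambda>n. ell2_nth (X n) i)" for i
  proof (rule metric_CauchyI)
    fix e :: real assume "0 < e"
    then obtain M where M: "\<And>m n. m \<ge> M \<Longrightarrow> n \<ge> M \<Longrightarrow> dist (X m) (X n) < e"
      using assms metric_CauchyD by blast
    have "dist (ell2_nth (X m) i) (ell2_nth (X n) i) < e" if "m \<ge> M" "n \<ge> M" for m n
      using coord[of "X m" "X n" i] M[OF that] by (simp add: dist_norm minus_ell2.rep_eq)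
    then show "\<exists>M. \<forall>m\<ge>M. \<forall>n\<ge>M. dist (ell2_nth (X m) i) (ell2_nth (X n) i) < e" by blast
  qed
  then have "\<exists>l. (\<lambda>n. ell2_nth (X n) i) \<longlonglongrightarrow> l" for i
    using Cauchy_convergent convergent_def by blast
  then obtain l where l: "\<And>i. (\<lambda>n. ell2_nth (X n) i) \<longlonglongrightarrow> l i" by metis
  have key: "\<exists>M. \<forall>n\<ge>M. \<forall>F. finite F \<longrightarrow> (\<Sum>i\<in>F. (cmod (ell2_nth (X n) i - l i))\<^sup>2) \<le> e\<^sup>2"
    if "0 < e" for e
  proof -
    obtain M where M: "\<And>m n. m \<ge> M \<Longrightarrow> n \<ge> M \<Longrightarrow> dist (X m) (X n) < e"
      using assms metric_CauchyD \<open>0 < e\<close> by blast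
    have "(\<Sum>i\<in>F. (cmod (ell2_nth (X n) i - l i))\<^sup>2) \<le> e\<^sup>2" if "n \<ge> M" "finite F" for n F
    proof (rule tendsto_upperbound)
      let ?S = "\<lambda>m. \<Sum>i\<in>F. (cmod (ell2_nth (X n) i - ell2_nth (X m) i))\<^sup>2"
      show "(\<lambda>m. ?S m)
          \<longlonglongrightarrow> (\<Sum>i\<in>F. (cmod (ell2_nth (X n) i - l i))\<^sup>2)"
        by (intro tendsto_intros l)
      have "?S m \<le> e\<^sup>2" if "m \<ge> M" for m
      proof -
        have "(\<Sum>i\<in>F. (cmod (cinner (unit_ell2 i) (X n - X m)))\<^sup>2) \<le> (norm (X n - X m))\<^sup>2"
          by (rule bessel[OF \<open>finite F\<close> orthonormal_on_unit])
        also have "\<dots> \<le> e\<^sup>2"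
          using M[OF \<open>n \<ge> M\<close> that] by (intro power_mono) (auto simp: dist_norm)
        finally show ?thesis by (simp add: minus_ell2.rep_eq)
      qed
      then show "\<forall>\<^sub>F m in sequentially. ?S m \<le> e\<^sup>2"
        using eventually_sequentially by blast
    qed simp
    then show ?thesis by blast
  qed
  obtain M where M: "\<And>F. finite F \<Longrightarrow> (\<Sum>i\<in>F. (cmod (ell2_nth (X M) i - l i))\<^sup>2) \<le> 1\<^sup>2"
    using key[of 1] by auto
  have "square_summable (\<lambda>i. ell2_nth (X M) i - l i)"
    by (rule square_summable_boundedI[OF M])
  then have "square_summable (\<lambda>i. ell2_nth (X M) i + (-1) * (ell2_nth (X M) i - l i))"
    using ell2_nth[of "X M"] by (intro square_summable_add square_summable_mult) auto
  then have "square_summable l" by simp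
  then have L: "ell2_nth (Abs_ell2 l) = l" by (simp add: Abs_ell2_inverse)
  have "X \<longlonglongrightarrow> Abs_ell2 l"
  proof (rule metric_LIMSEQ_I)
    fix e :: real assume "0 < e"
    then obtain M where M: "\<And>n F. n \<ge> M \<Longrightarrow> finite F \<Longrightarrow> (\<Sum>i\<in>F. (cmod (ell2_nth (X n) i - l i))\<^sup>2) \<le> (e/2)\<^sup>2"
      using key[of "e/2"] by auto
    have "norm (X n - Abs_ell2 l) \<le> e/2" if "n \<ge> M" for n
      using M[OF that] \<open>0 < e\<close> by (intro norm_ell2_boundedI) (auto simp: minus_ell2.rep_eq L)
    then show "\<exists>M. \<forall>n\<ge>M. dist (X n) (Abs_ell2 l) < e"
      using \<open>0 < e\<close> by (intro exI[of _ M]) (force simp: dist_norm)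
  qed
  then show ?thesis by (rule convergentI)
qed

section \<open>Adjoints, orthonormal bases and powers\<close>

lemma clinear_op_scaleC: "clinear_op x \<Longrightarrow> x (scaleC_ell2 a v) = scaleC_ell2 a (x v)"
  by (simp add: clinear_op_def)

lemma scaleR_scaleC: "r *\<^sub>R v = scaleC_ell2 (complex_of_real r) v"
  by (rule scaleR_ell2_def)

lemma cinner_scaleR_right: "cinner u (r *\<^sub>R v) = of_real r * cinner u v"
  by (simp add: scaleR_scaleC cinner_scaleC_right)

lemma cinner_scaleR_left: "cinner (r *\<^sub>R u) v = of_real r * cinner u v"
  by (simp add: scaleR_scaleC cinner_scaleC_left)

lemma clinear_op_exists:
  fixes f :: "'c ell2 \<Rightarrow> 'r ell2"
  assumes "\<And>v w. f (v + w) = f v + f w"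
    and "\<And>a v. f (scaleC_ell2 a v) = scaleC_ell2 a (f v)"
    and "\<And>v. norm (f v) \<le> norm v * K"
  shows "\<exists>y :: ('c, 'r) ell2_op. clinear_op y \<and> (\<forall>v. y v = f v)"
proof -
  have "bounded_linear f"
    using assms by (intro bounded_linear_intro[of f K]) (auto simp: scaleR_scaleC)
  then have "blinfun_apply (Blinfun f) = f" by (rule bounded_linear_Blinfun_apply)
  then show ?thesis using assms(2) unfolding clinear_op_def by metis
qed

text \<open>The adjoint is built by coordinates. Their square-summability follows by testing x on
  the finite combination of unit vectors that has these same coordinates as coefficients, and
  dividing by its norm.\<close>

lemma adjoint_exists:
  fixes x :: "('c, 'r) ell2_op"
  assumes "clinear_op x"
  shows "\<exists>y :: ('r, 'c) ell2_op. clinear_op y \<and> (\<forall>v w. cinner (x v) w = cinner v (y w))"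
proof -
  have sum: "(\<Sum>c\<in>F. (cmod (cinner (x (unit_ell2 c)) w))\<^sup>2) \<le> (norm w * norm x)\<^sup>2"
    if F: "finite F" for F w
  proof -
    let ?a = "\<lambda>c. cinner (x (unit_ell2 c)) w"
    let ?S = "\<Sum>c\<in>F. (cmod (?a c))\<^sup>2"
    let ?v = "\<Sum>c\<in>F. scaleC_ell2 (?a c) (unit_ell2 c)"
    have S: "(norm ?v)\<^sup>2 = ?S" by (rule norm_orthonormal_combination[OF F orthonormal_on_unit])
    have "cinner (x ?v) w = (\<Sum>c\<in>F. complex_of_real ((cmod (?a c))\<^sup>2))"
      by (simp add: blinfun.sum_right clinear_op_scaleC[OF assms] cinner_sum_left cinner_scaleC_left
          complex_norm_square mult.commute del: of_real_power)
    then have "cinner (x ?v) w = complex_of_real ?S" by simp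
    then have "cmod (cinner (x ?v) w) = ?S"
      by (simp add: sum_nonneg del: of_real_sum)
    moreover have "cmod (cinner (x ?v) w) \<le> (norm x * norm ?v) * norm w"
      by (meson cinner_norm_le mult_right_mono norm_blinfun norm_ge_zero order_trans)
    ultimately have "norm ?v * norm ?v \<le> (norm w * norm x) * norm ?v"
      using S by (simp add: power2_eq_square mult_ac)
    then have "norm ?v \<le> norm w * norm x"
      by (cases "norm ?v = 0") auto
    then show ?thesis using S power_mono[of "norm ?v" "norm w * norm x" 2] by simp
  qed
  define f where "f w = Abs_ell2 (\<lambda>c. cinner (x (unit_ell2 c)) w)" for w
  have f: "ell2_nth (f w) c = cinner (x (unit_ell2 c)) w" for w c
    unfolding f_def using square_summable_boundedI[OF sum] by (simp add: Abs_ell2_inverse)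
  have "\<exists>y :: ('r, 'c) ell2_op. clinear_op y \<and> (\<forall>v. y v = f v)"
  proof (rule clinear_op_exists)
    show "f (v + w) = f v + f w" for v w
      by (rule ell2_eqI) (simp add: f plus_ell2.rep_eq cinner_add_right)
    show "f (scaleC_ell2 a v) = scaleC_ell2 a (f v)" for a v
      by (rule ell2_eqI) (simp add: f scaleC_ell2.rep_eq cinner_scaleC_right)
    show "norm (f w) \<le> norm w * norm x" for w
      by (rule norm_ell2_boundedI) (auto simp: f sum)
  qed
  then obtain y :: "('r, 'c) ell2_op" where y: "clinear_op y" "\<And>w. y w = f w" by blast
  have "cinner w (x v) = cinner (f w) v" for v w
  proof -
    have "bounded_linear (\<lambda>v. cinner w (x v))"
      by (rule bounded_linear_compose[OF bounded_linear_cinner blinfun.bounded_linear_right])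
    from has_sum_bounded_linear[OF this unit_expansion[of v]]
    have "((\<lambda>i. cnj (ell2_nth (f w) i) * ell2_nth v i) has_sum cinner w (x v)) UNIV"
      by (simp add: o_def clinear_op_scaleC[OF assms] cinner_scaleC_right f cinner_commute[of w] mult.commute)
    then show ?thesis using cinner_has_sum has_sum_unique by blast
  qed
  then show ?thesis using y by (metis cinner_commute)
qed

lemma adjoint_op:
  assumes "clinear_op x"
  shows "clinear_op (adjoint_op x)" and "cinner (x v) w = cinner v (adjoint_op x w)"
proof -
  obtain y where y: "clinear_op y" "\<forall>v w. cinner (x v) w = cinner v (y w)"
    using adjoint_exists[OF assms] by blast
  have "adjoint_op x = y"
    unfolding adjoint_op_def
  proof (rule the_equality)
    show "\<forall>v w. cinner (x v) w = cinner v (y w)" by (rule y)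
    fix z assume "\<forall>v w. cinner (x v) w = cinner v (blinfun_apply z w)"
    then show "z = y" using y(2) by (intro blinfun_eqI cinner_ext_right) metis
  qed
  with y show "clinear_op (adjoint_op x)" and "cinner (x v) w = cinner v (adjoint_op x w)" by auto
qed

lemma adjoint_op_left:
  assumes "clinear_op x"
  shows "cinner w (x v) = cinner (adjoint_op x w) v"
  using adjoint_op(2)[OF assms, of v w] by (metis cinner_commute)

lemma basis_ext:
  assumes "orthonormal_basis e" "\<And>i. cinner (e i) v = cinner (e i) w"
  shows "v = w"
  using assms unfolding orthonormal_basis_def
  by (metis cinner_diff_right eq_iff_diff_eq_0)

section \<open>Change of basis, diagonal operators and real powers\<close>

lemma orthonormal_basis_cinner:
  "orthonormal_basis e \<Longrightarrow> cinner (e i) (e j) = (if i = j then 1 else 0)"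
  by (simp add: orthonormal_basis_def)

text \<open>A basis is indexed by the type of the coordinates, so the coefficient map is an operator
  of the space into itself. Bessel's inequality bounds it.\<close>

lemma unitary_exists:
  fixes e :: "'a \<Rightarrow> 'a ell2"
  assumes "orthonormal_basis e"
  shows "\<exists>U :: ('a, 'a) ell2_op. clinear_op U \<and> (\<forall>v i. ell2_nth (U v) i = cinner (e i) v)"
proof -
  define f where "f v = Abs_ell2 (\<lambda>i. cinner (e i) v)" for v
  have b: "(\<Sum>i\<in>F. (cmod (cinner (e i) v))\<^sup>2) \<le> (norm v)\<^sup>2" if "finite F" for F v
    by (rule bessel[OF that orthonormal_basis_on[OF assms]])
  have f: "ell2_nth (f v) i = cinner (e i) v" for v i
    unfolding f_def using square_summable_boundedI[OF b] by (simp add: Abs_ell2_inverse)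
  have "\<exists>y :: ('a, 'a) ell2_op. clinear_op y \<and> (\<forall>v. y v = f v)"
  proof (rule clinear_op_exists)
    show "f (v + w) = f v + f w" for v w
      by (rule ell2_eqI) (simp add: f plus_ell2.rep_eq cinner_add_right)
    show "f (scaleC_ell2 a v) = scaleC_ell2 a (f v)" for a v
      by (rule ell2_eqI) (simp add: f scaleC_ell2.rep_eq cinner_scaleC_right)
    show "norm (f w) \<le> norm w * 1" for w
      by (rule norm_ell2_boundedI) (auto simp: f b)
  qed
  then show ?thesis using f by metis
qed

lemma unitary_adjoint:
  assumes "orthonormal_basis e" "clinear_op U" "\<And>v i. ell2_nth (U v) i = cinner (e i) v"
  shows "adjoint_op U (unit_ell2 i) = e i" and "U (e i) = unit_ell2 i"
    and "adjoint_op U (U v) = v"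
proof -
  show 1: "adjoint_op U (unit_ell2 i) = e i" for i
  proof (rule cinner_ext_right)
    fix v
    have "cinner v (adjoint_op U (unit_ell2 i)) = cnj (ell2_nth (U v) i)"
      by (simp add: adjoint_op(2)[OF assms(2), symmetric] cinner_unit_right)
    then show "cinner v (adjoint_op U (unit_ell2 i)) = cinner v (e i)"
      using assms(3) cinner_commute[of v "e i"] by simp
  qed
  show "U (e i) = unit_ell2 i"
    by (rule ell2_eqI) (simp add: assms(3) orthonormal_basis_cinner[OF assms(1)] unit_ell2.rep_eq)
  show "adjoint_op U (U v) = v"
  proof (rule basis_ext[OF assms(1)])
    fix i
    have "cinner (e i) (adjoint_op U (U v)) = cinner (U (e i)) (U v)"
      by (simp add: adjoint_op(2)[OF assms(2)])
    also have "U (e i) = unit_ell2 i"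
      by (rule ell2_eqI) (simp add: assms(3) orthonormal_basis_cinner[OF assms(1)] unit_ell2.rep_eq)
    finally show "cinner (e i) (adjoint_op U (U v)) = cinner (e i) v"
      by (simp add: assms(3))
  qed
qed

text \<open>Totality of the basis turns Bessel's inequality into an equality: the coefficient map U
  satisfies U* U = 1, hence preserves \<open>cinner\<close>.\<close>

lemma parseval:
  fixes e :: "'a \<Rightarrow> 'a ell2"
  assumes "orthonormal_basis e"
  shows "((\<lambda>i. cnj (cinner (e i) v) * cinner (e i) w) has_sum cinner v w) UNIV"
proof -
  obtain U where U: "clinear_op U" "\<And>v i. ell2_nth (blinfun_apply U v) i = cinner (e i) v"
    using unitary_exists[OF assms] by metis
  have "cinner v w = cinner (U v) (U w)"
    using unitary_adjoint(3)[OF assms U] by (simp add: adjoint_op(2)[OF U(1)])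
  then show ?thesis using cinner_has_sum[of "U v" "U w"] by (simp add: U(2))
qed

lemma diagonal_op_exists:
  fixes e :: "'a \<Rightarrow> 'a ell2"
  assumes e: "orthonormal_basis e" and d: "\<And>i. cmod (d i) \<le> K"
  shows "\<exists>y. clinear_op y \<and> (\<forall>i. y (e i) = scaleC_ell2 (d i) (e i))"
proof -
  obtain U where U: "clinear_op U" "\<And>v i. ell2_nth (blinfun_apply U v) i = cinner (e i) v"
    using unitary_exists[OF e] by metis
  have K: "0 \<le> K" using d[of undefined] norm_ge_zero order_trans by blast
  have b: "(\<Sum>i\<in>F. (cmod (d i * ell2_nth v i))\<^sup>2) \<le> (norm v * K)\<^sup>2" if "finite F" for F v
  proof -
    have "(\<Sum>i\<in>F. (cmod (d i * ell2_nth v i))\<^sup>2) \<le> (\<Sum>i\<in>F. K\<^sup>2 * (cmod (ell2_nth v i))\<^sup>2)"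
      by (intro sum_mono) (auto simp: norm_mult power_mult_distrib intro!: mult_right_mono power_mono d)
    also have "\<dots> = K\<^sup>2 * (\<Sum>i\<in>F. (cmod (cinner (unit_ell2 i) v))\<^sup>2)"
      by (simp add: sum_distrib_left)
    also have "\<dots> \<le> K\<^sup>2 * (norm v)\<^sup>2"
      by (intro mult_left_mono bessel[OF that orthonormal_on_unit]) auto
    finally show ?thesis by (simp add: power_mult_distrib mult.commute)
  qed
  define f where "f v = Abs_ell2 (\<lambda>i. d i * ell2_nth v i)" for v
  have f: "ell2_nth (f v) i = d i * ell2_nth v i" for v i
    unfolding f_def using square_summable_boundedI[OF b] by (simp add: Abs_ell2_inverse)
  have "\<exists>y :: ('a, 'a) ell2_op. clinear_op y \<and> (\<forall>v. y v = f v)"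
  proof (rule clinear_op_exists)
    show "f (v + w) = f v + f w" for v w
      by (rule ell2_eqI) (simp add: f plus_ell2.rep_eq algebra_simps)
    show "f (scaleC_ell2 a v) = scaleC_ell2 a (f v)" for a v
      by (rule ell2_eqI) (simp add: f scaleC_ell2.rep_eq)
    show "norm (f w) \<le> norm w * K" for w
      by (rule norm_ell2_boundedI) (auto simp: f b K)
  qed
  then obtain D :: "('a, 'a) ell2_op" where D: "clinear_op D" "\<And>v. D v = f v" by blast
  define y where "y = adjoint_op U o\<^sub>L (D o\<^sub>L U)"
  have "clinear_op y"
    unfolding clinear_op_def y_def
    by (simp add: clinear_op_scaleC[OF U(1)] clinear_op_scaleC[OF D(1)] clinear_op_scaleC[OF adjoint_op(1)[OF U(1)]])
  moreover have "y (e i) = scaleC_ell2 (d i) (e i)" for i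
  proof -
    have "f (unit_ell2 i) = scaleC_ell2 (d i) (unit_ell2 i)"
      by (rule ell2_eqI) (simp add: f scaleC_ell2.rep_eq unit_ell2.rep_eq)
    then show ?thesis
      by (simp add: y_def D(2) unitary_adjoint[OF e U] clinear_op_scaleC[OF adjoint_op(1)[OF U(1)]])
  qed
  ultimately show ?thesis by blast
qed

lemma adjoint_diagonal:
  assumes e: "orthonormal_basis e" and y: "clinear_op y" "\<And>i. y (e i) = (d i :: real) *\<^sub>R e i"
  shows "adjoint_op y (e i) = d i *\<^sub>R e i"
proof (rule basis_ext[OF e])
  fix j
  show "cinner (e j) (adjoint_op y (e i)) = cinner (e j) (d i *\<^sub>R e i)"
    by (simp add: adjoint_op(2)[OF y(1), symmetric] y(2) cinner_scaleR_left cinner_scaleR_right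
        orthonormal_basis_cinner[OF e])
qed

text \<open>Agreement on the basis means that the adjoints have equal coefficients, hence are equal;
  the operators are then recovered from their adjoints.\<close>

lemma op_ext_basis:
  assumes e: "orthonormal_basis e" and y: "clinear_op y" and z: "clinear_op z"
    and eq: "\<And>i. blinfun_apply y (e i) = z (e i)"
  shows "y = z"
proof -
  have "adjoint_op y w = adjoint_op z w" for w
    by (rule basis_ext[OF e])
      (metis adjoint_op(2) eq y z)
  then show ?thesis
    by (intro blinfun_eqI cinner_ext_right) (metis adjoint_op_left y z)
qed

lemma power_op:
  fixes t :: "('a, 'a) ell2_op" and e :: "'a \<Rightarrow> 'a ell2"
  assumes t: "\<And>v w. cinner (t v) w = cinner v (t w)"
    and e: "orthonormal_basis e" and l: "\<And>i. 0 \<le> l i" "\<And>i. t (e i) = l i *\<^sub>R e i" and s: "0 \<le> s"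
  shows "clinear_op (power_op t s)" and "power_op t s (e i) = (l i powr s) *\<^sub>R e i"
proof -
  let ?P = "\<lambda>y. clinear_op y \<and>
     (\<exists>(e :: 'a \<Rightarrow> 'a ell2) (l :: 'a \<Rightarrow> real). orthonormal_basis e \<and>
        (\<forall>i. 0 \<le> l i \<and> t (e i) = l i *\<^sub>R e i \<and> y (e i) = (l i powr s) *\<^sub>R e i))"
  have nrm: "norm (e i) = 1" for i
    using cinner_self[of "e i"] orthonormal_basis_cinner[OF e, of i i] norm_ge_zero[of "e i"]
    by (simp add: power2_eq_1_iff flip: of_real_power)
  have "cmod (complex_of_real (l i powr s)) \<le> norm t powr s" for i
  proof -
    have "l i = norm (t (e i))" using l nrm by simp
    also have "\<dots> \<le> norm t" using norm_blinfun[of t "e i"] nrm by simp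
    finally show ?thesis using l(1) s by (simp add: powr_mono2)
  qed
  from diagonal_op_exists[OF e, of "\<lambda>i. complex_of_real (l i powr s)", OF this] obtain y
    where y: "clinear_op y" "\<And>i. y (e i) = (l i powr s) *\<^sub>R e i"
    by (metis scaleR_scaleC)
  have "power_op t s = y"
    unfolding power_op_def
  proof (rule the_equality)
    show "?P y" using y e l by blast
    fix y' assume "?P y'"
    then obtain e' :: "'a \<Rightarrow> 'a ell2" and l' where y': "clinear_op y'" and e': "orthonormal_basis e'"
      and l': "\<And>i. 0 \<le> l' i" "\<And>i. t (e' i) = l' i *\<^sub>R e' i" "\<And>i. y' (e' i) = (l' i powr s) *\<^sub>R e' i"
      by metis
    have "y (e' j) = y' (e' j)" for j
    proof (rule basis_ext[OF e])
      fix i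
      \<comment> \<open>As t is symmetric, \<open>e i\<close> and \<open>e' j\<close> are orthogonal
        unless their eigenvalues agree. So two eigenbases define the same power.\<close>
      have "l i * cinner (e i) (e' j) = l' j * cinner (e i) (e' j)"
        using t[of "e i" "e' j"] by (simp add: l l' cinner_scaleR_left cinner_scaleR_right)
      then have "(l i powr s) * cinner (e i) (e' j) = (l' j powr s) * cinner (e i) (e' j)"
        by (cases "cinner (e i) (e' j) = 0") auto
      then show "cinner (e i) (y (e' j)) = cinner (e i) (y' (e' j))"
        by (simp add: l' adjoint_op_left[OF y(1)] adjoint_diagonal[OF e y] cinner_scaleR_left cinner_scaleR_right)
    qed
    then show "y' = y" using op_ext_basis[OF e' y(1) y'] by metis
  qed
  with y show "clinear_op (power_op t s)" and "power_op t s (e i) = (l i powr s) *\<^sub>R e i" by auto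
qed

section \<open>Sums of nonnegative terms and the trace in an eigenbasis\<close>

lemma has_sum_ennreal:
  assumes "(f has_sum S) A" "\<And>i. i \<in> A \<Longrightarrow> 0 \<le> f i"
  shows "((\<lambda>i. ennreal (f i)) has_sum ennreal S) A"
proof -
  have "((\<lambda>F. ennreal (sum f F)) \<longlongrightarrow> ennreal S) (finite_subsets_at_top A)"
    using assms(1) unfolding has_sum_def by (intro tendsto_intros)
  moreover have "\<forall>\<^sub>F F in finite_subsets_at_top A. ennreal (sum f F) = (\<Sum>i\<in>F. ennreal (f i))"
    using assms(2) by (intro eventually_finite_subsets_at_top_weakI) (metis subsetD sum_ennreal)
  ultimately show ?thesis unfolding has_sum_def by (rule Lim_transform_eventually)
qed

lemma ennreal_summable_on:
  fixes f :: "'i \<Rightarrow> ennreal"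
  shows "f summable_on A"
  by (simp add: nonneg_summable_on_complete)

lemma infsum_ennreal_sum:
  fixes f :: "'i \<Rightarrow> 'j \<Rightarrow> ennreal"
  assumes "finite F"
  shows "(\<Sum>\<^sub>\<infinity>j\<in>B. \<Sum>i\<in>F. f i j) = (\<Sum>i\<in>F. \<Sum>\<^sub>\<infinity>j\<in>B. f i j)"
  using assms by induction (auto simp: infsum_add ennreal_summable_on)

lemma infsum_ennreal_swap_le:
  fixes f :: "'i \<Rightarrow> 'j \<Rightarrow> ennreal"
  shows "(\<Sum>\<^sub>\<infinity>i\<in>A. \<Sum>\<^sub>\<infinity>j\<in>B. f i j) \<le> (\<Sum>\<^sub>\<infinity>j\<in>B. \<Sum>\<^sub>\<infinity>i\<in>A. f i j)"
proof (rule infsum_le_finite_sums)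
  fix F assume "finite F" "F \<subseteq> A"
  then have "(\<Sum>i\<in>F. \<Sum>\<^sub>\<infinity>j\<in>B. f i j) = (\<Sum>\<^sub>\<infinity>j\<in>B. \<Sum>i\<in>F. f i j)"
    by (simp add: infsum_ennreal_sum)
  also have "\<dots> \<le> (\<Sum>\<^sub>\<infinity>j\<in>B. \<Sum>\<^sub>\<infinity>i\<in>A. f i j)"
  proof (rule infsum_mono[OF ennreal_summable_on ennreal_summable_on])
    fix j
    show "(\<Sum>i\<in>F. f i j) \<le> (\<Sum>\<^sub>\<infinity>i\<in>A. f i j)"
      using infsum_mono_neutral[of "\<lambda>i. f i j" F "\<lambda>i. f i j" A] \<open>finite F\<close> \<open>F \<subseteq> A\<close>
      by (auto simp: ennreal_summable_on)
  qed
  finally show "(\<Sum>i\<in>F. \<Sum>\<^sub>\<infinity>j\<in>B. f i j) \<le> (\<Sum>\<^sub>\<infinity>j\<in>B. \<Sum>\<^sub>\<infinity>i\<in>A. f i j)" .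
qed (rule ennreal_summable_on)

lemma infsum_ennreal_swap:
  fixes f :: "'i \<Rightarrow> 'j \<Rightarrow> ennreal"
  shows "(\<Sum>\<^sub>\<infinity>i\<in>A. \<Sum>\<^sub>\<infinity>j\<in>B. f i j) = (\<Sum>\<^sub>\<infinity>j\<in>B. \<Sum>\<^sub>\<infinity>i\<in>A. f i j)"
  by (rule antisym) (rule infsum_ennreal_swap_le)+

text \<open>By Parseval the trace is the double sum of
  \<open>d j * (cmod (ell2_nth (e j) i))\<^sup>2\<close>. Summing over i before j leaves
  \<open>d j\<close>, because \<open>e j\<close> is a unit vector.\<close>

lemma trace_pos_diagonal:
  fixes y :: "('a, 'a) ell2_op" and e :: "'a \<Rightarrow> 'a ell2"
  assumes e: "orthonormal_basis e" and y: "clinear_op y" "\<And>i. y (e i) = (d i :: real) *\<^sub>R e i"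
    and d: "\<And>i. 0 \<le> d i"
  shows "trace_pos y = (\<Sum>\<^sub>\<infinity>j. ennreal (d j))"
proof -
  have row: "ennreal (Re (coefficient y i i)) = (\<Sum>\<^sub>\<infinity>j. ennreal (d j * (cmod (ell2_nth (e j) i))\<^sup>2))" for i
  proof -
    have "((\<lambda>j. cnj (cinner (e j) (unit_ell2 i)) * cinner (e j) (y (unit_ell2 i)))
        has_sum coefficient y i i) UNIV"
      unfolding coefficient_def by (rule parseval[OF e])
    moreover have "cinner (e j) (y (unit_ell2 i)) = of_real (d j) * cinner (e j) (unit_ell2 i)" for j
      by (simp add: adjoint_op_left[OF y(1)] adjoint_diagonal[OF e y] cinner_scaleR_left)
    moreover have "cnj (cinner (e j) (unit_ell2 i)) * (of_real (d j) * cinner (e j) (unit_ell2 i)) =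
        complex_of_real (d j * (cmod (ell2_nth (e j) i))\<^sup>2)" for j
      by (simp add: cinner_unit_right complex_norm_square del: of_real_power)
    ultimately have "((\<lambda>j. complex_of_real (d j * (cmod (ell2_nth (e j) i))\<^sup>2))
        has_sum coefficient y i i) UNIV"
      by simp
    from has_sum_Re[OF this] have "((\<lambda>j. d j * (cmod (ell2_nth (e j) i))\<^sup>2)
        has_sum Re (coefficient y i i)) UNIV" by simp
    from has_sum_ennreal[OF this] show ?thesis
      using d by (simp add: infsumI)
  qed
  have col: "(\<Sum>\<^sub>\<infinity>i. ennreal (d j * (cmod (ell2_nth (e j) i))\<^sup>2)) = ennreal (d j)" for j
  proof -
    have "(norm (e j))\<^sup>2 = 1"
      using cinner_self[of "e j"] orthonormal_basis_cinner[OF e, of j j]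
      by (simp flip: of_real_power)
    then have "((\<lambda>i. d j * (cmod (ell2_nth (e j) i))\<^sup>2) has_sum d j * 1) UNIV"
      using norm_square_has_sum[of "e j"] by (intro has_sum_cmult_right) simp
    from has_sum_ennreal[OF this] show ?thesis
      using d by (simp add: infsumI)
  qed
  show ?thesis
    unfolding trace_pos_def row by (subst infsum_ennreal_swap) (simp add: col)
qed

text \<open>f consists of right singular vectors and s of the singular values with multiplicity. The
  value 0 is allowed, so that f can be a full basis; only the orthogonality of the images is
  recorded, which avoids the adjoint.\<close>

definition singular_system :: "('a, 'b) ell2_op \<Rightarrow> ('a \<Rightarrow> 'a ell2) \<Rightarrow> ('a \<Rightarrow> real) \<Rightarrow> bool" where
  "singular_system x f s \<longleftrightarrow> orthonormal_basis f \<and> (\<forall>i. 0 \<le> s i) \<and>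
     (\<forall>i j. cinner (x (f i)) (x (f j)) = (if i = j then complex_of_real ((s i)\<^sup>2) else 0))"

lemma schatten_trace_singular_system:
  assumes x: "clinear_op x" and f: "singular_system x f s" and p: "0 < p"
  shows "schatten_trace p x = (\<Sum>\<^sub>\<infinity>i. ennreal (s i powr p))"
proof -
  let ?t = "adjoint_op x o\<^sub>L x"
  have e: "orthonormal_basis f" and s: "\<And>i. 0 \<le> s i"
    and xx: "\<And>i j. cinner (x (f i)) (x (f j)) = (if i = j then complex_of_real ((s i)\<^sup>2) else 0)"
    using f by (auto simp: singular_system_def)
  have sym: "cinner (?t v) w = cinner v (?t w)" for v w
    using adjoint_op(2)[OF x, of v "x w"] adjoint_op_left[OF x, of "x v" w] by simp
  have ev: "?t (f i) = (s i)\<^sup>2 *\<^sub>R f i" for i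
    by (rule basis_ext[OF e])
      (simp add: adjoint_op(2)[OF x, symmetric] xx cinner_scaleR_right orthonormal_basis_cinner[OF e])
  have pw: "((s i)\<^sup>2) powr (p / 2) = s i powr p" for i
    using s[of i] by (cases "s i = 0") (auto simp: powr_powr simp flip: powr_numeral)
  have "0 \<le> p / 2" using p by simp
  note po = power_op[OF sym e _ ev this]
  show ?thesis
    unfolding schatten_trace_def
    by (subst trace_pos_diagonal[OF e po(1) po(2)]) (auto simp: pw)
qed

section \<open>The spectral theorem for compact operators\<close>

lemma compact_op_clinear: "compact_op x \<Longrightarrow> clinear_op x"
  by (simp add: compact_op_def)

lemma parallelogram_ell2:
  fixes a b :: "'a ell2"
  shows "(norm (a - b))\<^sup>2 = 2 * (norm a)\<^sup>2 + 2 * (norm b)\<^sup>2 - (norm (a + b))\<^sup>2"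
  by (simp add: power2_norm_eq_inner inner_diff_left inner_diff_right inner_add_left inner_add_right inner_commute)

text \<open>By compactness a maximizing sequence y of unit vectors can be chosen with convergent
  images. The image of \<open>y m + y n\<close> then has norm close to 2 \<mu>, so
  \<open>y m + y n\<close> has norm close to 2, and the parallelogram law makes y itself a Cauchy
  sequence. When \<mu> = 0, any unit vector of the complement will do.\<close>

lemma norm_attained_on_complement:
  fixes x :: "('a, 'b) ell2_op" and M :: "'a ell2 set"
  assumes x: "compact_op x" and v0: "v0 \<noteq> 0" "\<And>m. m \<in> M \<Longrightarrow> cinner m v0 = 0"
  obtains v \<mu> where "norm v = 1" "\<And>m. m \<in> M \<Longrightarrow> cinner m v = 0" "norm (x v) = \<mu>"
    "\<And>w. (\<And>m. m \<in> M \<Longrightarrow> cinner m w = 0) \<Longrightarrow> norm (x w) \<le> \<mu> * norm w"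
proof -
  define L where "L = {v. \<forall>m\<in>M. cinner m v = 0}"
  define A where "A = {norm (x v) | v. v \<in> L \<and> norm v = 1}"
  define \<mu> where "\<mu> = Sup A"
  have Lscale: "r *\<^sub>R v \<in> L" if "v \<in> L" for r v
    using that by (simp add: L_def cinner_scaleR_right)
  have Ladd: "v + w \<in> L" if "v \<in> L" "w \<in> L" for v w
    using that by (simp add: L_def cinner_add_right)
  define w0 where "w0 = (1 / norm v0) *\<^sub>R v0"
  have w0: "w0 \<in> L" "norm w0 = 1"
    unfolding w0_def using v0 by (auto simp: L_def cinner_scaleR_right)
  then have ne: "A \<noteq> {}" unfolding A_def by blast
  have bdd: "bdd_above A"
  proof (rule bdd_aboveI[of _ "norm x"])
    fix a assume "a \<in> A"
    then obtain v where "a = norm (x v)" "norm v = 1" unfolding A_def by blast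
    then show "a \<le> norm x" using norm_blinfun[of x v] by simp
  qed
  have le: "norm (x w) \<le> \<mu> * norm w" if "w \<in> L" for w
  proof (cases "w = 0")
    case False
    have "(1 / norm w) *\<^sub>R w \<in> L" "norm ((1 / norm w) *\<^sub>R w) = 1"
      using False that Lscale by auto
    then have "norm (x ((1 / norm w) *\<^sub>R w)) \<in> A" unfolding A_def by blast
    then have "norm (x ((1 / norm w) *\<^sub>R w)) \<le> \<mu>"
      unfolding \<mu>_def using bdd by (rule cSup_upper)
    then show ?thesis using False by (simp add: blinfun.scaleR_right field_simps)
  qed simp
  have \<mu>0: "0 \<le> \<mu>" using le[OF w0(1)] w0(2) norm_ge_zero[of "x w0"] by (metis mult.right_neutral order_trans)
  show thesis
  proof (cases "\<mu> = 0")
    case True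
    then have "norm (x w0) = \<mu>" using le[OF w0(1)] by simp
    then show thesis using w0 le by (intro that[of w0 \<mu>]) (auto simp: L_def)
  next
    case False
    then have \<mu>: "0 < \<mu>" using \<mu>0 by simp
    have "\<exists>v. v \<in> L \<and> norm v = 1 \<and> \<mu> - 1 / real (Suc n) < norm (x v)" for n
    proof -
      have "\<mu> - 1 / real (Suc n) < Sup A" unfolding \<mu>_def by simp
      then obtain a where "a \<in> A" "\<mu> - 1 / real (Suc n) < a"
        using less_cSup_iff[OF ne bdd] by blast
      then show ?thesis unfolding A_def by blast
    qed
    then obtain v where v: "\<And>n. v n \<in> L" "\<And>n. norm (v n) = 1" "\<And>n. \<mu> - 1 / real (Suc n) < norm (x (v n))"
      by metis
    have "compact (closure (blinfun_apply x ` cball 0 1))" using x by (simp add: compact_op_def)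
    moreover have "\<forall>n. x (v n) \<in> closure (blinfun_apply x ` cball 0 1)"
      using v(2) closure_subset by (force simp: image_iff)
    ultimately obtain u r where r: "strict_mono r" "((\<lambda>n. x (v n)) \<circ> r) \<longlonglongrightarrow> u"
      unfolding compact_def by (elim allE[of _ "\<lambda>n. blinfun_apply x (v n)"]) blast
    define y where "y n = v (r n)" for n
    have yL: "y n \<in> L" and y1: "norm (y n) = 1" for n using v by (auto simp: y_def)
    have xy: "(\<lambda>n. x (y n)) \<longlonglongrightarrow> u" using r(2) by (simp add: y_def o_def)
    have "(\<lambda>n. norm (x (y n))) \<longlonglongrightarrow> \<mu>"
    proof (rule tendsto_sandwich)
      have "\<mu> - 1 / real (Suc n) \<le> norm (x (y n))" for n
      proof -
        have "1 / real (Suc (r n)) \<le> 1 / real (Suc n)"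
          using seq_suble[OF r(1), of n] by (simp add: frac_le)
        then show ?thesis using v(3)[of "r n"] by (simp add: y_def)
      qed
      then show "\<forall>\<^sub>F n in sequentially. \<mu> - 1 / real (Suc n) \<le> norm (x (y n))" by simp
      show "\<forall>\<^sub>F n in sequentially. norm (x (y n)) \<le> \<mu>" using le[OF yL] y1 by simp
      have "(\<lambda>n. \<mu> - 1 / real (Suc n)) \<longlonglongrightarrow> \<mu> - 0"
        by (intro tendsto_diff tendsto_const LIMSEQ_Suc[OF lim_1_over_n])
      then show "(\<lambda>n. \<mu> - 1 / real (Suc n)) \<longlonglongrightarrow> \<mu>" by simp
    qed simp
    then have u: "norm u = \<mu>" using tendsto_norm[OF xy] LIMSEQ_unique by blast
    have "Cauchy y"
    proof (rule metric_CauchyI)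
      fix e :: real assume e: "0 < e"
      \<comment> \<open>The bound \<mu> keeps \<open>2 - 2 * \<eta> / \<mu>\<close> nonnegative, so
        that it can be squared; the other bound makes \<open>8 * \<eta> / \<mu>\<close> at most half
        of \<open>e\<^sup>2\<close>.\<close>
      define \<eta> where "\<eta> = min \<mu> (\<mu> * e\<^sup>2 / 16)"
      have \<eta>: "0 < \<eta>" "\<eta> \<le> \<mu>" "\<eta> \<le> \<mu> * e\<^sup>2 / 16" using \<mu> e by (auto simp: \<eta>_def)
      obtain N where N: "\<And>n. n \<ge> N \<Longrightarrow> norm (x (y n) - u) < \<eta>"
        using LIMSEQ_D[OF xy \<eta>(1)] by blast
      have "dist (y m) (y n) < e" if mn: "m \<ge> N" "n \<ge> N" for m n
      proof -
        have "norm (2 *\<^sub>R u) \<le> norm (x (y m) + x (y n)) + norm (x (y m) - u) + norm (x (y n) - u)"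
          by (smt (verit) norm_triangle_ineq4 scaleR_2 add_diff_eq diff_add_cancel norm_minus_commute
              norm_triangle_ineq add.commute add_diff_add diff_diff_eq2)
        then have "2 * \<mu> - 2 * \<eta> \<le> norm (x (y m + y n))"
          using N[OF mn(1)] N[OF mn(2)] u by (simp add: blinfun.add_right)
        also have "\<dots> \<le> \<mu> * norm (y m + y n)" by (rule le[OF Ladd[OF yL yL]])
        finally have "2 - 2 * \<eta> / \<mu> \<le> norm (y m + y n)"
          using \<mu> by (simp add: field_simps)
        moreover have "0 \<le> 2 - 2 * \<eta> / \<mu>" using \<mu> \<eta>(2) by (simp add: field_simps)
        ultimately have "(2 - 2 * \<eta> / \<mu>)\<^sup>2 \<le> (norm (y m + y n))\<^sup>2" by (rule power_mono)
        then have "(norm (y m - y n))\<^sup>2 \<le> 4 - (2 - 2 * \<eta> / \<mu>)\<^sup>2"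
          by (simp add: parallelogram_ell2 y1)
        also have "\<dots> \<le> 8 * (\<eta> / \<mu>)" by (simp add: power2_eq_square algebra_simps)
        also have "\<dots> \<le> 8 * (e\<^sup>2 / 16)"
          using \<eta>(3) \<mu> by (intro mult_left_mono) (auto simp: field_simps)
        also have "\<dots> < e\<^sup>2" using e by simp
        finally show ?thesis using e by (simp add: dist_norm power2_less_imp_less)
      qed
      then show "\<exists>N. \<forall>m\<ge>N. \<forall>n\<ge>N. dist (y m) (y n) < e" by blast
    qed
    then obtain z where z: "y \<longlonglongrightarrow> z" using ell2_Cauchy_convergent convergent_def by blast
    have "norm z = 1" using tendsto_norm[OF z] y1 LIMSEQ_unique[OF _ tendsto_const] by simp
    moreover have "cinner m z = 0" if "m \<in> M" for m
    proof -
      have "(\<lambda>n. cinner m (y n)) \<longlonglongrightarrow> cinner m z"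
        by (rule bounded_linear.tendsto[OF bounded_linear_cinner z])
      moreover have "cinner m (y n) = 0" for n using yL that by (simp add: L_def)
      ultimately show ?thesis using LIMSEQ_unique[OF _ tendsto_const] by simp
    qed
    moreover have "x z = u"
      using blinfun.tendsto[OF tendsto_const z, of x] xy LIMSEQ_unique by blast
    ultimately show thesis using u le by (intro that[of z \<mu>]) (auto simp: L_def)
  qed
qed

text \<open>As M consists of eigenvectors of the symmetric t, its complement is invariant under t.
  For a maximizing unit vector v, maximality gives norm at most \<open>\<mu>\<^sup>2\<close> for
  \<open>t v\<close>, while the inner product of v and \<open>t v\<close> equals
  \<open>\<mu>\<^sup>2\<close>. Equality in Cauchy-Schwarz forces \<open>t v\<close> to be a
  multiple of v.\<close>

lemma eigenvector_on_complement:
  fixes x :: "('a, 'b) ell2_op" and M :: "'a ell2 set"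
  defines "t \<equiv> adjoint_op x o\<^sub>L x"
  assumes x: "compact_op x" and M: "\<And>m. m \<in> M \<Longrightarrow> \<exists>c::real. t m = c *\<^sub>R m"
    and v0: "v0 \<noteq> 0" "\<And>m. m \<in> M \<Longrightarrow> cinner m v0 = 0"
  shows "\<exists>v c. norm v = 1 \<and> (\<forall>m\<in>M. cinner m v = 0) \<and> (0::real) \<le> c \<and> t v = c *\<^sub>R v"
proof -
  note cl = compact_op_clinear[OF x]
  from norm_attained_on_complement[OF x v0] obtain v \<mu>
    where v: "norm v = 1" "\<And>m. m \<in> M \<Longrightarrow> cinner m v = 0" "norm (x v) = \<mu>"
    and le: "\<And>w. (\<And>m. m \<in> M \<Longrightarrow> cinner m w = 0) \<Longrightarrow> norm (x w) \<le> \<mu> * norm w"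
    by blast
  have sym: "cinner (t v) w = cinner v (t w)" for v w
    unfolding t_def using adjoint_op(2)[OF cl, of v "x w"] adjoint_op_left[OF cl, of "x v" w] by simp
  have tL: "cinner m (t v) = 0" if m: "m \<in> M" for m
  proof -
    obtain c :: real where "t m = c *\<^sub>R m" using M[OF m] by blast
    then show ?thesis using v(2)[OF m] by (simp add: sym[symmetric] cinner_scaleR_left)
  qed
  have "complex_of_real ((norm (t v))\<^sup>2) = cinner (t v) (t v)" by (simp add: cinner_self)
  also have "\<dots> = cinner (x (t v)) (x v)"
    unfolding t_def by (simp add: adjoint_op(2)[OF cl])
  finally have "(norm (t v))\<^sup>2 = cmod (cinner (x (t v)) (x v))"
    by (metis abs_of_nonneg norm_of_real zero_le_power2)
  also have "\<dots> \<le> norm (x (t v)) * \<mu>" using cinner_norm_le[of "x (t v)" "x v"] v(3) by simp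
  also have "\<dots> \<le> (\<mu> * norm (t v)) * \<mu>"
    using le[OF tL] v(3) norm_ge_zero by (intro mult_right_mono) auto
  finally have tv: "norm (t v) \<le> \<mu>\<^sup>2"
    by (cases "norm (t v) = 0") (auto simp: power2_eq_square mult_ac)
  have "cinner v (t v) = complex_of_real ((norm (x v))\<^sup>2)"
    unfolding t_def by (simp add: adjoint_op(2)[OF cl, symmetric] cinner_self)
  then have "inner v (t v) = \<mu>\<^sup>2" by (simp add: inner_ell2_def v(3))
  then have "(norm (t v - \<mu>\<^sup>2 *\<^sub>R v))\<^sup>2 = (norm (t v))\<^sup>2 - \<mu>\<^sup>2 * \<mu>\<^sup>2"
    using v(1) power2_norm_eq_inner[of v]
    by (simp add: power2_norm_eq_inner inner_diff_left inner_diff_right inner_commute algebra_simps)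
  also have "\<dots> \<le> 0"
    using mult_mono[OF tv tv] by (simp add: power2_eq_square)
  finally have "t v = \<mu>\<^sup>2 *\<^sub>R v" by simp
  with v show ?thesis by (intro exI[of _ v] exI[of _ "\<mu>\<^sup>2"]) auto
qed

text \<open>Zorn's lemma handles zero and nonzero eigenvalues alike: vectors of the kernel belong to
  the family too, so that a maximal family is total, since any vector orthogonal to it would produce
  a further eigenvector.\<close>

lemma maximal_eigenvector_family:
  fixes x :: "('a, 'b) ell2_op"
  defines "t \<equiv> adjoint_op x o\<^sub>L x"
  assumes x: "compact_op x"
  obtains M :: "'a ell2 set" where "orthonormal_on M (\<lambda>m. m)"
    "\<And>m. m \<in> M \<Longrightarrow> \<exists>c::real. 0 \<le> c \<and> t m = c *\<^sub>R m"
    "\<And>v. (\<And>m. m \<in> M \<Longrightarrow> cinner m v = 0) \<Longrightarrow> v = 0"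
proof -
  define \<A> where "\<A> = {M. orthonormal_on M (\<lambda>m. m) \<and> (\<forall>m\<in>M. \<exists>c::real. 0 \<le> c \<and> t m = c *\<^sub>R m)}"
  have "\<exists>M\<in>\<A>. \<forall>X\<in>\<A>. M \<subseteq> X \<longrightarrow> X = M"
  proof (rule subset_Zorn')
    fix C assume C: "subset.chain \<A> C"
    have "cinner a b = (if a = b then 1 else 0)" if ab: "a \<in> \<Union>C" "b \<in> \<Union>C" for a b
    proof -
      obtain Y Z where YZ: "Y \<in> C" "a \<in> Y" "Z \<in> C" "b \<in> Z" using ab by blast
      then have "Y \<subseteq> Z \<or> Z \<subseteq> Y" using C unfolding subset.chain_def by blast
      then obtain X where "X \<in> C" "a \<in> X" "b \<in> X" using YZ by blast
      moreover then have "X \<in> \<A>" using C unfolding subset.chain_def by blast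
      ultimately show ?thesis unfolding \<A>_def orthonormal_on_def by blast
    qed
    moreover have "\<exists>c::real. 0 \<le> c \<and> t m = c *\<^sub>R m" if "m \<in> \<Union>C" for m
      using that C unfolding subset.chain_def \<A>_def by blast
    ultimately show "\<Union>C \<in> \<A>" unfolding \<A>_def orthonormal_on_def by blast
  qed
  then obtain M where M: "M \<in> \<A>" and max: "\<And>X. X \<in> \<A> \<Longrightarrow> M \<subseteq> X \<Longrightarrow> X = M" by blast
  have on: "orthonormal_on M (\<lambda>m. m)" and ev: "\<And>m. m \<in> M \<Longrightarrow> \<exists>c::real. 0 \<le> c \<and> t m = c *\<^sub>R m"
    using M by (auto simp: \<A>_def)
  have "v0 = 0" if v0: "\<And>m. m \<in> M \<Longrightarrow> cinner m v0 = 0" for v0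
  proof (rule ccontr)
    assume "v0 \<noteq> 0"
    have "\<And>m. m \<in> M \<Longrightarrow> \<exists>c::real. (adjoint_op x o\<^sub>L x) m = c *\<^sub>R m"
      using ev unfolding t_def by blast
    from eigenvector_on_complement[OF x this \<open>v0 \<noteq> 0\<close> v0] obtain v and c :: real
      where v: "norm v = 1" "\<forall>m\<in>M. cinner m v = 0" "0 \<le> c" "t v = c *\<^sub>R v"
      unfolding t_def by blast
    have "cinner v v = 1" using v(1) by (simp add: cinner_self)
    moreover have "cinner v m = 0" if "m \<in> M" for m using v(2) that cinner_commute[of v m] by simp
    ultimately have "insert v M \<in> \<A>"
      using on ev v unfolding \<A>_def orthonormal_on_def by auto
    then have "v \<in> M" using max by blast
    then show False using v(2) \<open>cinner v v = 1\<close> by simp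
  qed
  then show thesis using that[OF on ev] by metis
qed

text \<open>Each member has a nonzero coordinate, and by Bessel's inequality only countably many
  members have a nonzero coordinate at a given place.\<close>

lemma orthonormal_countable:
  fixes M :: "'a :: countable ell2 set"
  assumes M: "orthonormal_on M (\<lambda>m. m)"
  shows "countable M"
proof -
  have "M \<subseteq> (\<Union>i. {m \<in> M. (cmod (cinner m (unit_ell2 i)))\<^sup>2 \<noteq> 0})"
  proof
    fix m assume m: "m \<in> M"
    then have "cinner m m = 1" using M by (simp add: orthonormal_on_def)
    then have "m \<noteq> 0" by auto
    then obtain i where "ell2_nth m i \<noteq> 0"
      by (metis ell2_eqI zero_ell2.rep_eq)
    then show "m \<in> (\<Union>i. {m \<in> M. (cmod (cinner m (unit_ell2 i)))\<^sup>2 \<noteq> 0})"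
      using m by (auto simp: cinner_unit_right)
  qed
  moreover have "countable {m \<in> M. (cmod (cinner m (unit_ell2 i)))\<^sup>2 \<noteq> 0}" for i
    by (rule summable_countable_real[OF bessel_summable(1)[OF M]])
  ultimately show ?thesis by (meson countableI_type countable_UN countable_subset)
qed

text \<open>Needed to enumerate the eigenvectors by all of nat. In a finite total family every unit
  vector satisfies Parseval's identity; adding these identities for card M + 1 unit vectors and
  exchanging the sums gives card M + 1 <= card M.\<close>

lemma total_orthonormal_infinite:
  fixes M :: "nat ell2 set"
  assumes M: "orthonormal_on M (\<lambda>m. m)"
    and total: "\<And>v. (\<And>m. m \<in> M \<Longrightarrow> cinner m v = 0) \<Longrightarrow> v = 0"
  shows "infinite M"
proof
  assume fin: "finite M"
  have one: "1 = (\<Sum>m\<in>M. (cmod (ell2_nth m i))\<^sup>2)" for i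
  proof -
    let ?u = "unit_ell2 i"
    let ?w = "\<Sum>m\<in>M. scaleC_ell2 (cinner m ?u) m"
    have "cinner n ?w = cinner n ?u" if n: "n \<in> M" for n
    proof -
      have "cinner n ?w = (\<Sum>m\<in>M. if m = n then cinner m ?u else 0)"
        using M n unfolding cinner_sum_right cinner_scaleC_right orthonormal_on_def
        by (intro sum.cong) auto
      then show ?thesis using n fin by simp
    qed
    then have "?u - ?w = 0" by (intro total) (simp add: cinner_diff_right)
    then have "?u = ?w" by simp
    then have "1 = (norm ?w)\<^sup>2" using norm_unit[of i] by simp
    also have "\<dots> = (\<Sum>m\<in>M. (cmod (cinner m ?u))\<^sup>2)"
      by (rule norm_orthonormal_combination[OF fin M])
    finally show ?thesis by (simp add: cinner_unit_right)
  qed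
  have "real (card M + 1) = (\<Sum>i<card M + 1. \<Sum>m\<in>M. (cmod (ell2_nth m i))\<^sup>2)"
    by (simp flip: one)
  also have "\<dots> = (\<Sum>m\<in>M. \<Sum>i<card M + 1. (cmod (ell2_nth m i))\<^sup>2)" by (rule sum.swap)
  also have "\<dots> \<le> (\<Sum>m\<in>M. 1)"
  proof (rule sum_mono)
    fix m assume "m \<in> M"
    then have "cinner m m = 1" using M by (simp add: orthonormal_on_def)
    then have "(norm m)\<^sup>2 = 1" by (simp add: cinner_self flip: of_real_power)
    then show "(\<Sum>i<card M + 1. (cmod (ell2_nth m i))\<^sup>2) \<le> 1"
      using bessel[OF finite_lessThan orthonormal_on_unit, where v = m] \<open>(norm m)\<^sup>2 = 1\<close>
      by (metis (no_types, lifting) cinner_unit_left sum.cong)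
  qed
  finally show False by simp
qed

theorem singular_system_exists:
  fixes x :: "(nat, 'b) ell2_op"
  assumes x: "compact_op x"
  shows "\<exists>f s. singular_system x f s"
proof -
  note cl = compact_op_clinear[OF x]
  from maximal_eigenvector_family[OF x] obtain M where M: "orthonormal_on M (\<lambda>m. m)"
    and ev: "\<And>m. m \<in> M \<Longrightarrow> \<exists>c::real. 0 \<le> c \<and> (adjoint_op x o\<^sub>L x) m = c *\<^sub>R m"
    and total: "\<And>v. (\<And>m. m \<in> M \<Longrightarrow> cinner m v = 0) \<Longrightarrow> v = 0"
    by blast
  define f where "f = from_nat_into M"
  have bij: "bij_betw f UNIV M"
    unfolding f_def
    by (rule bij_betw_from_nat_into[OF orthonormal_countable[OF M] total_orthonormal_infinite[OF M total]])
  have fM: "f i \<in> M" for i using bij bij_betwE by blast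
  have inj: "f i = f j \<longleftrightarrow> i = j" for i j
    using bij unfolding bij_betw_def inj_def by auto
  obtain c where c: "\<And>i. 0 \<le> c i" "\<And>i. (adjoint_op x o\<^sub>L x) (f i) = (c i :: real) *\<^sub>R f i"
    using ev[OF fM] by metis
  have orth: "cinner (f i) (f j) = (if i = j then 1 else 0)" for i j
    using M fM inj unfolding orthonormal_on_def by auto
  have "orthonormal_basis f"
    unfolding orthonormal_basis_def
  proof (intro conjI allI impI)
    fix v assume v: "\<forall>i. cinner (f i) v = 0"
    show "v = 0"
    proof (rule total)
      fix m assume "m \<in> M"
      then obtain i where "m = f i" using bij unfolding bij_betw_def by blast
      then show "cinner m v = 0" using v by simp
    qed
  qed (rule orth)
  moreover have "cinner (x (f i)) (x (f j)) = (if i = j then complex_of_real ((sqrt (c i))\<^sup>2) else 0)" for i j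
    using c(2)[of j] by (simp add: adjoint_op(2)[OF cl] cinner_scaleR_right orth c(1))
  ultimately have "singular_system x f (\<lambda>i. sqrt (c i))"
    unfolding singular_system_def using c(1) by auto
  then show ?thesis by blast
qed

section \<open>Schmidt decompositions and Schatten norms\<close>

text \<open>The weak form of x = sum of l k g_k <h_k, .>. The weights are complex, so that
  eigenvalues of a normal matrix can be used without splitting off their phases.\<close>

definition schmidt ::
  "('a, 'b) ell2_op \<Rightarrow> 'k set \<Rightarrow> ('k \<Rightarrow> complex) \<Rightarrow> ('k \<Rightarrow> 'b ell2) \<Rightarrow> ('k \<Rightarrow> 'a ell2) \<Rightarrow> bool" where
  "schmidt x J l g h \<longleftrightarrow> orthonormal_on J g \<and> orthonormal_on J h \<and>
     (\<forall>u v. ((\<lambda>k. l k * cinner u (g k) * cinner (h k) v) has_sum cinner u (x v)) J)"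

lemma schmidt_singular_system:
  fixes x :: "('a, 'b) ell2_op"
  assumes x: "clinear_op x" and f: "singular_system x f s"
  shows "schmidt x {i. 0 < s i} (\<lambda>i. complex_of_real (s i)) (\<lambda>i. (1 / s i) *\<^sub>R x (f i)) f"
  unfolding schmidt_def
proof (intro conjI allI)
  have e: "orthonormal_basis f" and s: "\<And>i. 0 \<le> s i"
    and xx: "\<And>i j. cinner (x (f i)) (x (f j)) = (if i = j then complex_of_real ((s i)\<^sup>2) else 0)"
    using f by (auto simp: singular_system_def)
  show "orthonormal_on {i. 0 < s i} f" by (rule orthonormal_basis_on[OF e])
  show "orthonormal_on {i. 0 < s i} (\<lambda>i. (1 / s i) *\<^sub>R x (f i))"
    unfolding orthonormal_on_def
    by (auto simp: cinner_scaleR_left cinner_scaleR_right xx power2_eq_square)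
  fix u v
  have "((\<lambda>j. cnj (cinner (f j) (adjoint_op x u)) * cinner (f j) v) has_sum cinner u (x v)) UNIV"
    unfolding adjoint_op_left[OF x] by (rule parseval[OF e])
  moreover have "cnj (cinner (f j) (adjoint_op x u)) = cinner u (x (f j))" for j
    unfolding adjoint_op(2)[OF x, symmetric] by (metis cinner_commute)
  ultimately have "((\<lambda>j. cinner u (x (f j)) * cinner (f j) v) has_sum cinner u (x v)) UNIV"
    by simp
  moreover have "x (f j) = 0" if "\<not> 0 < s j" for j
  proof -
    have "s j = 0" using that s[of j] by simp
    then have "cinner (x (f j)) (x (f j)) = 0" using xx by simp
    then show ?thesis by (simp add: cinner_self)
  qed
  ultimately show "((\<lambda>k. complex_of_real (s k) * cinner u ((1 / s k) *\<^sub>R x (f k)) * cinner (f k) v)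
      has_sum cinner u (x v)) {i. 0 < s i}"
    by (subst has_sum_cong_neutral[where T = UNIV and g = "\<lambda>j. cinner u (x (f j)) * cinner (f j) v"])
      (auto simp: cinner_scaleR_right)
qed

text \<open>Convexity: the graph of the p-th power lies above its tangent at c. In this form of
  Young's inequality p = 1 is no exception. It serves twice, for the Jensen step in
  \<open>schmidt_pairing_le\<close> and for the duality estimate at the end.\<close>

lemma young_tangent:
  fixes s c p :: real
  assumes "0 \<le> s" "0 < c" "1 \<le> p"
  shows "c powr (p - 1) * s \<le> s powr p / p + (1 - 1 / p) * c powr p"
proof (cases "s = 0")
  case False
  have "(s powr p) powr (1 / p) * (c powr p) powr (1 - 1 / p) \<le> 1 / p * s powr p + (1 - 1 / p) * c powr p"
    using assms False by (intro Youngs_inequality_0) (auto simp: field_simps)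
  moreover have "p * (1 - 1 / p) = p - 1" using assms by (simp add: field_simps)
  ultimately show ?thesis using assms False by (simp add: powr_powr mult_ac)
qed (use assms in simp)

lemma has_sum_finite_sum:
  fixes f :: "'i \<Rightarrow> 'k \<Rightarrow> real"
  assumes "finite K" "\<And>i. i \<in> K \<Longrightarrow> ((\<lambda>k. f i k) has_sum S i) J"
  shows "((\<lambda>k. \<Sum>i\<in>K. f i k) has_sum (\<Sum>i\<in>K. S i)) J"
  using assms by (induction K rule: finite_induct) (simp_all add: has_sum_add)

lemma orthonormal_norm: "orthonormal_on J e \<Longrightarrow> k \<in> J \<Longrightarrow> norm (e k) = 1"
  using cinner_self[of "e k"] norm_ge_zero[of "e k"]
  by (simp add: orthonormal_on_def power2_eq_1_iff flip: of_real_power)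

text \<open>
  The weights \<open>(|\<langle>u\<^sub>i, g\<^sub>k\<rangle>|\<^sup>2 + |\<langle>h\<^sub>k, v\<^sub>i\<rangle>|\<^sup>2) / 2\<close> are doubly substochastic by Bessel's
  inequality; the estimate is Jensen's inequality for them.
\<close>

lemma schmidt_pairing_le:
  assumes p: "1 \<le> p" and x: "schmidt x J l g h"
    and u: "orthonormal_on K u" and v: "orthonormal_on K v" and K: "finite K"
    and sum: "(\<lambda>k. cmod (l k) powr p) summable_on J"
  shows "(\<Sum>i\<in>K. cmod (cinner (u i) (x (v i))) powr p) \<le> (\<Sum>\<^sub>\<infinity>k\<in>J. cmod (l k) powr p)"
proof -
  define a where "a i k = ((cmod (cinner (u i) (g k)))\<^sup>2 + (cmod (cinner (h k) (v i)))\<^sup>2) / 2" for i k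
  have g: "orthonormal_on J g" and h: "orthonormal_on J h"
    and hs: "\<And>u v. ((\<lambda>k. l k * cinner u (g k) * cinner (h k) v) has_sum cinner u (x v)) J"
    using x by (auto simp: schmidt_def)
  have a0: "0 \<le> a i k" for i k by (simp add: a_def)
  have col: "(\<Sum>i\<in>K. a i k) \<le> 1" if k: "k \<in> J" for k
  proof -
    have "(\<Sum>i\<in>K. (cmod (cinner (u i) (g k)))\<^sup>2) \<le> 1"
      using bessel[OF K u, of "g k"] orthonormal_norm[OF g k] by simp
    moreover have "(\<Sum>i\<in>K. (cmod (cinner (v i) (h k)))\<^sup>2) \<le> 1"
      using bessel[OF K v, of "h k"] orthonormal_norm[OF h k] by simp
    moreover have "cmod (cinner (v i) (h k)) = cmod (cinner (h k) (v i))" for i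
      using cinner_commute[of "v i" "h k"] by simp
    ultimately show ?thesis by (simp add: a_def sum.distrib flip: sum_divide_distrib)
  qed
  have row: "(\<Sum>k\<in>F. a i k) \<le> 1" if F: "finite F" "F \<subseteq> J" and i: "i \<in> K" for F i
  proof -
    have "(\<Sum>k\<in>F. (cmod (cinner (g k) (u i)))\<^sup>2) \<le> 1"
      using bessel[OF F(1) orthonormal_on_subset[OF g F(2)], of "u i"] orthonormal_norm[OF u i] by simp
    moreover have "(\<Sum>k\<in>F. (cmod (cinner (h k) (v i)))\<^sup>2) \<le> 1"
      using bessel[OF F(1) orthonormal_on_subset[OF h F(2)], of "v i"] orthonormal_norm[OF v i] by simp
    moreover have "cmod (cinner (g k) (u i)) = cmod (cinner (u i) (g k))" for k
      using cinner_commute[of "u i" "g k"] by simp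
    ultimately show ?thesis by (simp add: a_def sum.distrib flip: sum_divide_distrib)
  qed
  have as: "(\<lambda>k. a i k * cmod (l k) powr p) summable_on J" if i: "i \<in> K" for i
  proof (rule summable_on_comparison_test[OF sum])
    fix k assume k: "k \<in> J"
    have "a i k \<le> 1" using row[of "{k}" i] k i by simp
    then show "a i k * cmod (l k) powr p \<le> cmod (l k) powr p"
      by (simp add: mult_left_le_one_le a0)
  qed (simp add: a0)
  let ?Y = "\<lambda>i. \<Sum>\<^sub>\<infinity>k\<in>J. a i k * cmod (l k) powr p"
  have one: "cmod (cinner (u i) (x (v i))) powr p \<le> ?Y i" if i: "i \<in> K" for i
  proof (cases "cinner (u i) (x (v i)) = 0")
    case True
    then show ?thesis by (simp add: infsum_nonneg a0)
  next
    case False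
    \<comment> \<open>The tangent is taken at the very value to be estimated, so that the terms in
      \<open>c powr p\<close> combine to \<open>c powr p / p\<close>.\<close>
    define c where "c = cmod (cinner (u i) (x (v i)))"
    have c: "0 < c" using False by (simp add: c_def)
    let ?T = "\<lambda>k. l k * cinner (u i) (g k) * cinner (h k) (v i)"
    have fin: "c powr (p - 1) * cmod (\<Sum>k\<in>F. ?T k) \<le> ?Y i / p + (1 - 1 / p) * c powr p"
      if F: "finite F" "F \<subseteq> J" for F
    proof -
      have "cmod (\<Sum>k\<in>F. ?T k) \<le> (\<Sum>k\<in>F. a i k * cmod (l k))"
      proof (rule order_trans[OF norm_sum sum_mono])
        fix k
        have "cmod (cinner (u i) (g k)) * cmod (cinner (h k) (v i)) \<le> a i k"
          using sum_squares_bound[of "cmod (cinner (u i) (g k))" "cmod (cinner (h k) (v i))"]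
          by (simp add: a_def)
        then show "cmod (?T k) \<le> a i k * cmod (l k)"
          by (simp add: norm_mult mult_left_mono mult.assoc mult.commute[of "a i k"])
      qed
      then have "c powr (p - 1) * cmod (\<Sum>k\<in>F. ?T k) \<le> c powr (p - 1) * (\<Sum>k\<in>F. a i k * cmod (l k))"
        by (intro mult_left_mono) auto
      also have "\<dots> = (\<Sum>k\<in>F. a i k * (c powr (p - 1) * cmod (l k)))"
        by (simp add: sum_distrib_left mult_ac)
      also have "\<dots> \<le> (\<Sum>k\<in>F. a i k * (cmod (l k) powr p / p + (1 - 1 / p) * c powr p))"
        by (intro sum_mono mult_left_mono young_tangent a0 c p) auto
      also have "\<dots> = (\<Sum>k\<in>F. a i k * cmod (l k) powr p) / p + (\<Sum>k\<in>F. a i k) * ((1 - 1 / p) * c powr p)"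
        by (simp add: sum.distrib distrib_left sum_divide_distrib sum_distrib_right)
      also have "\<dots> \<le> ?Y i / p + 1 * ((1 - 1 / p) * c powr p)"
        using p F i
        by (intro add_mono divide_right_mono mult_right_mono row finite_sum_le_infsum as)
           (auto simp: a0)
      finally show ?thesis by simp
    qed
    have "c powr (p - 1) * c \<le> ?Y i / p + (1 - 1 / p) * c powr p"
    proof (rule tendsto_upperbound)
      show "((\<lambda>F. c powr (p - 1) * cmod (\<Sum>k\<in>F. ?T k)) \<longlongrightarrow> c powr (p - 1) * c) (finite_subsets_at_top J)"
        using hs[of "u i" "v i"] unfolding has_sum_def c_def by (intro tendsto_intros)
      show "\<forall>\<^sub>F F in finite_subsets_at_top J. c powr (p - 1) * cmod (\<Sum>k\<in>F. ?T k) \<le> ?Y i / p + (1 - 1 / p) * c powr p"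
        by (intro eventually_finite_subsets_at_top_weakI fin)
    qed simp
    moreover have "c powr (p - 1) * c = c powr p"
      using c powr_add[of c "p - 1" 1] by simp
    ultimately have "c powr p / p \<le> ?Y i / p" by (simp add: algebra_simps)
    then show ?thesis using p unfolding c_def by (simp add: divide_le_cancel)
  qed
  have "(\<Sum>i\<in>K. cmod (cinner (u i) (x (v i))) powr p) \<le> (\<Sum>i\<in>K. ?Y i)"
    by (rule sum_mono[OF one])
  also have "\<dots> \<le> (\<Sum>\<^sub>\<infinity>k\<in>J. cmod (l k) powr p)"
  proof (rule has_sum_mono)
    show "((\<lambda>k. \<Sum>i\<in>K. a i k * cmod (l k) powr p) has_sum (\<Sum>i\<in>K. ?Y i)) J"
      by (rule has_sum_finite_sum[OF K]) (simp add: as)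
    show "((\<lambda>k. cmod (l k) powr p) has_sum (\<Sum>\<^sub>\<infinity>k\<in>J. cmod (l k) powr p)) J"
      using sum by simp
    fix k assume "k \<in> J"
    have "(\<Sum>i\<in>K. a i k * cmod (l k) powr p) = (\<Sum>i\<in>K. a i k) * cmod (l k) powr p"
      by (simp add: sum_distrib_right)
    also have "\<dots> \<le> 1 * cmod (l k) powr p" by (intro mult_right_mono col \<open>k \<in> J\<close>) auto
    finally show "(\<Sum>i\<in>K. a i k * cmod (l k) powr p) \<le> cmod (l k) powr p" by simp
  qed
  finally show ?thesis .
qed

section \<open>Schatten norms as suprema of pairings\<close>

lemma ennreal_infsum_finite:
  fixes f :: "'i \<Rightarrow> real"
  assumes "\<And>i. 0 \<le> f i"
  shows "(\<Sum>\<^sub>\<infinity>i. ennreal (f i)) < \<infinity> \<longleftrightarrow> f summable_on UNIV"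
    and "f summable_on UNIV \<Longrightarrow> (\<Sum>\<^sub>\<infinity>i. ennreal (f i)) = ennreal (\<Sum>\<^sub>\<infinity>i. f i)"
proof -
  show e: "f summable_on UNIV \<Longrightarrow> (\<Sum>\<^sub>\<infinity>i. ennreal (f i)) = ennreal (\<Sum>\<^sub>\<infinity>i. f i)"
    using has_sum_ennreal[OF has_sum_infsum, of f UNIV] assms by (simp add: infsumI)
  show "(\<Sum>\<^sub>\<infinity>i. ennreal (f i)) < \<infinity> \<longleftrightarrow> f summable_on UNIV"
  proof
    assume fin: "(\<Sum>\<^sub>\<infinity>i. ennreal (f i)) < \<infinity>"
    show "f summable_on UNIV"
    proof (rule nonneg_bdd_above_summable_on)
      show "bdd_above (sum f ` {F. F \<subseteq> UNIV \<and> finite F})"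
      proof (rule bdd_aboveI)
        fix t assume "t \<in> sum f ` {F. F \<subseteq> UNIV \<and> finite F}"
        then obtain F where F: "finite F" "t = sum f F" by blast
        have "(\<Sum>i\<in>F. ennreal (f i)) \<le> (\<Sum>\<^sub>\<infinity>i. ennreal (f i))"
          using infsum_mono_neutral[of "\<lambda>i. ennreal (f i)" F "\<lambda>i. ennreal (f i)" UNIV] F
          by (auto simp: ennreal_summable_on)
        then have "ennreal t \<le> (\<Sum>\<^sub>\<infinity>i. ennreal (f i))" using F assms by (simp add: sum_ennreal)
        then show "t \<le> enn2real (\<Sum>\<^sub>\<infinity>i. ennreal (f i))"
          using fin by (metis ennreal_enn2real ennreal_le_iff enn2real_nonneg infinity_ennreal_def)
      qed
    qed (simp add: assms)
  next
    assume "f summable_on UNIV"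
    then show "(\<Sum>\<^sub>\<infinity>i. ennreal (f i)) < \<infinity>" using e by simp
  qed
qed

lemma schatten_class_singular_system:
  assumes x: "compact_op x" and f: "singular_system x f s" and p: "0 < p"
  shows "x \<in> schatten_class (ereal p) \<longleftrightarrow> (\<lambda>i. s i powr p) summable_on UNIV"
    and "x \<in> schatten_class (ereal p) \<Longrightarrow> schatten_norm (ereal p) x powr p = (\<Sum>\<^sub>\<infinity>i. s i powr p)"
proof -
  have tr: "schatten_trace p x = (\<Sum>\<^sub>\<infinity>i. ennreal (s i powr p))"
    by (rule schatten_trace_singular_system[OF compact_op_clinear[OF x] f p])
  show iff: "x \<in> schatten_class (ereal p) \<longleftrightarrow> (\<lambda>i. s i powr p) summable_on UNIV"
    using x by (simp add: schatten_class_def tr ennreal_infsum_finite(1)[of "\<lambda>i. s i powr p", simplified])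
  assume "x \<in> schatten_class (ereal p)"
  then have "schatten_trace p x = ennreal (\<Sum>\<^sub>\<infinity>i. s i powr p)"
    unfolding iff tr by (intro ennreal_infsum_finite(2)) auto
  moreover have "0 \<le> (\<Sum>\<^sub>\<infinity>i. s i powr p)" by (simp add: infsum_nonneg)
  ultimately show "schatten_norm (ereal p) x powr p = (\<Sum>\<^sub>\<infinity>i. s i powr p)"
    using p by (simp add: schatten_norm_def powr_powr)
qed

lemma schatten_norm_nonneg: "0 \<le> schatten_norm p x"
  by (simp add: schatten_norm_def)

lemma schatten_pairing_le:
  fixes x :: "(nat, 'b) ell2_op"
  assumes p: "1 \<le> p" and x: "x \<in> schatten_class (ereal p)"
    and u: "orthonormal_on K u" and v: "orthonormal_on K v" and K: "finite K"
  shows "(\<Sum>i\<in>K. cmod (cinner (u i) (x (v i))) powr p) \<le> schatten_norm (ereal p) x powr p"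
proof -
  have c: "compact_op x" using x by (simp add: schatten_class_def)
  obtain f s where f: "singular_system x f s" using singular_system_exists[OF c] by blast
  have p0: "0 < p" using p by simp
  note sc = schatten_class_singular_system[OF c f p0]
  have s: "0 \<le> s i" for i using f by (simp add: singular_system_def)
  have sum: "(\<lambda>i. s i powr p) summable_on UNIV" using sc(1) x by blast
  have sum': "(\<lambda>i. cmod (complex_of_real (s i)) powr p) summable_on {i. 0 < s i}"
    using summable_on_subset_banach[OF sum, of "{i. 0 < s i}"] s by simp
  have "(\<Sum>i\<in>K. cmod (cinner (u i) (x (v i))) powr p)
      \<le> (\<Sum>\<^sub>\<infinity>i\<in>{i. 0 < s i}. cmod (complex_of_real (s i)) powr p)"
    by (rule schmidt_pairing_le[OF p schmidt_singular_system[OF compact_op_clinear[OF c] f] u v K sum'])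
  also have "\<dots> \<le> (\<Sum>\<^sub>\<infinity>i. s i powr p)"
    using s by (intro infsum_mono_neutral sum' sum) auto
  finally show ?thesis using sc(2)[OF x] by simp
qed

text \<open>The pairings with the right singular vectors \<open>f i\<close> and the left ones
  \<open>x (f i) / s i\<close> return the singular values. Together with
  \<open>schatten_pairing_le\<close> this characterizes the norm by pairings, and it takes the place
  of the trace formula in what follows.\<close>

lemma schatten_class_boundedI:
  fixes x :: "(nat, 'b) ell2_op"
  assumes p: "1 \<le> p" and c: "compact_op x"
    and B: "\<And>(K :: nat set) u v. finite K \<Longrightarrow> orthonormal_on K u \<Longrightarrow> orthonormal_on K v \<Longrightarrow>
      (\<Sum>i\<in>K. cmod (cinner (u i) (x (v i))) powr p) \<le> B"
  shows "x \<in> schatten_class (ereal p)" and "schatten_norm (ereal p) x powr p \<le> B"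
proof -
  obtain f s where f: "singular_system x f s" using singular_system_exists[OF c] by blast
  have p0: "0 < p" using p by simp
  note sc = schatten_class_singular_system[OF c f p0]
  have s: "0 \<le> s i" for i using f by (simp add: singular_system_def)
  have xx: "cinner (x (f i)) (x (f i)) = complex_of_real ((s i)\<^sup>2)" for i
    using f by (simp add: singular_system_def)
  define u where "u i = (1 / s i) *\<^sub>R x (f i)" for i
  have ou: "orthonormal_on {i. 0 < s i} u" and onf: "orthonormal_on {i. 0 < s i} f"
    using schmidt_singular_system[OF compact_op_clinear[OF c] f] by (auto simp: schmidt_def u_def[abs_def])
  have bd: "(\<Sum>i\<in>F. s i powr p) \<le> B" if F: "finite F" for F
  proof -
    let ?K = "{i \<in> F. 0 < s i}"
    have "(\<Sum>i\<in>F. s i powr p) = (\<Sum>i\<in>?K. s i powr p)"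
      using F s by (intro sum.mono_neutral_right) (auto simp: less_le)
    also have "\<dots> = (\<Sum>i\<in>?K. cmod (cinner (u i) (x (f i))) powr p)"
    proof (rule sum.cong[OF refl])
      fix i assume i: "i \<in> ?K"
      then have "cinner (u i) (x (f i)) = complex_of_real (s i)"
        by (simp add: u_def cinner_scaleR_left xx power2_eq_square)
      then show "s i powr p = cmod (cinner (u i) (x (f i))) powr p" using s by simp
    qed
    also have "\<dots> \<le> B"
      using F by (intro B orthonormal_on_subset[OF ou] orthonormal_on_subset[OF onf]) auto
    finally show ?thesis .
  qed
  have sum: "(\<lambda>i. s i powr p) summable_on UNIV"
    by (rule nonneg_bdd_above_summable_on) (auto intro!: bdd_aboveI[where M = B] bd)
  then show x: "x \<in> schatten_class (ereal p)" using sc(1) by blast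
  show "schatten_norm (ereal p) x powr p \<le> B"
    unfolding sc(2)[OF x] by (rule infsum_le_finite_sums[OF sum]) (auto intro: bd)
qed

lemma powr_le_cancel_base:
  fixes a b p :: real
  assumes "a powr p \<le> b powr p" "0 < p" "0 \<le> b"
  shows "a \<le> b"
  using assms powr_less_mono2[of p b a] by fastforce

text \<open>A pairing over a single index, with the normalized v and \<open>x v\<close>, already
  detects the operator norm.\<close>

lemma norm_le_schatten_norm:
  fixes x :: "(nat, 'b) ell2_op"
  assumes p: "1 \<le> p" and x: "x \<in> schatten_class p"
  shows "norm x \<le> schatten_norm p x"
proof (cases p)
  case (real q)
  have q: "1 \<le> q" using p real by simp
  show ?thesis
  proof (rule norm_blinfun_bound)
    show "0 \<le> schatten_norm p x" by (rule schatten_norm_nonneg)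
    fix v
    show "norm (x v) \<le> schatten_norm p x * norm v"
    proof (cases "v = 0 \<or> x v = 0")
      case True
      then show ?thesis using schatten_norm_nonneg[of p x] by auto
    next
      case False
      define u where "u = (1 / norm (x v)) *\<^sub>R x v"
      define w where "w = (1 / norm v) *\<^sub>R v"
      have "cinner u u = 1" "cinner w w = 1"
        using False by (auto simp: u_def w_def cinner_self)
      then have "orthonormal_on {0::nat} (\<lambda>_. u)" "orthonormal_on {0::nat} (\<lambda>_. w)"
        by (auto simp: orthonormal_on_def)
      then have "cmod (cinner u (x w)) powr q \<le> schatten_norm p x powr q"
        using schatten_pairing_le[OF q, of x "{0::nat}" "\<lambda>_. u" "\<lambda>_. w"] x real by simp
      then have le: "cmod (cinner u (x w)) \<le> schatten_norm p x"
        by (rule powr_le_cancel_base) (use q schatten_norm_nonneg in auto)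
      have "cinner u (x w) = complex_of_real (norm (x v) / norm v)"
        using False
        by (simp add: u_def w_def blinfun.scaleR_right cinner_scaleR_left cinner_scaleR_right
            cinner_self power2_eq_square)
      then have "norm (x v) / norm v \<le> schatten_norm p x" using le by (simp add: norm_divide)
      then show ?thesis using False by (simp add: field_simps)
    qed
  qed
next
  case PInf
  then show ?thesis by (simp add: schatten_norm_def)
qed (use p in simp)

section \<open>Stability of compact operators and Schatten classes under linear operations\<close>

lemma clinear_op_add: "clinear_op x \<Longrightarrow> clinear_op y \<Longrightarrow> clinear_op (x + y)"
  by (simp add: clinear_op_def blinfun.add_left scaleC_add_right)

lemma clinear_op_scaleC_op: "clinear_op x \<Longrightarrow> clinear_op (scaleC_op a x)"
  by (simp add: clinear_op_def scaleC_op_apply scaleC_scaleC mult.commute)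

lemma compact_opI:
  assumes "clinear_op x" "compact S" "\<And>v. norm v \<le> 1 \<Longrightarrow> x v \<in> S"
  shows "compact_op x"
  unfolding compact_op_def
proof
  have "closure (blinfun_apply x ` cball 0 1) \<subseteq> S"
    using assms by (intro closure_minimal compact_imp_closed) auto
  then show "compact (closure (blinfun_apply x ` cball 0 1))"
    by (metis Int_absorb1 assms(2) closed_closure compact_Int_closed)
qed (rule assms)

lemma compact_op_image:
  "compact_op x \<Longrightarrow> norm v \<le> 1 \<Longrightarrow> x v \<in> closure (blinfun_apply x ` cball 0 1)"
  using closure_subset by (force simp: image_iff)

lemma compact_op_add:
  assumes "compact_op x" "compact_op y"
  shows "compact_op (x + y)"
proof (rule compact_opI)
  let ?C = "\<lambda>x. closure (blinfun_apply x ` cball 0 1)"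
  show "compact {a + b | a b. a \<in> ?C x \<and> b \<in> ?C y}"
    using assms by (intro compact_sums) (auto simp: compact_op_def)
  show "(x + y) v \<in> {a + b | a b. a \<in> ?C x \<and> b \<in> ?C y}" if "norm v \<le> 1" for v
    using compact_op_image[OF assms(1) that] compact_op_image[OF assms(2) that]
    by (auto simp: blinfun.add_left)
qed (use assms in \<open>auto simp: compact_op_clinear clinear_op_add\<close>)

lemma compact_op_scaleC_op:
  assumes "compact_op x"
  shows "compact_op (scaleC_op a x)"
proof (rule compact_opI)
  let ?C = "closure (blinfun_apply x ` cball 0 1)"
  show "compact (scaleC_ell2 a ` ?C)"
    using assms
    by (intro compact_continuous_image linear_continuous_on bounded_linear_scaleC_ell2)
      (auto simp: compact_op_def)
  show "scaleC_op a x v \<in> scaleC_ell2 a ` ?C" if "norm v \<le> 1" for v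
    using compact_op_image[OF assms that] by (auto simp: scaleC_op_apply)
qed (use assms in \<open>auto simp: compact_op_clinear clinear_op_scaleC_op\<close>)

text \<open>Membership follows from a bound for the pairing sums with any constant, here from |a +
  b| <= 2 max(|a|, |b|) in each term.\<close>

lemma schatten_class_add:
  fixes x y :: "(nat, 'b) ell2_op"
  assumes p: "1 \<le> p" and x: "x \<in> schatten_class p" and y: "y \<in> schatten_class p"
  shows "x + y \<in> schatten_class p"
proof -
  have c: "compact_op (x + y)"
    using x y by (intro compact_op_add) (auto simp: schatten_class_def)
  show ?thesis
  proof (cases p)
    case (real q)
    have q: "1 \<le> q" using p real by simp
    let ?A = "schatten_norm p x powr q" and ?B = "schatten_norm p y powr q"
    have "x + y \<in> schatten_class (ereal q)"
    proof (rule schatten_class_boundedI(1)[OF q c])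
      fix K :: "nat set" and u :: "nat \<Rightarrow> 'b ell2" and v :: "nat \<Rightarrow> nat ell2"
      assume K: "finite K" and u: "orthonormal_on K u" and v: "orthonormal_on K v"
      have "(\<Sum>i\<in>K. cmod (cinner (u i) ((x + y) (v i))) powr q)
          \<le> (\<Sum>i\<in>K. 2 powr q * (cmod (cinner (u i) (x (v i))) powr q + cmod (cinner (u i) (y (v i))) powr q))"
      proof (rule sum_mono)
        fix i
        let ?a = "cmod (cinner (u i) (x (v i)))" and ?b = "cmod (cinner (u i) (y (v i)))"
        have "cmod (cinner (u i) ((x + y) (v i))) \<le> ?a + ?b"
          by (simp add: blinfun.add_left cinner_add_right norm_triangle_ineq)
        also have "\<dots> \<le> 2 * max ?a ?b" by simp
        finally have "cmod (cinner (u i) ((x + y) (v i))) powr q \<le> (2 * max ?a ?b) powr q"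
          using q by (intro powr_mono2) auto
        also have "\<dots> = 2 powr q * (max ?a ?b) powr q" by (simp add: powr_mult)
        also have "\<dots> \<le> 2 powr q * (?a powr q + ?b powr q)"
          by (intro mult_left_mono) (auto simp: max_def)
        finally show "cmod (cinner (u i) ((x + y) (v i))) powr q \<le> 2 powr q * (?a powr q + ?b powr q)" .
      qed
      also have "\<dots> = 2 powr q * ((\<Sum>i\<in>K. cmod (cinner (u i) (x (v i))) powr q)
          + (\<Sum>i\<in>K. cmod (cinner (u i) (y (v i))) powr q))"
        by (simp only: sum_distrib_left[symmetric] sum.distrib)
      also have "\<dots> \<le> 2 powr q * (?A + ?B)"
        using x y real q K u v by (intro mult_left_mono add_mono) (auto intro!: schatten_pairing_le)
      finally show "(\<Sum>i\<in>K. cmod (cinner (u i) ((x + y) (v i))) powr q) \<le> 2 powr q * (?A + ?B)" .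
    qed
    then show ?thesis using real by simp
  next
    case PInf
    then show ?thesis using c by (simp add: schatten_class_def)
  qed (use p in simp)
qed

lemma schatten_class_scaleC_op:
  fixes x :: "(nat, 'b) ell2_op"
  assumes p: "1 \<le> p" and x: "x \<in> schatten_class p"
  shows "scaleC_op a x \<in> schatten_class p"
proof -
  have c: "compact_op (scaleC_op a x)"
    using x by (intro compact_op_scaleC_op) (auto simp: schatten_class_def)
  show ?thesis
  proof (cases p)
    case (real q)
    have q: "1 \<le> q" using p real by simp
    have "scaleC_op a x \<in> schatten_class (ereal q)"
    proof (rule schatten_class_boundedI(1)[OF q c])
      fix K :: "nat set" and u :: "nat \<Rightarrow> 'b ell2" and v :: "nat \<Rightarrow> nat ell2"
      assume K: "finite K" and u: "orthonormal_on K u" and v: "orthonormal_on K v"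
      have "(\<Sum>i\<in>K. cmod (cinner (u i) (scaleC_op a x (v i))) powr q)
          = cmod a powr q * (\<Sum>i\<in>K. cmod (cinner (u i) (x (v i))) powr q)"
        by (simp add: scaleC_op_apply cinner_scaleC_right norm_mult powr_mult sum_distrib_left)
      also have "\<dots> \<le> cmod a powr q * schatten_norm p x powr q"
        using x real q K u v by (intro mult_left_mono) (auto intro!: schatten_pairing_le)
      finally show "(\<Sum>i\<in>K. cmod (cinner (u i) (scaleC_op a x (v i))) powr q)
          \<le> cmod a powr q * schatten_norm p x powr q" .
    qed
    then show ?thesis using real by simp
  next
    case PInf
    then show ?thesis using c by (simp add: schatten_class_def)
  qed (use p in simp)
qed

section \<open>Operators with a finite Schmidt decomposition\<close>

lemma schatten_finite_schmidt:
  fixes x :: "(nat, 'b) ell2_op"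
  assumes p: "1 \<le> p" and c: "compact_op x" and J: "finite J" and x: "schmidt x J l g h"
  shows "x \<in> schatten_class (ereal p)"
    and "schatten_norm (ereal p) x powr p \<le> (\<Sum>k\<in>J. cmod (l k) powr p)"
proof -
  have b: "(\<Sum>i\<in>K. cmod (cinner (u i) (x (v i))) powr p) \<le> (\<Sum>k\<in>J. cmod (l k) powr p)"
    if "finite K" "orthonormal_on K u" "orthonormal_on K v" for K :: "nat set" and u v
    using schmidt_pairing_le[OF p x that(2,3,1)] J by simp
  show "x \<in> schatten_class (ereal p)"
    and "schatten_norm (ereal p) x powr p \<le> (\<Sum>k\<in>J. cmod (l k) powr p)"
    by (rule schatten_class_boundedI[OF p c b]; assumption)+
qed

text \<open>The counterpart of \<open>schatten_finite_schmidt\<close> for p infinite. Pairing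
  \<open>x v\<close> with itself, Cauchy-Schwarz for the sum over k and Bessel for both families
  give the bound.\<close>

lemma norm_finite_schmidt:
  fixes x :: "('a, 'b) ell2_op"
  assumes J: "finite J" and x: "schmidt x J l g h" and l: "\<And>k. k \<in> J \<Longrightarrow> cmod (l k) \<le> B" and B: "0 \<le> B"
  shows "norm x \<le> B"
proof (rule norm_blinfun_bound[OF B])
  fix v
  have g: "orthonormal_on J g" and h: "orthonormal_on J h"
    and hs: "\<And>u v. cinner u (x v) = (\<Sum>k\<in>J. l k * cinner u (g k) * cinner (h k) v)"
    using x J by (auto simp: schmidt_def has_sum_finite_iff)
  have "cmod (cinner (x v) (x v)) \<le> (\<Sum>k\<in>J. B * (cmod (cinner (g k) (x v)) * cmod (cinner (h k) v)))"
    unfolding hs[of "x v" v]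
  proof (rule order_trans[OF norm_sum sum_mono])
    fix k assume k: "k \<in> J"
    have "cmod (cinner (x v) (g k)) = cmod (cinner (g k) (x v))"
      using cinner_commute[of "x v" "g k"] by simp
    then show "cmod (l k * cinner (x v) (g k) * cinner (h k) v)
        \<le> B * (cmod (cinner (g k) (x v)) * cmod (cinner (h k) v))"
      by (simp add: norm_mult mult.assoc mult_right_mono l[OF k])
  qed
  also have "\<dots> = B * (\<Sum>k\<in>J. \<bar>cmod (cinner (g k) (x v))\<bar> * \<bar>cmod (cinner (h k) v)\<bar>)"
    by (simp add: sum_distrib_left)
  also have "\<dots> \<le> B * (L2_set (\<lambda>k. cmod (cinner (g k) (x v))) J * L2_set (\<lambda>k. cmod (cinner (h k) v)) J)"
    by (intro mult_left_mono L2_set_mult_ineq B)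
  also have "\<dots> \<le> B * (norm (x v) * norm v)"
    using bessel[OF J g, of "x v"] bessel[OF J h, of v]
    by (intro mult_left_mono mult_mono B) (auto simp: L2_set_def intro!: real_le_lsqrt sum_nonneg)
  finally have "(norm (x v))\<^sup>2 \<le> B * (norm (x v) * norm v)"
    by (simp add: cinner_self norm_power)
  then show "norm (x v) \<le> B * norm v"
    by (cases "norm (x v) = 0") (use B in \<open>auto simp: power2_eq_square mult_ac\<close>)
qed

section \<open>Matrix coefficients\<close>

definition elem_op :: "'r \<Rightarrow> 'c \<Rightarrow> ('c, 'r) ell2_op" where
  "elem_op r c = Blinfun (\<lambda>v. scaleC_ell2 (ell2_nth v c) (unit_ell2 r))"

lemma elem_op_apply: "elem_op r c v = scaleC_ell2 (ell2_nth v c) (unit_ell2 r)"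
proof -
  have "bounded_linear (\<lambda>v. scaleC_ell2 (ell2_nth v c) (unit_ell2 r))"
  proof (rule bounded_linear_intro)
    show "scaleC_ell2 (ell2_nth (v + w) c) (unit_ell2 r)
        = scaleC_ell2 (ell2_nth v c) (unit_ell2 r) + scaleC_ell2 (ell2_nth w c) (unit_ell2 r)" for v w
      by transfer (simp add: algebra_simps)
    show "scaleC_ell2 (ell2_nth (a *\<^sub>R v) c) (unit_ell2 r) = a *\<^sub>R scaleC_ell2 (ell2_nth v c) (unit_ell2 r)" for a v
      by (simp add: scaleR_scaleC scaleC_ell2.rep_eq scaleC_scaleC)
    show "norm (scaleC_ell2 (ell2_nth v c) (unit_ell2 r)) \<le> norm v * 1" for v
      using cinner_norm_le[of "unit_ell2 c" v] by (simp add: norm_scaleC_ell2)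
  qed
  then show ?thesis unfolding elem_op_def by (simp add: bounded_linear_Blinfun_apply)
qed

lemma compact_elem_op: "compact_op (elem_op r c)"
proof (rule compact_opI)
  show "clinear_op (elem_op r c)"
    unfolding clinear_op_def by (simp add: elem_op_apply scaleC_ell2.rep_eq scaleC_scaleC)
  let ?f = "\<lambda>a. scaleC_ell2 a (unit_ell2 r)"
  have "bounded_linear ?f"
  proof (rule bounded_linear_intro)
    show "?f (a + b) = ?f a + ?f b" for a b by transfer (simp add: algebra_simps)
    show "?f (x *\<^sub>R a) = x *\<^sub>R ?f a" for x a
      by (simp add: scaleR_scaleC scaleC_scaleC scaleR_conv_of_real)
    show "norm (?f a) \<le> norm a * 1" for a by (simp add: norm_scaleC_ell2)
  qed
  then show "compact (?f ` cball 0 1)"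
    by (intro compact_continuous_image linear_continuous_on) auto
  show "elem_op r c v \<in> ?f ` cball 0 1" if "norm v \<le> 1" for v
    using that cinner_norm_le[of "unit_ell2 c" v] by (auto simp: elem_op_apply)
qed

lemma cinner_elem_op: "cinner u (elem_op r c v) = cinner u (unit_ell2 r) * cinner (unit_ell2 c) v"
  by (simp add: elem_op_apply cinner_scaleC_right mult.commute)

lemma coefficient_add: "coefficient (x + y) r c = coefficient x r c + coefficient y r c"
  by (simp add: coefficient_def blinfun.add_left plus_ell2.rep_eq)

lemma coefficient_diff: "coefficient (x - y) r c = coefficient x r c - coefficient y r c"
  by (simp add: coefficient_def blinfun.diff_left minus_ell2.rep_eq)

lemma coefficient_scaleC: "coefficient (scaleC_op a x) r c = a * coefficient x r c"
  by (simp add: coefficient_def scaleC_op_apply scaleC_ell2.rep_eq)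

lemma coefficient_zero [simp]: "coefficient 0 r c = 0"
  by (simp add: coefficient_def zero_ell2.rep_eq)

lemma coefficient_sum: "coefficient (\<Sum>i\<in>F. f i) r c = (\<Sum>i\<in>F. coefficient (f i) r c)"
  by (induction F rule: infinite_finite_induct) (auto simp: coefficient_add)

lemma coefficient_elem_op: "coefficient (elem_op r c) r' c' = (if r = r' \<and> c = c' then 1 else 0)"
  by (simp add: coefficient_def elem_op_apply scaleC_ell2.rep_eq unit_ell2.rep_eq)

lemma coefficient_le_norm: "cmod (coefficient x r c) \<le> norm x"
proof -
  have "cmod (coefficient x r c) \<le> norm (unit_ell2 r) * norm (x (unit_ell2 c))"
    unfolding coefficient_def by (rule cinner_norm_le)
  then show ?thesis using norm_blinfun[of x "unit_ell2 c"] by simp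
qed

lemma unit_orthonormal_basis: "orthonormal_basis unit_ell2"
  unfolding orthonormal_basis_def
  by (auto simp: unit_ell2.rep_eq zero_ell2.rep_eq intro!: ell2_eqI)

lemma coefficients_zero:
  assumes "clinear_op x" "\<And>r c. coefficient x r c = 0"
  shows "x = 0"
proof (rule op_ext_basis[OF unit_orthonormal_basis assms(1)])
  show "clinear_op 0" by (simp add: clinear_op_def)
  show "x (unit_ell2 i) = blinfun_apply 0 (unit_ell2 i)" for i
    using assms(2) by (intro ell2_eqI) (simp add: coefficient_def zero_ell2.rep_eq)
qed

section \<open>Compactness and finite dimension make coefficients small far out\<close>

lemma finite_large_entries:
  assumes e: "0 < e"
  shows "finite {i. e \<le> cmod (ell2_nth v i)}"
proof (rule ccontr)
  assume "infinite {i. e \<le> cmod (ell2_nth v i)}"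
  then obtain F where F: "F \<subseteq> {i. e \<le> cmod (ell2_nth v i)}" "finite F" "card F = nat \<lceil>(norm v)\<^sup>2 / e\<^sup>2\<rceil> + 1"
    using infinite_arbitrarily_large by blast
  have "real (card F) * e\<^sup>2 = (\<Sum>i\<in>F. e\<^sup>2)" by simp
  also have "\<dots> \<le> (\<Sum>i\<in>F. (cmod (cinner (unit_ell2 i) v))\<^sup>2)"
    using F(1) e by (intro sum_mono power_mono) auto
  also have "\<dots> \<le> (norm v)\<^sup>2" by (rule bessel[OF F(2) orthonormal_on_unit])
  finally have "real (card F) \<le> (norm v)\<^sup>2 / e\<^sup>2" using e by (simp add: field_simps)
  then show False using F(3) by linarith
qed

text \<open>A finite e/2-net of the image of the ball confines the large coefficients to finitely
  many rows, since every net vector has few large coordinates. Each row consists of the conjugated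
  coordinates of a vector, the image of a unit vector under the adjoint.\<close>

lemma compact_op_finite_large_coefficients:
  assumes x: "compact_op x" and e: "0 < e"
  shows "finite {(r, c). e \<le> cmod (coefficient x r c)}"
proof -
  let ?S = "closure (blinfun_apply x ` cball 0 1)"
  have "seq_compact ?S" using x by (simp add: compact_op_def compact_imp_seq_compact)
  then obtain K where K: "finite K" "?S \<subseteq> (\<Union>k\<in>K. ball k (e / 2))"
    using seq_compact_imp_totally_bounded[of ?S] e by (metis half_gt_zero)
  have row: "finite {c. e \<le> cmod (coefficient x r c)}" for r
  proof -
    have "coefficient x r c = cnj (ell2_nth (adjoint_op x (unit_ell2 r)) c)" for c
      unfolding coefficient_def adjoint_op_left[OF compact_op_clinear[OF x]] by (simp add: cinner_unit_right)
    then show ?thesis using finite_large_entries[OF e] by simp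
  qed
  let ?R = "\<Union>k\<in>K. {r. e / 2 \<le> cmod (ell2_nth k r)}"
  have "r \<in> ?R" if rc: "e \<le> cmod (coefficient x r c)" for r c
  proof -
    have "x (unit_ell2 c) \<in> ?S" by (rule compact_op_image[OF x]) simp
    then obtain k where k: "k \<in> K" "dist k (x (unit_ell2 c)) < e / 2" using K(2) by auto
    have "cmod (cinner (unit_ell2 r) (k - x (unit_ell2 c))) < e / 2"
      using cinner_norm_le[of "unit_ell2 r" "k - x (unit_ell2 c)"] k(2) by (simp add: dist_norm)
    then have "cmod (ell2_nth k r - coefficient x r c) < e / 2"
      by (simp add: minus_ell2.rep_eq coefficient_def)
    then have "e / 2 \<le> cmod (ell2_nth k r)"
      using rc norm_triangle_ineq2[of "coefficient x r c" "ell2_nth k r"]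
      by (simp add: norm_minus_commute)
    then show ?thesis using k(1) by blast
  qed
  then have "{(r, c). e \<le> cmod (coefficient x r c)} \<subseteq> (SIGMA r:?R. {c. e \<le> cmod (coefficient x r c)})"
    by auto
  moreover have "finite (SIGMA r:?R. {c. e \<le> cmod (coefficient x r c)})"
    using K(1) half_gt_zero[OF e] row by (intro finite_SigmaI finite_UN_I finite_large_entries)
  ultimately show ?thesis by (rule finite_subset)
qed

text \<open>The matrix coefficients separate the points of W, so coordinates of a finite-dimensional
  W can be found among them. W is kept apart from B because the members of B may lie outside W and
  need not be complex linear. Passing from the span of B to that of \<open>insert b0 B\<close> costs
  at most one new coordinate.\<close>

lemma finite_span_coordinates:
  fixes B :: "('c, 'r) ell2_op set"
  assumes B: "finite B"
    and add: "\<And>x y. x \<in> W \<Longrightarrow> y \<in> W \<Longrightarrow> x + y \<in> W"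
    and scale: "\<And>a x. x \<in> W \<Longrightarrow> scaleC_op a x \<in> W"
    and lin: "\<And>x. x \<in> W \<Longrightarrow> clinear_op x"
    and W: "W \<subseteq> module.span scaleC_op B" and ne: "0 \<in> W"
  shows "\<exists>(n :: nat) r c b. (\<forall>i<n. b i \<in> W) \<and>
    (\<forall>y\<in>W. y = (\<Sum>i<n. scaleC_op (coefficient y (r i) (c i)) (b i)))"
  using B add scale lin W ne
proof (induction B arbitrary: W rule: finite_induct)
  interpret op: vector_space "scaleC_op :: complex \<Rightarrow> ('c, 'r) ell2_op \<Rightarrow> ('c, 'r) ell2_op"
    by (rule vector_space_scaleC_op)
  case empty
  then have "\<forall>y\<in>W. y = 0" by auto
  then show ?case by (intro exI[of _ "0::nat"]) simp
next
  interpret op: vector_space "scaleC_op :: complex \<Rightarrow> ('c, 'r) ell2_op \<Rightarrow> ('c, 'r) ell2_op"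
    by (rule vector_space_scaleC_op)
  case (insert b0 B)
  note add = insert.prems(1) and scale = insert.prems(2) and lin = insert.prems(3)
  define W' where "W' = W \<inter> op.span B"
  have diff: "x - y \<in> W" if "x \<in> W" "y \<in> W" for x y
    using add[OF that(1) scale[OF that(2), of "-1"]] by simp
  have sumW: "(\<Sum>i<m. f i) \<in> W" if "\<And>i. i < m \<Longrightarrow> f i \<in> W" for m :: nat and f
    using that insert.prems(5) by (induction m) (auto intro: add)
  have "\<exists>(n :: nat) r c b. (\<forall>i<n. b i \<in> W') \<and>
      (\<forall>y\<in>W'. y = (\<Sum>i<n. scaleC_op (coefficient y (r i) (c i)) (b i)))"
    using insert.prems unfolding W'_def
    by (intro insert.IH) (auto intro: op.span_add op.span_scale op.span_zero)
  then obtain n :: nat and r c b where nb: "\<forall>i<n. b i \<in> W'"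
    and nrep: "\<forall>y\<in>W'. y = (\<Sum>i<n. scaleC_op (coefficient y (r i) (c i)) (b i))"
    by blast
  have b: "b i \<in> W'" if "i < n" for i using nb that by blast
  have rep: "y = (\<Sum>i<n. scaleC_op (coefficient y (r i) (c i)) (b i))" if "y \<in> W'" for y
    using bspec[OF nrep that] .
  define P where "P y = (\<Sum>i<n. scaleC_op (coefficient y (r i) (c i)) (b i))" for y
  have PW: "P y \<in> W" for y unfolding P_def using b by (intro sumW scale) (auto simp: W'_def)
  have P_add: "P (x + y) = P x + P y" for x y
    by (simp add: P_def coefficient_add op.scale_left_distrib sum.distrib)
  have P_scale: "P (scaleC_op a y) = scaleC_op a (P y)" for a y
    by (simp add: P_def coefficient_scaleC op.scale_sum_right)
  have P_W': "P y = y" if "y \<in> W'" for y using rep[OF that] by (simp add: P_def)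
  show ?case
  proof (cases "\<forall>y\<in>W. P y = y")
    case True
    then show ?thesis using b unfolding P_def W'_def
      by (intro exI[of _ n] exI[of _ r] exI[of _ c] exI[of _ b]) auto
  next
    case False
    then obtain w where w: "w \<in> W" "P w \<noteq> w" by blast
    \<comment> \<open>Modulo W', the space W is spanned by w; \<open>w1\<close> represents the new
      direction and is annihilated by P.\<close>
    define w1 where "w1 = w - P w"
    have w1: "w1 \<in> W" "w1 \<noteq> 0" using w PW diff by (auto simp: w1_def)
    have "\<exists>r0 c0. coefficient w1 r0 c0 \<noteq> 0"
      using coefficients_zero[OF lin[OF w1(1)]] w1(2) by blast
    then obtain r0 c0 where a: "coefficient w1 r0 c0 \<noteq> 0" by blast
    obtain k0 where k0: "w - scaleC_op k0 b0 \<in> op.span B"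
      using insert.prems(4) w(1) op.span_breakdown_eq by blast
    have "k0 \<noteq> 0"
    proof
      assume "k0 = 0"
      then have "w \<in> W'" using k0 w(1) by (simp add: W'_def)
      then show False using P_W' w(2) by blast
    qed
    have decomp: "\<exists>k. y = P y + scaleC_op k w1" if y: "y \<in> W" for y
    proof -
      obtain k where k: "y - scaleC_op k b0 \<in> op.span B"
        using insert.prems(4) y op.span_breakdown_eq by blast
      define q where "q = k / k0"
      have "(y - scaleC_op k b0) - scaleC_op q (w - scaleC_op k0 b0) \<in> op.span B"
        by (rule op.span_diff[OF k op.span_scale[OF k0]])
      also have "(y - scaleC_op k b0) - scaleC_op q (w - scaleC_op k0 b0) = y - scaleC_op q w"
        using \<open>k0 \<noteq> 0\<close> by (simp add: op.scale_right_diff_distrib q_def)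
      finally have y': "y - scaleC_op q w \<in> W'"
        using diff[OF y scale[OF w(1)]] by (simp add: W'_def)
      have "P y = (y - scaleC_op q w) + scaleC_op q (P w)"
        using P_add[of "y - scaleC_op q w" "scaleC_op q w"] P_W'[OF y'] P_scale by simp
      then have "y = P y + scaleC_op q w1" by (simp add: w1_def op.scale_right_diff_distrib)
      then show ?thesis by blast
    qed
    define \<alpha> where "\<alpha> = coefficient w1 r0 c0"
    \<comment> \<open>Elimination: \<open>P y\<close> contributes to the coefficient at (r0, c0) as
      well, and the multiples of \<open>w1\<close> subtracted from the old vectors cancel this
      contribution.\<close>
    define b' where "b' i = (if i < n then b i - scaleC_op (coefficient (b i) r0 c0 / \<alpha>) w1
      else scaleC_op (1 / \<alpha>) w1)" for i
    define r' where "r' i = (if i < n then r i else r0)" for i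
    define c' where "c' i = (if i < n then c i else c0)" for i
    have "b' i \<in> W" if "i < Suc n" for i
      using b w1(1) by (auto simp: b'_def W'_def intro!: diff scale)
    moreover have "y = (\<Sum>i<Suc n. scaleC_op (coefficient y (r' i) (c' i)) (b' i))" if y: "y \<in> W" for y
    proof -
      obtain k where k: "y = P y + scaleC_op k w1" using decomp[OF y] by blast
      let ?s = "\<Sum>i<n. coefficient y (r i) (c i) * coefficient (b i) r0 c0"
      have "coefficient y r0 c0 = coefficient (P y) r0 c0 + k * \<alpha>"
        using arg_cong[OF k, of "\<lambda>z. coefficient z r0 c0"]
        by (simp add: coefficient_add coefficient_scaleC \<alpha>_def)
      also have "coefficient (P y) r0 c0 = ?s"
        by (simp add: P_def coefficient_sum coefficient_scaleC)
      finally have k': "k = coefficient y r0 c0 / \<alpha> - ?s / \<alpha>"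
        using a by (simp add: \<alpha>_def field_simps)
      have "(\<Sum>i<Suc n. scaleC_op (coefficient y (r' i) (c' i)) (b' i))
          = (\<Sum>i<n. scaleC_op (coefficient y (r i) (c i)) (b i - scaleC_op (coefficient (b i) r0 c0 / \<alpha>) w1))
            + scaleC_op (coefficient y r0 c0) (scaleC_op (1 / \<alpha>) w1)"
        by (simp add: b'_def r'_def c'_def)
      also have "\<dots> = P y - scaleC_op (?s / \<alpha>) w1 + scaleC_op (coefficient y r0 c0 / \<alpha>) w1"
        by (simp add: P_def op.scale_right_diff_distrib sum_subtractf op.scale_sum_left sum_divide_distrib)
      also have "\<dots> = P y + scaleC_op k w1"
        by (simp add: k' op.scale_left_diff_distrib)
      finally show ?thesis using k by simp
    qed
    ultimately show ?thesis by blast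
  qed
qed

text \<open>
  A finite-dimensional space of operators has a finite system of coordinates among the matrix
  coefficients, so that the bounded family \<open>y e\<close> is dominated by finitely many compact operators.
\<close>

lemma finite_rank_diagonal_small:
  fixes y :: "'r \<times> 'c \<Rightarrow> ('c, 'r) ell2_op"
  assumes B: "finite B" and y: "\<And>e. e \<in> I \<Longrightarrow> y e \<in> module.span scaleC_op B"
    and comp: "\<And>e. e \<in> I \<Longrightarrow> compact_op (y e)"
    and bd: "\<And>e. e \<in> I \<Longrightarrow> norm (y e) \<le> K" and \<eta>: "0 < \<eta>"
  shows "finite {(r, c). (r, c) \<in> I \<and> \<eta> \<le> cmod (coefficient (y (r, c)) r c)}"
proof (cases "I = {}")
  case False
  interpret op: vector_space "scaleC_op :: complex \<Rightarrow> ('c, 'r) ell2_op \<Rightarrow> ('c, 'r) ell2_op"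
    by (rule vector_space_scaleC_op)
  have K: "0 \<le> K" using False bd norm_ge_zero order_trans by blast
  define W where "W = {x \<in> op.span B. compact_op x}"
  obtain e0 where e0: "e0 \<in> I" using False by blast
  have "scaleC_op 0 (y e0) \<in> W"
    unfolding W_def using y[OF e0] comp[OF e0] by (auto intro: op.span_scale compact_op_scaleC_op op.span_zero)
      (metis compact_op_scaleC_op op.scale_zero_left)
  then have "0 \<in> W" by simp
  then have "\<exists>(n :: nat) r c b. (\<forall>i<n. b i \<in> W) \<and>
    (\<forall>y\<in>W. y = (\<Sum>i<n. scaleC_op (coefficient y (r i) (c i)) (b i)))"
    by (intro finite_span_coordinates[OF B])
      (auto simp: W_def compact_op_clinear intro: op.span_add op.span_scale compact_op_add compact_op_scaleC_op)
  then obtain n :: nat and r c b where b: "\<And>i. i < n \<Longrightarrow> b i \<in> W"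
    and rep: "\<And>y. y \<in> W \<Longrightarrow> y = (\<Sum>i<n. scaleC_op (coefficient y (r i) (c i)) (b i))"
    by metis
  \<comment> \<open>Each of the n summands below is at most K \<theta>. The 1 in the denominator
    makes their sum strictly smaller than \<eta> and excludes division by 0.\<close>
  define \<theta> where "\<theta> = \<eta> / (real n * K + 1)"
  have \<theta>: "0 < \<theta>" using \<eta> K by (simp add: \<theta>_def add_nonneg_pos)
  have "{(r, c). (r, c) \<in> I \<and> \<eta> \<le> cmod (coefficient (y (r, c)) r c)}
      \<subseteq> (\<Union>i<n. {(r, c). \<theta> \<le> cmod (coefficient (b i) r c)})"
  proof (clarify, rule ccontr)
    fix r' c' assume I: "(r', c') \<in> I" and large: "\<eta> \<le> cmod (coefficient (y (r', c')) r' c')"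
      and "(r', c') \<notin> (\<Union>i<n. {(r, c). \<theta> \<le> cmod (coefficient (b i) r c)})"
    then have small: "cmod (coefficient (b i) r' c') \<le> \<theta>" if "i < n" for i using that by fastforce
    let ?y = "y (r', c')"
    have "?y \<in> W" using y comp I by (simp add: W_def)
    from rep[OF this] have "coefficient ?y r' c' = (\<Sum>i<n. coefficient ?y (r i) (c i) * coefficient (b i) r' c')"
      by (metis (no_types, lifting) coefficient_sum coefficient_scaleC sum.cong)
    also have "cmod \<dots> \<le> (\<Sum>i<n. K * \<theta>)"
    proof (rule order_trans[OF norm_sum sum_mono])
      fix i assume "i \<in> {..<n}"
      then show "cmod (coefficient ?y (r i) (c i) * coefficient (b i) r' c') \<le> K * \<theta>"
        using small order_trans[OF coefficient_le_norm bd[OF I]] K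
        by (simp add: norm_mult mult_mono)
    qed
    also have "\<dots> = (real n * K) * \<theta>" by simp
    also have "\<dots> < (real n * K + 1) * \<theta>" using \<theta> by (simp add: distrib_right)
    also have "\<dots> = \<eta>" using K by (simp add: \<theta>_def add_nonneg_eq_0_iff)
    finally show False using large by simp
  qed
  moreover have "finite (\<Union>i<n. {(r, c). \<theta> \<le> cmod (coefficient (b i) r c)})"
    using b \<theta> by (auto simp: W_def intro!: compact_op_finite_large_coefficients)
  ultimately show ?thesis by (rule finite_subset)
qed simp

section \<open>Averaging to a Schur multiplier\<close>

definition unity_root :: "nat \<Rightarrow> complex" where
  "unity_root n = exp (2 * of_real pi * \<i> / of_nat n)"

lemma unity_root_power: "unity_root n ^ j = exp (2 * of_real pi * \<i> * of_nat j / of_nat n)"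
  unfolding unity_root_def exp_of_nat_mult[symmetric] by (simp add: mult_ac)

lemma norm_unity_root [simp]: "cmod (unity_root n) = 1"
  by (simp add: unity_root_def norm_exp_eq_Re)

lemma unity_root_cnj: "cnj (unity_root n ^ a) * unity_root n ^ a = 1"
  using complex_norm_square[of "unity_root n ^ a"] by (simp add: norm_power mult.commute)

lemma unity_root_orthogonality:
  assumes "a < n" "b < n"
  shows "(\<Sum>s<n. unity_root n ^ (s * a) * cnj (unity_root n ^ (s * b))) = (if a = b then of_nat n else 0)"
proof -
  define x where "x = unity_root n ^ a * cnj (unity_root n ^ b)"
  have n: "1 \<le> n" using assms by simp
  have pow: "unity_root n ^ (s * a) * cnj (unity_root n ^ (s * b)) = x ^ s" for s
    by (simp add: x_def power_mult_distrib power_mult[symmetric] mult.commute)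
  show ?thesis
  proof (cases "a = b")
    case True
    then have "x = 1" unfolding x_def using unity_root_cnj[of n b] by (simp add: mult.commute)
    then show ?thesis unfolding pow using True by simp
  next
    case False
    have "x \<noteq> 1"
    proof
      assume "x = 1"
      then have "unity_root n ^ a = unity_root n ^ b"
        using unity_root_cnj[of n b] unfolding x_def
        by (metis mult.assoc mult.left_neutral mult.right_neutral)
      then have "a mod n = b mod n"
        unfolding unity_root_power using complex_root_unity_eq[OF n] by blast
      then show False using False assms by simp
    qed
    have "unity_root n ^ n = 1"
      unfolding unity_root_power using n by simp
    moreover have "x ^ n = (unity_root n ^ n) ^ a * cnj ((unity_root n ^ n) ^ b)"
      by (simp add: x_def power_mult_distrib power_mult[symmetric] mult.commute)
    ultimately have "x ^ n = 1" by simp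
    then show ?thesis unfolding pow using False \<open>x \<noteq> 1\<close> by (simp add: geometric_sum)
  qed
qed

section \<open>Finite matrices placed on chosen rows and columns\<close>

definition unitary_matrix :: "nat \<Rightarrow> (nat \<Rightarrow> nat \<Rightarrow> complex) \<Rightarrow> bool" where
  "unitary_matrix n G \<longleftrightarrow>
     (\<forall>k<n. \<forall>k'<n. (\<Sum>i<n. cnj (G k i) * G k' i) = (if k = k' then 1 else 0))"

text \<open>Row k of G carried to the unit vectors at the places \<open>R i\<close> and multiplied
  by the diagonal unitary with entries a. These are the singular vectors of a test matrix after
  conjugation.\<close>

definition frame ::
  "nat \<Rightarrow> (nat \<Rightarrow> 'a) \<Rightarrow> (nat \<Rightarrow> complex) \<Rightarrow> (nat \<Rightarrow> nat \<Rightarrow> complex) \<Rightarrow> nat \<Rightarrow> 'a ell2" where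
  "frame n R a G k = (\<Sum>i<n. scaleC_ell2 (a i * G k i) (unit_ell2 (R i)))"

lemma cinner_frame_right:
  "cinner u (frame n R a G k) = (\<Sum>i<n. a i * G k i * cinner u (unit_ell2 (R i)))"
  by (simp add: frame_def cinner_sum_right cinner_scaleC_right)

lemma cinner_frame_left:
  "cinner (frame n R a G k) v = (\<Sum>i<n. cnj (a i * G k i) * cinner (unit_ell2 (R i)) v)"
  by (simp add: frame_def cinner_sum_left cinner_scaleC_left)

lemma orthonormal_on_frame:
  assumes G: "unitary_matrix n G" and R: "inj_on R {..<n}" and a: "\<And>i. i < n \<Longrightarrow> cmod (a i) = 1"
  shows "orthonormal_on {..<n} (frame n R a G)"
  unfolding orthonormal_on_def
proof (intro ballI)
  fix k k' assume k: "k \<in> {..<n}" "k' \<in> {..<n}"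
  have entry: "cinner (unit_ell2 (R i)) (frame n R a G k') = a i * G k' i" if i: "i < n" for i
  proof -
    have "cinner (unit_ell2 (R i)) (frame n R a G k') = (\<Sum>j<n. if j = i then a j * G k' j else 0)"
      unfolding cinner_frame_right cinner_unit_unit
      using R i by (intro sum.cong refl) (auto simp: inj_on_def)
    then show ?thesis using i by simp
  qed
  have "cinner (frame n R a G k) (frame n R a G k') = (\<Sum>i<n. cnj (a i * G k i) * (a i * G k' i))"
    unfolding cinner_frame_left[of n R a G k] by (intro sum.cong refl) (simp only: entry lessThan_iff)
  also have "\<dots> = (\<Sum>i<n. cnj (G k i) * G k' i)"
  proof (rule sum.cong[OF refl])
    fix i assume i: "i \<in> {..<n}"
    have "cnj (a i) * a i = 1"
      using i a complex_norm_square[of "a i"] by (simp add: mult.commute)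
    moreover have "cnj (a i * G k i) * (a i * G k' i) = (cnj (a i) * a i) * (cnj (G k i) * G k' i)" by simp
    ultimately show "cnj (a i * G k i) * (a i * G k' i) = cnj (G k i) * G k' i" by simp
  qed
  finally show "cinner (frame n R a G k) (frame n R a G k') = (if k = k' then 1 else 0)"
    using G k by (simp add: unitary_matrix_def)
qed

lemma compact_op_zero: "compact_op 0"
  by (rule compact_opI[of _ "{0}"]) (auto simp: clinear_op_def)

text \<open>The phases a and b are absorbed by the singular vectors and leave l unchanged. This
  makes the norm bound of a test matrix independent of the diagonal unitaries and of the places R
  and C.\<close>

lemma frame_schmidt:
  assumes G: "unitary_matrix n G" and H: "unitary_matrix n H"
    and R: "inj_on R {..<n}" and C: "inj_on C {..<n}"
    and a: "\<And>i. i < n \<Longrightarrow> cmod (a i) = 1" and b: "\<And>i. i < n \<Longrightarrow> cmod (b i) = 1"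
    and z: "\<And>i j. i < n \<Longrightarrow> j < n \<Longrightarrow> z i j = (\<Sum>k<n. l k * G k i * cnj (H k j))"
  shows "schmidt (\<Sum>i<n. \<Sum>j<n. scaleC_op (z i j * a i * cnj (b j)) (elem_op (R i) (C j)))
    {..<n} l (frame n R a G) (frame n C b H)" (is "schmidt ?x _ _ _ _")
  unfolding schmidt_def
proof (intro conjI allI)
  show "orthonormal_on {..<n} (frame n R a G)" by (rule orthonormal_on_frame[OF G R a])
  show "orthonormal_on {..<n} (frame n C b H)" by (rule orthonormal_on_frame[OF H C b])
  fix u v
  let ?u = "\<lambda>i. cinner u (unit_ell2 (R i))" and ?v = "\<lambda>j. cinner (unit_ell2 (C j)) v"
  let ?f = "\<lambda>i j k. l k * (a i * G k i * ?u i) * (cnj (b j * H k j) * ?v j)"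
  have "cinner u (?x v)
      = (\<Sum>i<n. \<Sum>j<n. z i j * a i * cnj (b j) * (?u i * ?v j))"
    by (simp only: blinfun.sum_left cinner_sum_right scaleC_op_apply cinner_scaleC_right cinner_elem_op)
  also have "\<dots> = (\<Sum>i<n. \<Sum>j<n. \<Sum>k<n. ?f i j k)"
    by (intro sum.cong refl) (simp add: z sum_distrib_left sum_distrib_right mult_ac)
  also have "\<dots> = (\<Sum>i<n. \<Sum>k<n. \<Sum>j<n. ?f i j k)"
    by (intro sum.cong refl sum.swap)
  also have "\<dots> = (\<Sum>k<n. \<Sum>i<n. \<Sum>j<n. ?f i j k)"
    by (rule sum.swap)
  also have "\<dots> = (\<Sum>k<n. l k * cinner u (frame n R a G k) * cinner (frame n C b H k) v)"
    unfolding cinner_frame_left cinner_frame_right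
    by (intro sum.cong refl) (simp only: sum_distrib_left sum_distrib_right, rule sum.swap)
  finally show "((\<lambda>k. l k * cinner u (frame n R a G k) * cinner (frame n C b H k) v) has_sum
      cinner u (?x v)) {..<n}"
    by (intro has_sum_finiteI) simp_all
qed

text \<open>Both sides are the trace pairing of y with the conjugated matrix w, computed on the left
  by its singular vectors and on the right by entries.\<close>

lemma frame_pairing:
  assumes y: "clinear_op y"
    and w: "\<And>i j. i < n \<Longrightarrow> j < n \<Longrightarrow> w i j = (\<Sum>k<n. m k * G k i * cnj (H k j))"
  shows "(\<Sum>k<n. cnj (m k) * cinner (frame n R a G k) (y (frame n C b H k))) =
    (\<Sum>i<n. \<Sum>j<n. cnj (w i j) * cnj (a i) * b j * coefficient y (R i) (C j))"
    (is "?L = _")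
proof -
  let ?f = "\<lambda>i j k. cnj (m k) * cnj (a i * G k i) * (b j * H k j) * coefficient y (R i) (C j)"
  have yf: "y (frame n C b H k) = (\<Sum>j<n. scaleC_ell2 (b j * H k j) (y (unit_ell2 (C j))))" for k
    unfolding frame_def by (simp add: blinfun.sum_right clinear_op_scaleC[OF y])
  have "?L
      = (\<Sum>k<n. cnj (m k) * (\<Sum>j<n. b j * H k j * (\<Sum>i<n. cnj (a i * G k i) * coefficient y (R i) (C j))))"
    unfolding cinner_frame_left yf cinner_sum_right cinner_scaleC_right coefficient_def by (rule refl)
  also have "\<dots> = (\<Sum>k<n. \<Sum>j<n. \<Sum>i<n. ?f i j k)"
    by (simp add: sum_distrib_left mult_ac)
  also have "\<dots> = (\<Sum>k<n. \<Sum>i<n. \<Sum>j<n. ?f i j k)"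
    by (intro sum.cong refl sum.swap)
  also have "\<dots> = (\<Sum>i<n. \<Sum>k<n. \<Sum>j<n. ?f i j k)"
    by (rule sum.swap)
  also have "\<dots> = (\<Sum>i<n. \<Sum>j<n. \<Sum>k<n. ?f i j k)"
    by (intro sum.cong refl sum.swap)
  also have "\<dots> = (\<Sum>i<n. \<Sum>j<n. cnj (w i j) * cnj (a i) * b j * coefficient y (R i) (C j))"
    by (intro sum.cong refl) (simp add: w sum_distrib_left sum_distrib_right mult_ac)
  finally show ?thesis .
qed

lemma schatten_class_finite_schmidt:
  fixes x :: "(nat, 'b) ell2_op"
  assumes "1 \<le> p" "compact_op x" "finite J" "schmidt x J l g h"
  shows "x \<in> schatten_class p"
proof (cases p)
  case (real q)
  then show ?thesis using schatten_finite_schmidt(1)[of q x J l g h] assms by simp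
qed (use assms in \<open>auto simp: schatten_class_def\<close>)

lemma elem_op_schmidt: "schmidt (elem_op r c) {0::nat} (\<lambda>_. 1) (\<lambda>_. unit_ell2 r) (\<lambda>_. unit_ell2 c)"
  unfolding schmidt_def orthonormal_on_def
  by (auto simp: cinner_elem_op cinner_unit_unit simp del: cinner_unit_left intro!: has_sum_finiteI)

lemma elem_op_schatten:
  fixes r :: 'b and c :: nat
  assumes p: "1 \<le> p"
  shows "elem_op r c \<in> schatten_class p" and "schatten_norm p (elem_op r c) \<le> 1"
proof -
  show "elem_op r c \<in> schatten_class p"
    by (rule schatten_class_finite_schmidt[OF p compact_elem_op _ elem_op_schmidt]) simp
  show "schatten_norm p (elem_op r c) \<le> 1"
  proof (cases p)
    case (real q)
    have q: "1 \<le> q" using p real by simp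
    have "schatten_norm (ereal q) (elem_op r c) powr q \<le> 1 powr q"
      using schatten_finite_schmidt(2)[OF q compact_elem_op _ elem_op_schmidt, of r c] by simp
    then show ?thesis using powr_le_cancel_base[of _ q 1] q real by simp
  next
    case PInf
    then show ?thesis
      using norm_finite_schmidt[OF _ elem_op_schmidt, of 1 r c] by (simp add: schatten_norm_def)
  qed (use p in simp)
qed

section \<open>The space of Schatten operators supported on I\<close>

lemma schatten_class_on_add:
  fixes x y :: "(nat, nat) ell2_op"
  assumes "1 \<le> p" "x \<in> schatten_class_on p I" "y \<in> schatten_class_on p I"
  shows "x + y \<in> schatten_class_on p I"
  using assms by (auto simp: schatten_class_on_def coefficient_add intro: schatten_class_add)

lemma schatten_class_on_scaleC:
  fixes x :: "(nat, nat) ell2_op"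
  assumes "1 \<le> p" "x \<in> schatten_class_on p I"
  shows "scaleC_op a x \<in> schatten_class_on p I"
  using assms by (auto simp: schatten_class_on_def coefficient_scaleC intro: schatten_class_scaleC_op)

lemma scaleC_op_minus1: "scaleC_op (-1) x = - x"
  by (rule blinfun_eqI) (simp add: scaleC_op_apply scaleC_minus1 blinfun.minus_left)

lemma scaleC_op_zero: "scaleC_op 0 x = 0"
  by (rule blinfun_eqI) (simp add: scaleC_op_apply, transfer, simp)

lemma schatten_class_on_diff:
  fixes x y :: "(nat, nat) ell2_op"
  assumes "1 \<le> p" "x \<in> schatten_class_on p I" "y \<in> schatten_class_on p I"
  shows "x - y \<in> schatten_class_on p I"
  using schatten_class_on_add[OF assms(1,2) schatten_class_on_scaleC[OF assms(1,3), of "-1"]]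
  by (simp add: scaleC_op_minus1)

lemma schatten_class_on_zero:
  assumes "1 \<le> p"
  shows "(0 :: (nat, nat) ell2_op) \<in> schatten_class_on p I"
  using schatten_class_scaleC_op[OF assms elem_op_schatten(1)[OF assms], of 0]
  by (simp add: scaleC_op_zero schatten_class_on_def)

lemma schatten_class_on_sum:
  fixes f :: "'i \<Rightarrow> (nat, nat) ell2_op"
  assumes "1 \<le> p" "\<And>i. i \<in> F \<Longrightarrow> f i \<in> schatten_class_on p I"
  shows "(\<Sum>i\<in>F. f i) \<in> schatten_class_on p I"
  using assms(2)
  by (induction F rule: infinite_finite_induct)
    (auto intro: schatten_class_on_zero schatten_class_on_add assms(1))

lemma elem_op_schatten_class_on:
  "1 \<le> p \<Longrightarrow> (r, c) \<in> I \<Longrightarrow> (elem_op r c :: (nat, nat) ell2_op) \<in> schatten_class_on p I"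
  by (auto simp: schatten_class_on_def coefficient_elem_op elem_op_schatten)

lemma opnorm_on_leD:
  assumes "opnorm_on X N S \<le> ennreal K" "0 \<le> K" "x \<in> X" "N x \<le> 1"
  shows "N (S x) \<le> K"
proof -
  have "ennreal (N (S x)) \<le> opnorm_on X N S"
    unfolding opnorm_on_def using assms(3,4) by (intro SUP_upper) simp
  then show ?thesis using assms(1,2) by (meson ennreal_le_iff order_trans)
qed

text \<open>With sign 1 up to k and -1 afterwards the sum telescopes to T_k - (T_n - T_k). This is
  the only choice of signs to which the unconditional constant is applied.\<close>

lemma sum_signed_Delta:
  assumes k: "1 \<le> k" and n: "k \<le> n"
  shows "(\<Sum>j=1..n. (if j \<le> k then 1 else -1 :: real) *\<^sub>R Delta T j x) = T k x + T k x - T n x"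
  using n
proof (induction n rule: dec_induct)
  case base
  have "(\<Sum>j=1..m. Delta T j x) = T m x" if "1 \<le> m" for m
    using that by (induction m rule: dec_induct) (auto simp: Delta_def)
  then show ?case using k by simp
next
  case (step n)
  then show ?case using k by (simp add: Delta_def)
qed

section \<open>Multipliers obtained from an approximating sequence\<close>

locale schatten_approximation =
  fixes p :: ereal and I :: "(nat \<times> nat) set" and T :: "nat \<Rightarrow> (nat, nat) ell2_op \<Rightarrow> (nat, nat) ell2_op"
    and \<delta> :: real
  assumes p: "1 \<le> p" and \<delta>: "0 < \<delta>"
    and approx: "approximating_sequence scaleC_op (schatten_class_on p I) (schatten_norm p) T"
    and unc: "real_unconditional_const (schatten_class_on p I) (schatten_norm p) T \<le> ennreal (1 + \<delta>)"
begin

abbreviation "X \<equiv> schatten_class_on p I"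
abbreviation "N \<equiv> schatten_norm p"

text \<open>The symbol of the Schur multiplier into which averaging turns T_k.\<close>

definition diagonal_coefficient :: "nat \<Rightarrow> nat \<times> nat \<Rightarrow> complex" where
  "diagonal_coefficient k = (\<lambda>(r, c). coefficient (T k (elem_op r c)) r c)"

lemma T_props:
  assumes "1 \<le> k"
  shows "x \<in> X \<Longrightarrow> T k x \<in> X"
    and "x \<in> X \<Longrightarrow> y \<in> X \<Longrightarrow> T k (x + y) = T k x + T k y"
    and "x \<in> X \<Longrightarrow> T k (scaleC_op a x) = scaleC_op a (T k x)"
    and "opnorm_on X N (T k) < \<infinity>"
    and "finite_rank_on scaleC_op X (T k)"
  using approx assms unfolding approximating_sequence_def bounded_operator_on_def by blast+

lemma X_norm: "x \<in> X \<Longrightarrow> norm x \<le> N x"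
  by (rule norm_le_schatten_norm[OF p]) (simp add: schatten_class_on_def)

lemma X_compact: "x \<in> X \<Longrightarrow> compact_op x"
  by (simp add: schatten_class_on_def schatten_class_def)

lemma diagonal_coefficient_tendsto:
  assumes "e \<in> I"
  shows "(\<lambda>k. diagonal_coefficient k e) \<longlonglongrightarrow> 1"
proof -
  obtain r c where e: "e = (r, c)" by (cases e)
  let ?E = "elem_op r c :: (nat, nat) ell2_op"
  have E: "?E \<in> X" using assms e by (intro elem_op_schatten_class_on p) simp
  have N: "(\<lambda>k. N (T k ?E - ?E)) \<longlonglongrightarrow> 0"
    using approx E unfolding approximating_sequence_def by blast
  have "(\<lambda>k. diagonal_coefficient k e - 1) \<longlonglongrightarrow> 0"
  proof (rule Lim_null_comparison[OF _ N])
    have "cmod (diagonal_coefficient k e - 1) \<le> N (T k ?E - ?E)" if "1 \<le> k" for k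
    proof -
      have "cmod (coefficient (T k ?E - ?E) r c) \<le> N (T k ?E - ?E)"
        using order_trans[OF coefficient_le_norm X_norm[OF schatten_class_on_diff[OF p T_props(1)[OF that E] E]]] .
      then show ?thesis by (simp add: e diagonal_coefficient_def coefficient_diff coefficient_elem_op)
    qed
    then show "\<forall>\<^sub>F k in sequentially. cmod (diagonal_coefficient k e - 1) \<le> N (T k ?E - ?E)"
      using eventually_sequentially by blast
  qed
  then show ?thesis by (rule LIM_zero_cancel)
qed

text \<open>Finite rank enters here: the images of the matrix units under T_k form a bounded family
  of compact operators in a finite-dimensional space. Outside a finite subset of I, the symbol of
  2T_k - 1 is therefore close to -1.\<close>

lemma finite_large_diagonal_coefficients:
  assumes k: "1 \<le> k" and \<eta>: "0 < \<eta>"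
  shows "finite {e \<in> I. \<eta> \<le> cmod (diagonal_coefficient k e)}"
proof -
  obtain B where B: "finite B" "T k ` X \<subseteq> module.span scaleC_op B"
    using T_props(5)[OF k] unfolding finite_rank_on_def by blast
  define K where "K = enn2real (opnorm_on X N (T k))"
  have opn: "opnorm_on X N (T k) \<le> ennreal K" using T_props(4)[OF k] by (simp add: K_def)
  define y :: "nat \<times> nat \<Rightarrow> (nat, nat) ell2_op" where "y = (\<lambda>(r, c). T k (elem_op r c))"
  have EX: "(elem_op r c :: (nat, nat) ell2_op) \<in> X" if "(r, c) \<in> I" for r c
    using that by (rule elem_op_schatten_class_on[OF p])
  have yX: "y e \<in> X" if "e \<in> I" for e
    using that T_props(1)[OF k EX] by (auto simp: y_def split: prod.split)
  have "y e \<in> module.span scaleC_op B" if "e \<in> I" for e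
    using that B(2) EX by (auto simp: y_def split: prod.split)
  moreover have "norm (y e) \<le> K" if e: "e \<in> I" for e
  proof -
    have "N (y e) \<le> K"
      using opnorm_on_leD[OF opn _ EX elem_op_schatten(2)[OF p]] e
      by (auto simp: y_def K_def split: prod.split)
    then show ?thesis using X_norm[OF yX[OF e]] by simp
  qed
  ultimately have "finite {(r, c). (r, c) \<in> I \<and> \<eta> \<le> cmod (coefficient (y (r, c)) r c)}"
    using yX X_compact by (intro finite_rank_diagonal_small[OF B(1) _ _ _ \<eta>]) auto
  then show ?thesis
    by (rule finite_subset[rotated]) (auto simp: y_def diagonal_coefficient_def)
qed

lemma linear_sum:
  assumes add: "\<And>x y. x \<in> X \<Longrightarrow> y \<in> X \<Longrightarrow> A (x + y) = A x + A y"
    and zero: "A 0 = 0" and f: "\<And>i. i \<in> F \<Longrightarrow> f i \<in> X"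
  shows "A (\<Sum>i\<in>F. f i) = (\<Sum>i\<in>F. A (f i))"
  using f by (induction F rule: infinite_finite_induct)
    (auto simp: zero add schatten_class_on_sum[OF p])

text \<open>
  Conjugation by the diagonal unitaries with entries \<open>\<rho>\<^bsup>si\<^esup>\<close> and \<open>\<rho>\<^bsup>snj\<^esup>\<close>, where \<open>\<rho>\<close> is a
  primitive root of unity of order \<open>n\<^sup>2\<close>, multiplies the entry \<open>(i, j)\<close> by \<open>\<rho>\<^bsup>s(i + nj)\<^esup>\<close>. As the
  numbers \<open>i + nj\<close> are distinct, averaging over \<open>s\<close> leaves a Schur multiplier.
\<close>

lemma multiplier_bound:
  assumes k: "1 \<le> k"
    and R: "inj_on R {..<n}" and C: "inj_on C {..<n}"
    and supp: "\<And>i j. i < n \<Longrightarrow> j < n \<Longrightarrow> z i j \<noteq> 0 \<Longrightarrow> (R i, C j) \<in> I"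
    and G: "unitary_matrix n G" and H: "unitary_matrix n H"
    and G': "unitary_matrix n G'" and H': "unitary_matrix n H'"
    and z: "\<And>i j. i < n \<Longrightarrow> j < n \<Longrightarrow> z i j = (\<Sum>k<n. l k * G k i * cnj (H k j))"
    and w: "\<And>i j. i < n \<Longrightarrow> j < n \<Longrightarrow> w i j = (\<Sum>k<n. m k * G' k i * cnj (H' k j))"
    and l: "\<And>(x :: (nat, nat) ell2_op) g h. compact_op x \<Longrightarrow> schmidt x {..<n} l g h \<Longrightarrow> N x \<le> 1"
    and m: "\<And>(x :: (nat, nat) ell2_op) g h. x \<in> schatten_class p \<Longrightarrow> N x \<le> 1 + \<delta> \<Longrightarrow>
      orthonormal_on {..<n} g \<Longrightarrow> orthonormal_on {..<n} h \<Longrightarrow>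
      cmod (\<Sum>k<n. cnj (m k) * cinner (g k) (x (h k))) \<le> \<beta>"
  shows "cmod (\<Sum>i<n. \<Sum>j<n. (2 * diagonal_coefficient k (R i, C j) - 1) * z i j * cnj (w i j)) \<le> \<beta>"
proof (cases "n = 0")
  case True
  \<comment> \<open>For n = 0 only the nonnegativity of \<beta> is at stake. It comes from
    \<open>m\<close> at the operator 0, whose norm is bounded by \<open>l\<close> with an empty
    Schmidt decomposition.\<close>
  have "cmod (\<Sum>k<n. cnj (m k) * cinner 0 ((0 :: (nat, nat) ell2_op) 0)) \<le> \<beta>"
    using schatten_class_on_zero[OF p, of I] \<delta> X_norm[of 0] True
    by (intro m) (auto simp: schatten_class_on_def orthonormal_on_def schatten_norm_nonneg
        intro!: order_trans[OF l[OF compact_op_zero]] simp: schmidt_def)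
  then show ?thesis using True by simp
next
  case False
  define \<rho> where "\<rho> = unity_root (n * n)"
  have \<rho>1: "cmod \<rho> = 1" by (simp add: \<rho>_def)
  define E :: "nat \<Rightarrow> nat \<Rightarrow> (nat, nat) ell2_op" where "E i j = elem_op (R i) (C j)" for i j
  have EX: "E i j \<in> X" if "i < n" "j < n" "z i j \<noteq> 0" for i j
    unfolding E_def using supp[OF that] by (rule elem_op_schatten_class_on[OF p])
  \<comment> \<open>T_n' stands in for the identity. Only finitely many entries occur, so
    coefficientwise convergence as n' tends to infinity restores the 1 at the end.\<close>
  define D where "D n' i j = 2 * diagonal_coefficient k (R i, C j) - diagonal_coefficient n' (R i, C j)" for n' i j
  let ?S = "\<lambda>n'. \<Sum>i<n. \<Sum>j<n. D n' i j * z i j * cnj (w i j)"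
  have main: "cmod (?S n') \<le> \<beta>" if n': "k \<le> n'" for n'
  proof -
    have n'1: "1 \<le> n'" using k n' by simp
    define A where "A x = T k x + T k x - T n' x" for x
    have AX: "A x \<in> X" if "x \<in> X" for x
      unfolding A_def using that k n'1 by (intro schatten_class_on_diff schatten_class_on_add p T_props)
    have A_add: "A (x + y) = A x + A y" if "x \<in> X" "y \<in> X" for x y
      unfolding A_def using T_props(2)[OF k that] T_props(2)[OF n'1 that] by simp
    interpret op: vector_space "scaleC_op :: complex \<Rightarrow> (nat, nat) ell2_op \<Rightarrow> (nat, nat) ell2_op"
      by (rule vector_space_scaleC_op)
    have A_scale: "A (scaleC_op a x) = scaleC_op a (A x)" if "x \<in> X" for a x
      unfolding A_def using T_props(3)[OF k that] T_props(3)[OF n'1 that]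
      by (simp add: op.scale_right_distrib op.scale_right_diff_distrib)
    have A0: "A 0 = 0"
      using A_scale[OF schatten_class_on_zero[OF p], of 0] by (simp add: scaleC_op_zero)
    have A_norm: "N (A x) \<le> 1 + \<delta>" if x: "x \<in> X" "N x \<le> 1" for x
    proof -
      let ?\<epsilon> = "\<lambda>j. if j \<le> k then 1 else -1 :: real"
      have "opnorm_on X N (\<lambda>x. \<Sum>j=1..n'. ?\<epsilon> j *\<^sub>R Delta T j x) \<le> ennreal (1 + \<delta>)"
        using unc unfolding real_unconditional_const_le_iff by auto
      from opnorm_on_leD[OF this _ x] have "N (\<Sum>j=1..n'. ?\<epsilon> j *\<^sub>R Delta T j x) \<le> 1 + \<delta>"
        using \<delta> by simp
      then show ?thesis unfolding A_def sum_signed_Delta[OF k n'] .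
    qed
    define \<alpha> where "\<alpha> i j i' j' = coefficient (A (E i j)) (R i') (C j')" for i j i' j'
    define a where "a s i = \<rho> ^ (s * i)" for s i
    define b where "b s j = cnj (\<rho> ^ (s * (n * j)))" for s j
    have a1: "cmod (a s i) = 1" and b1: "cmod (b s i) = 1" for s i
      by (simp_all add: a_def b_def norm_power \<rho>1)
    have ab: "a s i * cnj (b s j) = \<rho> ^ (s * (i + n * j))" for s i j
      by (simp add: a_def b_def distrib_left power_add)
    have ab': "cnj (a s i) * b s j = cnj (\<rho> ^ (s * (i + n * j)))" for s i j
      by (simp add: a_def b_def distrib_left power_add)
    let ?Z = "\<lambda>s i j. scaleC_op (z i j * a s i * cnj (b s j)) (E i j)"
    define Z where "Z s = (\<Sum>i<n. \<Sum>j<n. ?Z s i j)" for s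
    have ZtX: "?Z s i j \<in> X" if "i < n" "j < n" for s i j
      using schatten_class_on_scaleC[OF p EX[OF that]] schatten_class_on_zero[OF p]
      by (cases "z i j = 0") (auto simp: scaleC_op_zero)
    have ZX: "Z s \<in> X" for s
      unfolding Z_def using ZtX by (intro schatten_class_on_sum[OF p]) auto
    have "schmidt (Z s) {..<n} l (frame n R (a s) G) (frame n C (b s) H)" for s
      unfolding Z_def E_def by (rule frame_schmidt[OF G H R C a1 b1 z])
    then have ZN: "N (Z s) \<le> 1" for s using l X_compact[OF ZX] by blast
    have AZ: "A (Z s) = (\<Sum>i<n. \<Sum>j<n. scaleC_op (z i j * a s i * cnj (b s j)) (A (E i j)))" for s
    proof -
      have "A (Z s) = (\<Sum>i<n. A (\<Sum>j<n. ?Z s i j))"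
        unfolding Z_def using ZtX by (intro linear_sum A_add A0 schatten_class_on_sum[OF p]) auto
      also have "\<dots> = (\<Sum>i<n. \<Sum>j<n. A (?Z s i j))"
        using ZtX by (intro sum.cong refl linear_sum A_add A0) auto
      also have "\<dots> = (\<Sum>i<n. \<Sum>j<n. scaleC_op (z i j * a s i * cnj (b s j)) (A (E i j)))"
      proof (intro sum.cong refl)
        fix i j assume "i \<in> {..<n}" "j \<in> {..<n}"
        then show "A (?Z s i j) = scaleC_op (z i j * a s i * cnj (b s j)) (A (E i j))"
          using EX[of i j] A_scale by (cases "z i j = 0") (auto simp: scaleC_op_zero A0)
      qed
      finally show ?thesis .
    qed
    \<comment> \<open>This conjugates z by the s-th pair of diagonal unitaries, applies A, undoes
      the conjugation and pairs the result with w.\<close>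
    define \<Phi> where "\<Phi> s = (\<Sum>k<n. cnj (m k) * cinner (frame n R (a s) G' k) (A (Z s) (frame n C (b s) H' k)))" for s
    have \<Phi>_le: "cmod (\<Phi> s) \<le> \<beta>" for s
      unfolding \<Phi>_def using AX[OF ZX, of s] A_norm[OF ZX ZN, of s]
      by (intro m orthonormal_on_frame[OF G' R] orthonormal_on_frame[OF H' C] a1 b1)
        (auto simp: schatten_class_on_def)
    have \<Phi>: "\<Phi> s = (\<Sum>i'<n. \<Sum>j'<n. \<Sum>i<n. \<Sum>j<n. z i j * cnj (w i' j') * \<alpha> i j i' j' *
        (\<rho> ^ (s * (i + n * j)) * cnj (\<rho> ^ (s * (i' + n * j')))))" for s
    proof -
      have "\<Phi> s = (\<Sum>i'<n. \<Sum>j'<n. cnj (w i' j') * cnj (a s i') * b s j' * coefficient (A (Z s)) (R i') (C j'))"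
        unfolding \<Phi>_def
        by (rule frame_pairing[OF compact_op_clinear[OF X_compact[OF AX[OF ZX]]] w])
      also have "\<dots> = (\<Sum>i'<n. \<Sum>j'<n. \<Sum>i<n. \<Sum>j<n. z i j * cnj (w i' j') * \<alpha> i j i' j' *
          ((a s i * cnj (b s j)) * (cnj (a s i') * b s j')))"
        unfolding AZ coefficient_sum coefficient_scaleC \<alpha>_def sum_distrib_left
        by (intro sum.cong refl) (simp add: mult_ac)
      finally show ?thesis unfolding ab ab' .
    qed
    let ?M = "n * n"
    let ?t = "\<lambda>i j i' j'. z i j * cnj (w i' j') * \<alpha> i j i' j' * of_nat ?M"
    have lt: "i + n * j < ?M" if "i < n" "j < n" for i j
    proof -
      have "i + n * j < n * Suc j" using that(1) by simp
      also have "\<dots> \<le> n * n" using that(2) by (intro mult_le_mono2) simp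
      finally show ?thesis .
    qed
    have inj: "i + n * j = i' + n * j' \<longleftrightarrow> i = i' \<and> j = j'" if "i < n" "i' < n" for i j i' j'
    proof
      assume eq: "i + n * j = i' + n * j'"
      have "(i + n * j) mod n = i" "(i' + n * j') mod n = i'" "(i + n * j) div n = j" "(i' + n * j') div n = j'"
        using that by auto
      then show "i = i' \<and> j = j'" using eq by metis
    qed simp
    have "(\<Sum>s<?M. \<Phi> s) = (\<Sum>i'<n. \<Sum>j'<n. \<Sum>i<n. \<Sum>j<n. z i j * cnj (w i' j') * \<alpha> i j i' j' *
        (\<Sum>s<?M. \<rho> ^ (s * (i + n * j)) * cnj (\<rho> ^ (s * (i' + n * j')))))"
      unfolding \<Phi> sum_distrib_left
      by (subst sum.swap, rule sum.cong[OF refl], subst sum.swap, rule sum.cong[OF refl],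
          subst sum.swap, rule sum.cong[OF refl], rule sum.swap)
    also have "\<dots> = (\<Sum>i'<n. \<Sum>j'<n. \<Sum>i<n. \<Sum>j<n. if i = i' then if j = j' then
        ?t i j i' j' else 0 else 0)"
      unfolding \<rho>_def
      by (intro sum.cong refl) (simp add: unity_root_orthogonality lt inj del: complex_cnj_power of_nat_mult)
    also have "\<dots> = (\<Sum>i'<n. \<Sum>j'<n. ?t i' j' i' j')"
    proof (intro sum.cong refl)
      fix i' j' assume ij: "i' \<in> {..<n}" "j' \<in> {..<n}"
      have "(\<Sum>i<n. \<Sum>j<n. if i = i' then if j = j' then ?t i j i' j' else 0 else 0)
          = (\<Sum>i<n. if i = i' then \<Sum>j<n. if j = j' then ?t i j i' j' else 0 else 0)"
        by (intro sum.cong refl) simp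
      also have "\<dots> = ?t i' j' i' j'"
        using ij by simp
      finally show "(\<Sum>i<n. \<Sum>j<n. if i = i' then if j = j' then ?t i j i' j' else 0 else 0)
          = ?t i' j' i' j'" .
    qed
    also have "\<dots> = ?S n' * of_nat ?M"
    proof -
      have "\<alpha> i j i j = D n' i j" for i j
        by (simp add: \<alpha>_def A_def D_def diagonal_coefficient_def E_def coefficient_add coefficient_diff)
      then show ?thesis by (simp add: sum_distrib_left sum_distrib_right mult_ac)
    qed
    finally have avg: "?S n' * of_nat ?M = (\<Sum>s<?M. \<Phi> s)" by simp
    have "cmod (?S n') * real ?M = cmod (\<Sum>s<?M. \<Phi> s)"
      unfolding avg[symmetric] by (simp add: norm_mult)
    also have "\<dots> \<le> real ?M * \<beta>"
      using order_trans[OF norm_sum sum_bounded_above[of "{..<?M}" "\<lambda>s. cmod (\<Phi> s)" \<beta>]] \<Phi>_le by simp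
    finally show ?thesis using False by (simp add: mult.commute)
  qed
  have "(\<lambda>n'. cmod (?S n')) \<longlonglongrightarrow>
      cmod (\<Sum>i<n. \<Sum>j<n. (2 * diagonal_coefficient k (R i, C j) - 1) * z i j * cnj (w i j))"
  proof (intro tendsto_norm tendsto_sum)
    fix i j assume ij: "i \<in> {..<n}" "j \<in> {..<n}"
    show "(\<lambda>n'. D n' i j * z i j * cnj (w i j)) \<longlonglongrightarrow>
        (2 * diagonal_coefficient k (R i, C j) - 1) * z i j * cnj (w i j)"
    proof (cases "z i j = 0")
      case False
      then show ?thesis
        unfolding D_def using ij supp
        by (intro tendsto_mult tendsto_diff tendsto_const diagonal_coefficient_tendsto) auto
    qed simp
  qed
  then show ?thesis
    by (rule tendsto_upperbound) (use main eventually_sequentially in auto)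
qed

end

section \<open>Cycles with a fixed half\<close>

lemma path_between_mono: "path_between E u vs w \<Longrightarrow> E \<subseteq> E' \<Longrightarrow> path_between E' u vs w"
  unfolding path_between_def by blast

lemma path_between_take:
  assumes "path_between E u vs w" "i < length vs"
  shows "path_between E u (take (Suc i) vs) (vs ! i)"
proof -
  have "last (take (Suc i) vs) = vs ! i" using assms(2) by (simp add: take_Suc_conv_app_nth)
  then show ?thesis using assms by (auto simp: path_between_def)
qed

lemma path_between_drop:
  assumes "path_between E u vs w" "i < length vs"
  shows "path_between E (vs ! i) (drop i vs) w"
  using assms unfolding path_between_def by (auto simp: hd_drop_conv_nth)

lemma bipartite_edges_iff: "{Inl c, Inr r} \<in> bipartite_edges I \<longleftrightarrow> (r, c) \<in> I"
  by (auto simp: bipartite_edges_def doubleton_eq_iff)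

lemma bipartite_edgesE:
  assumes "{u, w} \<in> bipartite_edges I"
  shows "isl u \<longleftrightarrow> \<not> isl w"
  using assms by (auto simp: bipartite_edges_def doubleton_eq_iff)

lemma bipartite_path_parity:
  assumes "path_between (bipartite_edges I - F) (Inl c) vs w" "i < length vs"
  shows "isl (vs ! i) \<longleftrightarrow> even i"
  using assms(2)
proof (induction i)
  case 0
  then show ?case using assms(1) by (simp add: path_between_def hd_conv_nth)
next
  case (Suc i)
  then have "{vs ! i, vs ! Suc i} \<in> bipartite_edges I"
    using assms(1) by (auto simp: path_between_def)
  then show ?case using Suc bipartite_edgesE by auto
qed

lemma not_asymptotically_infinite_dist:
  assumes "\<not> asymptotically_infinite_dist E u w"
  shows "\<exists>d. \<forall>F. finite F \<longrightarrow> (\<exists>vs. path_between (E - F) u vs w \<and> length vs \<le> d + 1)"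
proof -
  obtain d where d: "\<And>F. finite F \<Longrightarrow> F \<subseteq> E \<Longrightarrow> \<not> enat d \<le> graph_dist (E - F) u w"
    using assms unfolding asymptotically_infinite_dist_def by blast
  have "\<exists>vs. path_between (E - F) u vs w \<and> length vs \<le> d + 1" if "finite F" for F
  proof -
    have "graph_dist (E - (F \<inter> E)) u w < enat d" using d[of "F \<inter> E"] that by simp
    moreover have "E - (F \<inter> E) = E - F" by blast
    ultimately obtain vs where "path_between (E - F) u vs w" "enat (length vs - 1) < enat d"
      unfolding graph_dist_def by (auto simp: INF_less_iff)
    then show ?thesis by (intro exI[of _ vs]) auto
  qed
  then show ?thesis by blast
qed

text \<open>
  Take the pair \<open>(c, r)\<close> and the bound \<open>n\<close> with \<open>n\<close> minimal. By minimality, for every other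
  vertex \<open>v\<close> the paths of length \<open>n\<close> through \<open>v\<close> are destroyed by deleting finitely many edges,
  as one of the two pieces of such a path is a path from \<open>C\<close> to \<open>R\<close> of length less than \<open>n\<close>.
\<close>

lemma robust_paths:
  fixes I :: "(nat \<times> nat) set"
  assumes "\<not> asymptotically_infinite_dist (bipartite_edges I) (Inl c) (Inr r)"
  obtains n c0 r0 where "odd n" "3 \<le> n"
    "\<And>F V. finite F \<Longrightarrow> finite V \<Longrightarrow> \<exists>vs. path_between (bipartite_edges I - F) (Inl c0) vs (Inr r0) \<and>
      length vs = n + 1 \<and> set vs \<inter> V \<subseteq> {Inl c0, Inr r0}"
proof -
  let ?E = "bipartite_edges I"
  define P where "P c r d \<longleftrightarrow> (\<forall>F. finite F \<longrightarrow> (\<exists>vs. path_between (?E - F) (Inl c) vs (Inr r) \<and> length vs \<le> d + 1))"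
    for c r d
  have "\<exists>d c r. P c r d" using not_asymptotically_infinite_dist[OF assms] unfolding P_def by blast
  then have ex: "\<exists>c r. P c r (LEAST d. \<exists>c r. P c r d)" by (rule LeastI_ex)
  define n where "n = (LEAST d. \<exists>c r. P c r d)"
  obtain c0 r0 where P0: "P c0 r0 n" using ex unfolding n_def by blast
  have nP: "\<not> P c r d" if "d < n" for c r d using not_less_Least[of d] that unfolding n_def by blast
  have len: "even (length vs)" "2 \<le> length vs" if "path_between (?E - F) (Inl c) vs (Inr r)" for F c r vs
  proof -
    have ne: "vs \<noteq> []" and l: "vs ! (length vs - 1) = Inr r"
      using that by (auto simp: path_between_def last_conv_nth)
    then have "odd (length vs - 1)"
      using bipartite_path_parity[OF that, of "length vs - 1"] by simp
    then show "even (length vs)" "2 \<le> length vs" using ne by (cases vs; auto simp: Suc_le_eq; fail)+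
  qed
  have n1: "1 \<le> n"
    using P0 len(2) unfolding P_def by (metis add_le_cancel_right finite.emptyI nat_1_add_1 order_trans)
  \<comment> \<open>By minimality of n, for every pair (c, r) a finite deletion destroys all paths
    from c to r with at most n vertices, that is, of length less than n.\<close>
  have "\<exists>F. finite F \<and> (\<forall>vs. path_between (?E - F) (Inl c) vs (Inr r) \<longrightarrow> n < length vs)" for c r
    using nP[of "n - 1" c r] n1 unfolding P_def by (auto simp: not_le)
  then obtain Fb where Fb: "\<And>c r. finite (Fb c r)"
    "\<And>c r vs. path_between (?E - Fb c r) (Inl c) vs (Inr r) \<Longrightarrow> n < length vs"
    by metis
  have main: "\<exists>vs. path_between (?E - F) (Inl c0) vs (Inr r0) \<and>
      length vs = n + 1 \<and> set vs \<inter> V \<subseteq> {Inl c0, Inr r0}" if "finite F" "finite V" for F V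
  proof -
    \<comment> \<open>For v in C the piece from v to r0 is cut, for v in R the piece from c0 to v.
      Each joins C to R and, if v is an inner vertex of a path of length n, is shorter than
      n.\<close>
    define g where "g v = (case v of Inl c' \<Rightarrow> Fb c' r0 | Inr r' \<Rightarrow> Fb c0 r')" for v :: "nat + nat"
    define F' where "F' = F \<union> Fb c0 r0 \<union> (\<Union>v\<in>V. g v)"
    have "finite (g v)" for v using Fb(1) by (simp add: g_def split: sum.split)
    then have "finite F'" using that Fb(1) by (simp add: F'_def)
    then obtain vs where vs: "path_between (?E - F') (Inl c0) vs (Inr r0)" "length vs \<le> n + 1"
      using P0 unfolding P_def by blast
    have "n < length vs"
      by (rule Fb(2), rule path_between_mono[OF vs(1)]) (auto simp: F'_def)
    then have l: "length vs = n + 1" using vs(2) by simp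
    have ends: "vs ! 0 = Inl c0" "vs ! n = Inr r0"
      using vs(1) l by (auto simp: path_between_def hd_conv_nth last_conv_nth)
    have "v = Inl c0 \<or> v = Inr r0" if v: "v \<in> set vs" "v \<in> V" for v
    proof (rule ccontr)
      assume neg: "\<not> (v = Inl c0 \<or> v = Inr r0)"
      obtain i where i: "i < length vs" "v = vs ! i" using v(1) by (metis in_set_conv_nth)
      have i': "0 < i" "i < n" using i neg ends l by (metis gr0I, metis Suc_eq_plus1 less_antisym)
      have sub: "?E - F' \<subseteq> ?E - g v" using v(2) by (auto simp: F'_def)
      show False
      proof (cases v)
        case (Inl c')
        then have "path_between (?E - Fb c' r0) (Inl c') (drop i vs) (Inr r0)"
          using path_between_mono[OF path_between_drop[OF vs(1) i(1)] sub] i(2) by (simp add: g_def)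
        from Fb(2)[OF this] show False using l i' by simp
      next
        case (Inr r')
        then have "path_between (?E - Fb c0 r') (Inl c0) (take (Suc i) vs) (Inr r')"
          using path_between_mono[OF path_between_take[OF vs(1) i(1)] sub] i(2) by (simp add: g_def)
        from Fb(2)[OF this] show False using l i' by simp
      qed
    qed
    moreover have "path_between (?E - F) (Inl c0) vs (Inr r0)"
      by (rule path_between_mono[OF vs(1)]) (auto simp: F'_def)
    ultimately show ?thesis using l by blast
  qed
  \<comment> \<open>Deleting the edge between c0 and r0 itself rules out n = 1.\<close>
  obtain vs where vs: "path_between (?E - {{Inl c0, Inr r0}}) (Inl c0) vs (Inr r0)" "length vs = n + 1"
    using main[of "{{Inl c0, Inr r0}}" "{}"] by auto
  have "odd n" using len(1)[OF vs(1)] vs(2) by simp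
  moreover have "n \<noteq> 1"
  proof
    assume "n = 1"
    then have "vs ! 0 = Inl c0" "vs ! 1 = Inr r0" "{vs ! 0, vs ! 1} \<in> ?E - {{Inl c0, Inr r0}}"
      using vs by (auto simp: path_between_def hd_conv_nth last_conv_nth)
    then show False by simp
  qed
  ultimately have "3 \<le> n" using n1 by presburger
  then show thesis using \<open>odd n\<close> main that by blast
qed

text \<open>The edges of the cycle with vertices \<open>C 0, R 0, C 1, R 1, \<dots>, C (n - 1), R (n - 1)\<close>.\<close>

definition cycle_edge :: "(nat \<Rightarrow> 'r) \<Rightarrow> (nat \<Rightarrow> 'c) \<Rightarrow> nat \<Rightarrow> nat \<Rightarrow> 'r \<times> 'c" where
  "cycle_edge R C n m = (R (m div 2), C (Suc m div 2 mod n))"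

text \<open>The half e is fixed before the quantifier over D: the index k of T_k is chosen according
  to e, and D will be the finite set of edges on which the symbol of this T_k is not yet
  small.\<close>

definition half_fixed_cycles :: "('r \<times> 'c) set \<Rightarrow> nat \<Rightarrow> (nat \<Rightarrow> 'r \<times> 'c) \<Rightarrow> bool" where
  "half_fixed_cycles I n e \<longleftrightarrow> odd n \<and> 3 \<le> n \<and> (\<forall>m<n. e m \<in> I) \<and>
    (\<forall>D. finite D \<longrightarrow> (\<exists>R C. inj_on R {..<n} \<and> inj_on C {..<n} \<and>
      (\<forall>m<2 * n. cycle_edge R C n m \<in> I) \<and> (\<forall>m<n. cycle_edge R C n m = e m) \<and>
      (\<forall>m. n \<le> m \<and> m < 2 * n \<longrightarrow> cycle_edge R C n m \<notin> D)))"

lemma half_fixed_cycles_exist: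
  fixes I :: "(nat \<times> nat) set"
  assumes "\<not> asymptotically_infinite_dist (bipartite_edges I) (Inl c) (Inr r)"
  shows "\<exists>n e. half_fixed_cycles I n e"
proof -
  let ?E = "bipartite_edges I"
  obtain n c0 r0 where n: "odd n" "3 \<le> n"
    and paths: "\<And>F V. finite F \<Longrightarrow> finite V \<Longrightarrow> \<exists>vs. path_between (?E - F) (Inl c0) vs (Inr r0) \<and>
      length vs = n + 1 \<and> set vs \<inter> V \<subseteq> {Inl c0, Inr r0}"
    using robust_paths[OF assms] by metis
  obtain vs where vs: "path_between (?E - {}) (Inl c0) vs (Inr r0)" "length vs = n + 1"
    using paths[of "{}" "{}"] by auto
  define e where "e m = (if even m then (projr (vs ! Suc m), projl (vs ! m)) else (projr (vs ! m), projl (vs ! Suc m)))" for m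
  have cyc: "\<exists>R C. inj_on R {..<n} \<and> inj_on C {..<n} \<and>
      (\<forall>m<2 * n. cycle_edge R C n m \<in> I) \<and> (\<forall>m<n. cycle_edge R C n m = e m) \<and>
      (\<forall>m. n \<le> m \<and> m < 2 * n \<longrightarrow> cycle_edge R C n m \<notin> D)" if D: "finite D" for D
  proof -
    define F where "F = (\<lambda>(r, c). {Inl c, Inr r} :: (nat + nat) set) ` D"
    have "finite F" using D by (simp add: F_def)
    then obtain ws where ws: "path_between (?E - F) (Inl c0) ws (Inr r0)" "length ws = n + 1"
      and disj: "set ws \<inter> set vs \<subseteq> {Inl c0, Inr r0}"
      using paths[of F "set vs"] by auto
    have ends: "vs ! 0 = Inl c0" "vs ! n = Inr r0" "ws ! 0 = Inl c0" "ws ! n = Inr r0"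
      using vs ws by (auto simp: path_between_def hd_conv_nth last_conv_nth)
    have dist: "distinct vs" "distinct ws" using vs ws by (auto simp: path_between_def)
    \<comment> \<open>The cycle runs forward along vs and backward along ws. The index 2n is kept as
      a second copy of vertex 0.\<close>
    define v where "v m = (if m \<le> n then vs ! m else ws ! (2 * n - m))" for m
    have v_ge: "v m = ws ! (2 * n - m)" if "n \<le> m" for m
      using that ends by (auto simp: v_def)
    have cross: "vs ! a \<noteq> ws ! b" if ab: "a \<le> n" "0 < b" "b < n" for a b
    proof
      assume eq: "vs ! a = ws ! b"
      then have "ws ! b \<in> set ws \<inter> set vs" using ab vs(2) ws(2) by (metis IntI Suc_eq_plus1 less_Suc_eq le_imp_less_Suc nth_mem)
      then have "ws ! b = ws ! 0 \<or> ws ! b = ws ! n" using disj ends by auto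
      then show False using dist(2) ab ws(2) by (auto simp: nth_eq_iff_index_eq)
    qed
    have inj: "inj_on v {..<2 * n}"
    proof (rule linorder_inj_onI)
      fix a b assume ab: "a < b" "a \<in> {..<2 * n}" "b \<in> {..<2 * n}"
      consider "b \<le> n" | "a \<le> n" "n < b" | "n < a" by linarith
      then show "v a \<noteq> v b"
      proof cases
        case 1
        then show ?thesis using ab dist vs(2) by (simp add: v_def nth_eq_iff_index_eq)
      next
        case 2
        then show ?thesis using ab cross[of a "2 * n - b"] by (simp add: v_def)
      next
        case 3
        then show ?thesis using ab dist ws(2) by (simp add: v_def nth_eq_iff_index_eq)
      qed
    qed auto
    have par: "isl (v m) \<longleftrightarrow> even m" if "m \<le> 2 * n" for m
    proof (cases "m \<le> n")
      case True
      then show ?thesis using bipartite_path_parity[OF vs(1)] vs(2) by (simp add: v_def)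
    next
      case False
      then have "isl (v m) \<longleftrightarrow> even (2 * n - m)"
        using bipartite_path_parity[OF ws(1), of "2 * n - m"] ws(2) by (simp add: v_def)
      then show ?thesis using that by simp
    qed
    have e1: "{v m, v (Suc m)} \<in> ?E" if "m < n" for m
      using vs that by (auto simp: path_between_def v_def)
    have e2: "{v m, v (Suc m)} \<in> ?E - F" if "n \<le> m" "m < 2 * n" for m
    proof -
      have "Suc (2 * n - Suc m) = 2 * n - m" "Suc (2 * n - Suc m) < length ws" using that ws(2) by auto
      then have "{ws ! (2 * n - Suc m), ws ! (2 * n - m)} \<in> ?E - F"
        using ws(1) unfolding path_between_def by metis
      then show ?thesis using that by (simp add: v_ge insert_commute)
    qed
    define C where "C i = projl (v (2 * i))" for i
    define R where "R i = projr (v (2 * i + 1))" for i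
    have vC: "v (2 * i) = Inl (C i)" if "i \<le> n" for i
      using par[of "2 * i"] that by (simp add: C_def)
    have vR: "v (2 * i + 1) = Inr (R i)" if "i < n" for i
      using par[of "2 * i + 1"] that by (simp add: R_def)
    have Cn: "C n = C 0" using ends by (simp add: C_def v_def)
    have "inj_on C {..<n}"
    proof (rule inj_onI)
      fix i j assume "i \<in> {..<n}" "j \<in> {..<n}" "C i = C j"
      then show "i = j" using vC[of i] vC[of j] inj_onD[OF inj, of "2 * i" "2 * j"] by simp
    qed
    moreover have "inj_on R {..<n}"
    proof (rule inj_onI)
      fix i j assume "i \<in> {..<n}" "j \<in> {..<n}" "R i = R j"
      then show "i = j" using vR[of i] vR[of j] inj_onD[OF inj, of "2 * i + 1" "2 * j + 1"] by simp
    qed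
    moreover have edge: "{v m, v (Suc m)} = {Inl (snd (cycle_edge R C n m)), Inr (fst (cycle_edge R C n m))}" (is ?edge)
      and edge': "cycle_edge R C n m = (if even m then (projr (v (Suc m)), projl (v m)) else (projr (v m), projl (v (Suc m))))" (is ?edge')
      if m: "m < 2 * n" for m
    proof -
      have "?edge \<and> ?edge'"
      proof (cases "even m")
        case True
        then obtain i where i: "m = 2 * i" by blast
        then have "cycle_edge R C n m = (R i, C i)" using m by (simp add: cycle_edge_def)
        then show ?thesis using vC[of i] vR[of i] i m by simp
      next
        case False
        then obtain i where i: "m = 2 * i + 1" by (metis oddE)
        have "C (Suc i mod n) = C (Suc i)" using i m Cn by (cases "Suc i = n") auto
        then have "cycle_edge R C n m = (R i, C (Suc i))" using i by (simp add: cycle_edge_def)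
        then show ?thesis using vC[of "Suc i"] vR[of i] i m by (simp add: insert_commute)
      qed
      then show ?edge ?edge'
        by auto
    qed
    moreover have "cycle_edge R C n m \<in> I" if "m < 2 * n" for m
    proof -
      have "{v m, v (Suc m)} \<in> ?E" using e1[of m] e2[of m] that by (cases "m < n") auto
      then show ?thesis unfolding edge[OF that] bipartite_edges_iff by simp
    qed
    moreover have "cycle_edge R C n m = e m" if "m < n" for m
      using edge'[of m] that by (simp add: e_def v_def)
    moreover have "cycle_edge R C n m \<notin> D" if m: "n \<le> m" "m < 2 * n" for m
    proof
      assume "cycle_edge R C n m \<in> D"
      then have "{v m, v (Suc m)} \<in> F"
        unfolding edge[OF m(2)] F_def by (force simp: image_iff split: prod.splits)
      then show False using e2[OF m] by simp
    qed
    ultimately show ?thesis by blast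
  qed
  have "e m \<in> I" if "m < n" for m
  proof -
    obtain R C where "\<forall>m<2 * n. cycle_edge R C n m \<in> I" "\<forall>m<n. cycle_edge R C n m = e m"
      using cyc[of "{}"] by auto
    then show ?thesis using that by (metis add_less_mono less_add_same_cancel1 mult_2 trans_less_add1)
  qed
  then show ?thesis unfolding half_fixed_cycles_def using n cyc by blast
qed

section \<open>The cyclic test matrices\<close>

lemma unity_root_power_self: "1 \<le> n \<Longrightarrow> unity_root n ^ n = 1"
  unfolding unity_root_power by simp

lemma unity_root_power_mod:
  assumes "1 \<le> n"
  shows "unity_root n ^ (k * a) = unity_root n ^ (k * (a mod n))"
proof -
  have "unity_root n ^ (k * a) = unity_root n ^ (n * (k * (a div n)) + k * (a mod n))"
    by (metis add_mult_distrib2 mult.left_commute mult_div_mod_eq)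
  also have "\<dots> = unity_root n ^ (k * (a mod n))"
    by (simp add: power_add power_mult unity_root_power_self[OF assms])
  finally show ?thesis .
qed

lemma unity_root_orthogonality_mod:
  assumes n: "1 \<le> n"
  shows "(\<Sum>k<n. unity_root n ^ (k * a) * cnj (unity_root n ^ (k * b))) = (if a mod n = b mod n then of_nat n else 0)"
  unfolding unity_root_power_mod[OF n, of _ a] unity_root_power_mod[OF n, of _ b]
  by (rule unity_root_orthogonality) (use n in auto)

section \<open>Expansion of power sums over roots of unity\<close>

lemma of_real_gbinomial: "complex_of_real (\<alpha> gchoose k) = (complex_of_real \<alpha> gchoose k)"
  by (simp add: gbinomial_prod_rev)

text \<open>The tail of the binomial series is the (n+1)-st power of z times a series dominated by
  its absolute values at 1/2. Convergence at 3/4, a point between 1/2 and the radius of convergence,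
  makes the latter summable.\<close>

lemma binomial_taylor_bound:
  fixes \<alpha> :: real
  shows "\<exists>K\<ge>0. \<forall>z. cmod z \<le> 1 / 2 \<longrightarrow>
    cmod ((1 + z) powr complex_of_real \<alpha> - (\<Sum>a\<le>n. complex_of_real (\<alpha> gchoose a) * z ^ a)) \<le> K * cmod z ^ Suc n"
proof -
  define c where "c a = complex_of_real \<alpha> gchoose a" for a
  have s: "(\<lambda>a. c a * z ^ a) sums (1 + z) powr complex_of_real \<alpha>" if "cmod z < 1" for z
    unfolding c_def by (rule gen_binomial_complex[OF that])
  have "summable (\<lambda>a. norm (c a * (1 / 2) ^ a))"
    by (rule powser_insidea[of c "3 / 4"]) (use s[of "3 / 4"] in \<open>auto simp: sums_iff\<close>)
  then have "summable (\<lambda>i. cmod (c (i + Suc n)) * (1 / 2) ^ (i + Suc n))"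
    by (subst summable_iff_shift) (simp add: norm_mult norm_power)
  then have "summable (\<lambda>i. 2 ^ Suc n * (cmod (c (i + Suc n)) * (1 / 2) ^ (i + Suc n)))"
    by (rule summable_mult)
  then have sm: "summable (\<lambda>i. cmod (c (i + Suc n)) * (1 / 2) ^ i)"
    by (simp add: power_add mult_ac power_divide)
  define K where "K = (\<Sum>i. cmod (c (i + Suc n)) * (1 / 2) ^ i)"
  have "0 \<le> K" unfolding K_def by (rule suminf_nonneg[OF sm]) simp
  moreover have "cmod ((1 + z) powr complex_of_real \<alpha> - (\<Sum>a\<le>n. complex_of_real (\<alpha> gchoose a) * z ^ a)) \<le> K * cmod z ^ Suc n"
    if z: "cmod z \<le> 1 / 2" for z
  proof -
    have sz: "(\<lambda>a. c a * z ^ a) sums (1 + z) powr complex_of_real \<alpha>" using z by (intro s) simp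
    then have "(\<lambda>i. c (i + Suc n) * z ^ (i + Suc n)) sums
        ((1 + z) powr complex_of_real \<alpha> - (\<Sum>a<Suc n. c a * z ^ a))"
      by (rule sums_split_initial_segment)
    then have "(1 + z) powr complex_of_real \<alpha> - (\<Sum>a\<le>n. complex_of_real (\<alpha> gchoose a) * z ^ a)
        = (\<Sum>i. c (i + Suc n) * z ^ (i + Suc n))"
      by (simp add: sums_iff of_real_gbinomial c_def lessThan_Suc_atMost)
    also have "cmod \<dots> \<le> (\<Sum>i. cmod (c (i + Suc n)) * (1 / 2) ^ i * cmod z ^ Suc n)"
    proof (rule norm_suminf_le)
      fix i
      have "cmod z ^ i \<le> (1 / 2) ^ i" using z by (intro power_mono) auto
      then have "cmod (c (i + Suc n)) * cmod z ^ i * cmod z ^ Suc n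
          \<le> cmod (c (i + Suc n)) * (1 / 2) ^ i * cmod z ^ Suc n"
        by (intro mult_right_mono mult_left_mono) auto
      then show "cmod (c (i + Suc n) * z ^ (i + Suc n)) \<le> cmod (c (i + Suc n)) * (1 / 2) ^ i * cmod z ^ Suc n"
        by (simp add: norm_mult norm_power power_add mult_ac)
    qed (rule summable_mult2[OF sm])
    also have "\<dots> = K * cmod z ^ Suc n"
      unfolding K_def by (rule suminf_mult2[OF sm, symmetric])
    finally show ?thesis .
  qed
  ultimately show ?thesis by blast
qed

text \<open>Since |1 + z|^q is the squared modulus of (1 + z)^(q/2), the holomorphic binomial series
  can be used. With |P| <= L and |f| <= L + K, factoring |f|^2 - |P|^2 gives the constant K (2L +
  K).\<close>

lemma norm_powr_taylor_bound:
  fixes q :: real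
  shows "\<exists>M\<ge>0. \<forall>z. cmod z \<le> 1 / 2 \<longrightarrow>
    \<bar>cmod (1 + z) powr q - (cmod (\<Sum>a\<le>n. complex_of_real (q / 2 gchoose a) * z ^ a))\<^sup>2\<bar> \<le> M * cmod z ^ Suc n"
proof -
  obtain K where K: "0 \<le> K" and T: "\<And>z. cmod z \<le> 1 / 2 \<Longrightarrow>
      cmod ((1 + z) powr complex_of_real (q / 2) - (\<Sum>a\<le>n. complex_of_real (q / 2 gchoose a) * z ^ a)) \<le> K * cmod z ^ Suc n"
    using binomial_taylor_bound[of "q / 2" n] by blast
  define L where "L = (\<Sum>a\<le>n. \<bar>q / 2 gchoose a\<bar>)"
  have L: "0 \<le> L" by (simp add: L_def sum_nonneg)
  have "\<bar>cmod (1 + z) powr q - (cmod (\<Sum>a\<le>n. complex_of_real (q / 2 gchoose a) * z ^ a))\<^sup>2\<bar>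
      \<le> (K * (2 * L + K)) * cmod z ^ Suc n" if z: "cmod z \<le> 1 / 2" for z
  proof -
    define f where "f = (1 + z) powr complex_of_real (q / 2)"
    define P where "P = (\<Sum>a\<le>n. complex_of_real (q / 2 gchoose a) * z ^ a)"
    have fq: "cmod (1 + z) powr q = (cmod f)\<^sup>2"
      by (simp add: f_def norm_powr_real_powr' power2_eq_square flip: powr_add)
    have zp: "cmod z ^ a \<le> 1" for a using z by (intro power_le_one) auto
    have P: "cmod P \<le> L"
      unfolding P_def L_def
      by (intro order_trans[OF norm_sum] sum_mono)
        (simp add: norm_mult norm_power mult_left_le zp)
    have fP: "cmod (f - P) \<le> K * cmod z ^ Suc n" using T[OF z] by (simp add: f_def P_def)
    have "K * cmod z ^ Suc n \<le> K" using mult_left_le[OF zp K] .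
    then have f: "cmod f \<le> L + K"
      using norm_triangle_sub[of f P] fP P by linarith
    have "\<bar>(cmod f)\<^sup>2 - (cmod P)\<^sup>2\<bar> = \<bar>cmod f - cmod P\<bar> * (cmod f + cmod P)"
      by (simp add: power2_eq_square square_diff_square_factored abs_mult mult.commute)
    also have "\<dots> \<le> (K * cmod z ^ Suc n) * (2 * L + K)"
      using norm_triangle_ineq3[of f P] fP f P by (intro mult_mono) auto
    finally show ?thesis unfolding fq P_def[symmetric] by (simp add: mult_ac)
  qed
  then show ?thesis using K L by (intro exI[of _ "K * (2 * L + K)"]) auto
qed

text \<open>Expanding the squares, the sum over k keeps only the pairs (a, b) congruent modulo n.
  For a, b <= n these are a = b, with an even power of t that cancels in the difference, and (0, n)
  and (n, 0), with the odd power t^n. Each of the latter contributes n c_0 c_n t^n to S, and the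
  difference doubles it.\<close>

lemma truncated_power_sum_difference:
  fixes c :: "nat \<Rightarrow> real" and t :: real
  assumes n: "odd n"
  defines "S \<equiv> \<lambda>s. \<Sum>k<n. (cmod (\<Sum>a\<le>n. complex_of_real (c a) * (complex_of_real s * unity_root n ^ k) ^ a))\<^sup>2"
  shows "S t - S (- t) = 4 * real n * c 0 * c n * t ^ n"
proof -
  have n1: "1 \<le> n" using n by (cases n) auto
  have S: "complex_of_real (S s) = (\<Sum>a\<le>n. \<Sum>b\<le>n. if a mod n = b mod n then of_nat n * complex_of_real (c a * c b * s ^ (a + b)) else 0)" for s
  proof -
    let ?f = "\<lambda>a b k. complex_of_real (c a * c b * s ^ (a + b)) *
        (unity_root n ^ (k * a) * cnj (unity_root n ^ (k * b)))"
    have "complex_of_real (S s) = (\<Sum>k<n. \<Sum>a\<le>n. \<Sum>b\<le>n. ?f a b k)"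
      unfolding S_def of_real_sum complex_norm_square cnj_sum sum_product
      by (intro sum.cong refl) (simp add: power_mult_distrib power_mult power_add mult_ac)
    also have "\<dots> = (\<Sum>a\<le>n. \<Sum>k<n. \<Sum>b\<le>n. ?f a b k)"
      by (rule sum.swap)
    also have "\<dots> = (\<Sum>a\<le>n. \<Sum>b\<le>n. \<Sum>k<n. ?f a b k)"
      by (intro sum.cong refl sum.swap)
    also have "\<dots> = (\<Sum>a\<le>n. \<Sum>b\<le>n. if a mod n = b mod n then of_nat n * complex_of_real (c a * c b * s ^ (a + b)) else 0)"
      unfolding sum_distrib_left[symmetric] unity_root_orthogonality_mod[OF n1]
      by (intro sum.cong refl) simp
    finally show ?thesis .
  qed
  let ?X = "2 * of_nat n * complex_of_real (c 0 * c n * t ^ n)"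
  have "complex_of_real (S t - S (- t)) = (\<Sum>a\<le>n. \<Sum>b\<le>n. if a mod n = b mod n then
      of_nat n * complex_of_real (c a * c b * (t ^ (a + b) - (- t) ^ (a + b))) else 0)"
    unfolding of_real_diff S sum_subtractf[symmetric]
    by (intro sum.cong refl) (simp add: right_diff_distrib)
  also have "\<dots> = (\<Sum>a\<le>n. \<Sum>b\<le>n. (if a = 0 then if b = n then ?X else 0 else 0) + (if a = n then if b = 0 then ?X else 0 else 0))"
  proof (intro sum.cong refl)
    fix a b assume "a \<in> {..n}" "b \<in> {..n}"
    then have ab: "a \<le> n" "b \<le> n" by auto
    consider "a = b" | "a < b" "b < n" | "0 < a" "a < b" "b = n" | "a = 0" "b = n"
      | "b < a" "a < n" | "0 < b" "b < a" "a = n" | "b = 0" "a = n"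
      using ab n1 by linarith
    then show "(if a mod n = b mod n then
      of_nat n * complex_of_real (c a * c b * (t ^ (a + b) - (- t) ^ (a + b))) else 0)
      = (if a = 0 then if b = n then ?X else 0 else 0) + (if a = n then if b = 0 then ?X else 0 else 0)"
      using n1 n by cases (auto simp: power_add simp flip: power_mult_distrib)
  qed
  also have "\<dots> = 2 * ?X"
  proof -
    have "(\<Sum>a\<le>n. \<Sum>b\<le>n. if a = x then if b = y then ?X else 0 else 0) = ?X" if "x \<le> n" "y \<le> n" for x y
    proof -
      have "(\<Sum>a\<le>n. \<Sum>b\<le>n. if a = x then if b = y then ?X else 0 else 0) = (\<Sum>a\<le>n. if a = x then (\<Sum>b\<le>n. if b = y then ?X else 0) else 0)"
        by (intro sum.cong refl) simp
      then show ?thesis using that by simp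
    qed
    from this[of 0 n] this[of n 0] show ?thesis by (simp only: sum.distrib) simp
  qed
  also have "\<dots> = complex_of_real (4 * real n * c 0 * c n * t ^ n)" by simp
  finally show ?thesis by (simp only: of_real_eq_iff)
qed

text \<open>
  To order \<open>t\<^sup>n\<close> the two sums differ by \<open>4 n c t\<^sup>n\<close>, where \<open>c\<close> is the binomial coefficient
  \<open>q/2\<close> over \<open>n\<close>, which vanishes for \<open>q\<close> even and \<open>q/2 < n\<close> only.
\<close>

lemma cycle_power_sums_differ:
  fixes q :: real
  assumes n: "odd n" and q: "0 < q" "\<And>i. 1 \<le> i \<Longrightarrow> q \<noteq> 2 * real i"
  shows "\<exists>t. 0 < t \<and> t < 1 \<and>
    (\<Sum>k<n. cmod (1 + complex_of_real t * unity_root n ^ k) powr q) \<noteq>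
    (\<Sum>k<n. cmod (1 + complex_of_real (- t) * unity_root n ^ k) powr q)"
proof -
  have n0: "0 < n" using n by (cases n) auto
  define c where "c a = q / 2 gchoose a" for a
  have "c n \<noteq> 0"
  proof -
    have "q / 2 - real i \<noteq> 0" for i using q(1) q(2)[of i] by (cases "i = 0") auto
    then show ?thesis by (simp add: c_def gbinomial_prod_rev)
  qed
  obtain M where M: "0 \<le> M" and T: "\<And>z. cmod z \<le> 1 / 2 \<Longrightarrow>
    \<bar>cmod (1 + z) powr q - (cmod (\<Sum>a\<le>n. complex_of_real (c a) * z ^ a))\<^sup>2\<bar> \<le> M * cmod z ^ Suc n"
    using norm_powr_taylor_bound[where n = n and q = q] unfolding c_def by blast
  \<comment> \<open>Each of the two sums has an error of at most n M t^(n+1). Keeping M t below |c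
    n| makes the total error at most half of the difference 4 n |c n| t^n. The denominator M + 1 is
    positive even for M = 0.\<close>
  define t where "t = min (1 / 2) (\<bar>c n\<bar> / (M + 1))"
  have t: "0 < t" "t \<le> 1 / 2" using \<open>c n \<noteq> 0\<close> M unfolding t_def by (simp_all only: min.cobounded1) simp
  have "M * t \<le> M * (\<bar>c n\<bar> / (M + 1))" using M by (intro mult_left_mono) (auto simp: t_def)
  also have "\<dots> \<le> \<bar>c n\<bar>" using M by (simp add: field_simps)
  finally have Mt: "M * t \<le> \<bar>c n\<bar>" .
  define F where "F s = (\<Sum>k<n. cmod (1 + complex_of_real s * unity_root n ^ k) powr q)" for s
  define S where "S s = (\<Sum>k<n. (cmod (\<Sum>a\<le>n. complex_of_real (c a) * (complex_of_real s * unity_root n ^ k) ^ a))\<^sup>2)" for s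
  have FS: "\<bar>F s - S s\<bar> \<le> real n * (M * t ^ Suc n)" if s: "\<bar>s\<bar> = t" for s
  proof -
    have "\<bar>F s - S s\<bar> \<le> (\<Sum>k<n. M * t ^ Suc n)"
      unfolding F_def S_def sum_subtractf[symmetric]
    proof (rule order_trans[OF sum_abs sum_mono])
      fix k
      have z: "cmod (complex_of_real s * unity_root n ^ k) = t" using s by (simp add: norm_mult norm_power)
      show "\<bar>cmod (1 + complex_of_real s * unity_root n ^ k) powr q -
          (cmod (\<Sum>a\<le>n. complex_of_real (c a) * (complex_of_real s * unity_root n ^ k) ^ a))\<^sup>2\<bar> \<le> M * t ^ Suc n"
        using T[of "complex_of_real s * unity_root n ^ k"] t unfolding z by simp
    qed
    then show ?thesis by simp
  qed
  have "F t \<noteq> F (- t)"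
  proof
    assume "F t = F (- t)"
    then have "\<bar>S t - S (- t)\<bar> \<le> 2 * (real n * (M * t ^ Suc n))"
      using FS[of t] FS[of "- t"] t(1) by simp
    also have "\<dots> = 2 * real n * t ^ n * (M * t)" by simp
    also have "\<dots> \<le> 2 * real n * t ^ n * \<bar>c n\<bar>" using Mt t(1) by (intro mult_left_mono) auto
    finally have "\<bar>S t - S (- t)\<bar> \<le> 2 * real n * t ^ n * \<bar>c n\<bar>" .
    moreover have "S t - S (- t) = 4 * real n * c 0 * c n * t ^ n"
      unfolding S_def by (rule truncated_power_sum_difference[OF n])
    moreover have "c 0 = 1" by (simp add: c_def)
    ultimately have "4 * (real n * t ^ n * \<bar>c n\<bar>) \<le> 2 * (real n * t ^ n * \<bar>c n\<bar>)"
      using t(1) by (simp add: abs_mult mult_ac)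
    moreover have "0 < real n * t ^ n * \<bar>c n\<bar>" using n0 t(1) \<open>c n \<noteq> 0\<close> by simp
    ultimately show False by linarith
  qed
  then show ?thesis using t unfolding F_def by (intro exI[of _ t]) auto
qed

section \<open>Circulant matrices and the trace pairing\<close>

definition dft :: "nat \<Rightarrow> nat \<Rightarrow> nat \<Rightarrow> complex" where
  "dft n k i = unity_root n ^ (k * i) / complex_of_real (sqrt n)"

lemma dft_mult_cnj: "dft n k i * cnj (dft n k' j) = unity_root n ^ (k * i) * cnj (unity_root n ^ (k' * j)) / of_nat n"
  by (simp add: dft_def flip: of_real_mult)

lemma unitary_dft:
  assumes \<sigma>: "\<And>i. cnj (\<sigma> i) * \<sigma> i = 1"
  shows "unitary_matrix n (\<lambda>k i. \<sigma> i * dft n k i)"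
  unfolding unitary_matrix_def
proof (intro allI impI)
  fix k k' assume k: "k < n" "k' < n"
  have "(\<Sum>i<n. cnj (\<sigma> i * dft n k i) * (\<sigma> i * dft n k' i)) = (\<Sum>i<n. (cnj (\<sigma> i) * \<sigma> i) * (dft n k' i * cnj (dft n k i)))"
    by (intro sum.cong refl) (simp add: mult_ac)
  also have "\<dots> = (\<Sum>i<n. unity_root n ^ (i * k') * cnj (unity_root n ^ (i * k)) / of_nat n)"
    unfolding \<sigma> dft_mult_cnj by (simp add: mult.commute)
  also have "\<dots> = (if k = k' then 1 else 0)"
    using k unfolding sum_divide_distrib[symmetric] unity_root_orthogonality[OF k(2,1)] by auto
  finally show "(\<Sum>i<n. cnj (\<sigma> i * dft n k i) * (\<sigma> i * dft n k' i)) = (if k = k' then 1 else 0)" .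
qed

lemma norm_dft_le: "0 < n \<Longrightarrow> cmod (dft n k i) \<le> 1"
  by (simp add: dft_def norm_divide norm_power)

text \<open>The right-hand side is the circulant matrix 1 + sS, where S has ones at (i, i + 1 mod
  n). The Fourier matrix diagonalizes it, with eigenvalues \<open>1 + s * unity_root n ^ k\<close>;
  as it is normal, their moduli are its singular values.\<close>

lemma cycle_symbol:
  assumes "i < n" "j < n"
  shows "(\<Sum>k<n. (1 + s * unity_root n ^ k) * dft n k i * cnj (dft n k j)) =
    (if i = j then 1 else 0) + s * (if Suc i mod n = j then 1 else 0)"
proof -
  have n: "1 \<le> n" using assms by simp
  have "(\<Sum>k<n. (1 + s * unity_root n ^ k) * dft n k i * cnj (dft n k j)) =
      (\<Sum>k<n. unity_root n ^ (k * i) * cnj (unity_root n ^ (k * j)) / of_nat n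
        + s * (unity_root n ^ (k * Suc i) * cnj (unity_root n ^ (k * j)) / of_nat n))"
    unfolding mult.assoc[of "1 + _"] dft_mult_cnj
    by (intro sum.cong refl) (simp add: power_add algebra_simps add_divide_distrib)
  also have "\<dots> = (\<Sum>k<n. unity_root n ^ (k * i) * cnj (unity_root n ^ (k * j))) / of_nat n
      + s * ((\<Sum>k<n. unity_root n ^ (k * Suc i) * cnj (unity_root n ^ (k * j))) / of_nat n)"
    by (simp only: sum.distrib sum_divide_distrib sum_distrib_left)
  also have "\<dots> = (if i = j then 1 else 0) + s * (if Suc i mod n = j then 1 else 0)"
    unfolding unity_root_orthogonality_mod[OF n] using assms by simp
  finally show ?thesis .
qed

text \<open>For matrices with common singular vectors the Hilbert-Schmidt inner product is the inner
  product of their weights.\<close>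

lemma unitary_trace:
  assumes G: "unitary_matrix n G" and H: "unitary_matrix n H"
  shows "(\<Sum>i<n. \<Sum>j<n. (\<Sum>k<n. l k * G k i * cnj (H k j)) * cnj (\<Sum>k<n. m k * G k i * cnj (H k j)))
    = (\<Sum>k<n. l k * cnj (m k))"
proof -
  let ?f = "\<lambda>k k' i j. l k * cnj (m k') * (cnj (G k' i) * G k i) * (cnj (H k j) * H k' j)"
  have "(\<Sum>i<n. \<Sum>j<n. (\<Sum>k<n. l k * G k i * cnj (H k j)) * cnj (\<Sum>k<n. m k * G k i * cnj (H k j)))
      = (\<Sum>i<n. \<Sum>j<n. \<Sum>k<n. \<Sum>k'<n. ?f k k' i j)"
    unfolding cnj_sum sum_product by (intro sum.cong refl) (simp add: mult_ac)
  also have "\<dots> = (\<Sum>i<n. \<Sum>k<n. \<Sum>j<n. \<Sum>k'<n. ?f k k' i j)"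
    by (intro sum.cong refl sum.swap)
  also have "\<dots> = (\<Sum>k<n. \<Sum>i<n. \<Sum>j<n. \<Sum>k'<n. ?f k k' i j)" by (rule sum.swap)
  also have "\<dots> = (\<Sum>k<n. \<Sum>i<n. \<Sum>k'<n. \<Sum>j<n. ?f k k' i j)"
    by (rule sum.cong[OF refl], rule sum.cong[OF refl], rule sum.swap)
  also have "\<dots> = (\<Sum>k<n. \<Sum>k'<n. \<Sum>i<n. \<Sum>j<n. ?f k k' i j)"
    by (rule sum.cong[OF refl], rule sum.swap)
  also have "\<dots> = (\<Sum>k<n. \<Sum>k'<n. if k' = k then l k * cnj (m k') else 0)"
  proof (intro sum.cong refl)
    fix k k' assume k: "k \<in> {..<n}" "k' \<in> {..<n}"
    have "(\<Sum>i<n. \<Sum>j<n. ?f k k' i j) = l k * cnj (m k') * (\<Sum>i<n. cnj (G k' i) * G k i) * (\<Sum>j<n. cnj (H k j) * H k' j)"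
      by (simp only: sum_distrib_left sum_distrib_right) (subst sum.swap, rule refl)
    then show "(\<Sum>i<n. \<Sum>j<n. ?f k k' i j) = (if k' = k then l k * cnj (m k') else 0)"
      using G H k by (simp add: unitary_matrix_def)
  qed
  also have "\<dots> = (\<Sum>k<n. l k * cnj (m k))" by simp
  finally show ?thesis .
qed

text \<open>
  As \<open>n\<close> is odd, changing the signs of the second half of the cycle is, up to diagonal unitaries
  with entries \<open>\<sigma>\<close>, the passage from \<open>1 + sS\<close> to \<open>1 - sS\<close> for the cyclic shift \<open>S\<close>.
\<close>

lemma half_cycle_signs:
  fixes n :: nat
  assumes n: "odd n"
  obtains \<sigma> :: "nat \<Rightarrow> complex" where "\<And>m. cnj (\<sigma> m) = \<sigma> m" "\<And>m. \<sigma> m * \<sigma> m = 1" "\<sigma> (2 * n) = \<sigma> 0"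
    "\<And>m. \<sigma> (Suc m) * \<sigma> m = (-1) ^ m * (if m < n then 1 else -1)"
proof -
  \<comment> \<open>The entries of sS lie on the odd edges, the diagonal ones on the even edges: the
    power of -1 accounts for the passage from sS to -sS, the other factor for the signs on the
    second half. For odd n, \<tau> l times \<tau> (n + l) is (-1)^n (-1) = 1, so the product
    \<sigma> closes up around the cycle.\<close>
  define \<tau> where "\<tau> l = (-1) ^ l * (if l < n then 1 else -1 :: complex)" for l
  define \<sigma> where "\<sigma> m = (\<Prod>l<m. \<tau> l)" for m
  have \<tau>: "cnj (\<tau> l) = \<tau> l" "\<tau> l * \<tau> l = 1" for l
    by (auto simp: \<tau>_def simp flip: power_mult_distrib)
  have 1: "cnj (\<sigma> m) = \<sigma> m" for m by (simp add: \<sigma>_def \<tau>)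
  have 2: "\<sigma> m * \<sigma> m = 1" for m by (simp add: \<sigma>_def \<tau> flip: prod.distrib)
  have 3: "\<sigma> (Suc m) * \<sigma> m = \<tau> m" for m
    using 2[of m] by (simp add: \<sigma>_def mult_ac)
  have "\<sigma> (2 * n) = (\<Prod>l<n. \<tau> l * \<tau> (n + l))"
  proof -
    have "\<sigma> (n + m) = (\<Prod>l<n. \<tau> l) * (\<Prod>l<m. \<tau> (n + l))" for m
      by (induction m) (simp_all add: \<sigma>_def mult_ac)
    from this[of n] show ?thesis by (simp add: prod.distrib mult_2)
  qed
  also have "\<dots> = 1"
  proof (rule prod.neutral, rule ballI)
    fix l assume "l \<in> {..<n}"
    have "(-1 :: complex) ^ l * (-1) ^ (n + l) = -1"
      using n by (simp add: power_add mult_ac flip: power_mult_distrib)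
    then show "\<tau> l * \<tau> (n + l) = 1" using \<open>l \<in> {..<n}\<close> by (simp add: \<tau>_def)
  qed
  finally have "\<sigma> (2 * n) = \<sigma> 0" by (simp add: \<sigma>_def)
  then show thesis using 1 2 3 that unfolding \<tau>_def by blast
qed

text \<open>Here \<open>l\<close> says that the scaled matrix c (1 + sS) has norm at most 1, and
  \<open>m\<close> that pairing with weights m is bounded by \<beta> on the ball of radius 1 +
  \<delta>. The conclusion is the pairing for c (1 - sS). Leaving both bounds abstract lets one
  argument serve finite and infinite p.\<close>

lemma (in schatten_approximation) cycle_inequality:
  fixes n :: nat and e :: "nat \<Rightarrow> nat \<times> nat" and s c :: complex
  assumes cycles: "half_fixed_cycles I n e"
    and l: "\<And>(x :: (nat, nat) ell2_op) g h. compact_op x \<Longrightarrow>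
      schmidt x {..<n} (\<lambda>k. c * (1 + s * unity_root n ^ k)) g h \<Longrightarrow> N x \<le> 1"
    and m: "\<And>(x :: (nat, nat) ell2_op) g h. x \<in> schatten_class p \<Longrightarrow> N x \<le> 1 + \<delta> \<Longrightarrow>
      orthonormal_on {..<n} g \<Longrightarrow> orthonormal_on {..<n} h \<Longrightarrow>
      cmod (\<Sum>k<n. cnj (m k) * cinner (g k) (x (h k))) \<le> \<beta>"
  shows "cmod (\<Sum>k<n. c * (1 - s * unity_root n ^ k) * cnj (m k)) \<le> \<beta>"
proof -
  have n: "odd n" "3 \<le> n" and e: "\<And>m. m < n \<Longrightarrow> e m \<in> I"
    and cyc: "\<And>D. finite D \<Longrightarrow> \<exists>R C. inj_on R {..<n} \<and> inj_on C {..<n} \<and>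
      (\<forall>m<2 * n. cycle_edge R C n m \<in> I) \<and> (\<forall>m<n. cycle_edge R C n m = e m) \<and>
      (\<forall>m. n \<le> m \<and> m < 2 * n \<longrightarrow> cycle_edge R C n m \<notin> D)"
    using cycles unfolding half_fixed_cycles_def by blast+
  have n0: "0 < n" using n by simp
  obtain \<sigma> where \<sigma>: "\<And>m. cnj (\<sigma> m) = \<sigma> m" "\<And>m. \<sigma> m * \<sigma> m = 1" "\<sigma> (2 * n) = \<sigma> 0"
    "\<And>m. \<sigma> (Suc m) * \<sigma> m = (-1) ^ m * (if m < n then 1 else -1)"
    using half_cycle_signs[OF n(1)] by blast
  define z where "z i j = c * ((if i = j then 1 else 0) + s * (if Suc i mod n = j then 1 else 0))" for i j
  \<comment> \<open>Row R i is vertex 2i + 1 of the cycle and column C j is vertex 2j, which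
    explains the arguments of \<sigma>. On the one hand z' is c (1 - sS) between diagonal unitaries,
    on the other hand it is z with the signs changed on the second half.\<close>
  define z' where "z' i j = \<sigma> (Suc (2 * i)) * \<sigma> (2 * j) *
      (c * ((if i = j then 1 else 0) - s * (if Suc i mod n = j then 1 else 0)))" for i j
  define G' where "G' k i = \<sigma> (Suc (2 * i)) * dft n k i" for k i
  define H' where "H' k j = \<sigma> (2 * j) * dft n k j" for k j
  let ?l = "\<lambda>k. c * (1 - s * unity_root n ^ k)"
  \<comment> \<open>The singular vectors of z' are used, so that the pairing of z' with w becomes a
    sum over the weights alone.\<close>
  define w where "w i j = (\<Sum>k<n. m k * G' k i * cnj (H' k j))" for i j
  have un: "unitary_matrix n (dft n)" using unitary_dft[of "\<lambda>_. 1" n] by simp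
  have uG': "unitary_matrix n G'" and uH': "unitary_matrix n H'"
    unfolding G'_def H'_def by (intro unitary_dft; simp add: \<sigma>)+
  have z: "z i j = (\<Sum>k<n. c * (1 + s * unity_root n ^ k) * dft n k i * cnj (dft n k j))" if "i < n" "j < n" for i j
    unfolding z_def cycle_symbol[OF that, of s, symmetric] by (simp add: sum_distrib_left mult.assoc)
  have z': "z' i j = (\<Sum>k<n. ?l k * G' k i * cnj (H' k j))" if "i < n" "j < n" for i j
  proof -
    have "(if i = j then 1 else 0) - s * (if Suc i mod n = j then 1 else 0)
        = (\<Sum>k<n. (1 - s * unity_root n ^ k) * dft n k i * cnj (dft n k j))"
      using cycle_symbol[OF that, of "- s"] by simp
    then show ?thesis
      unfolding z'_def G'_def H'_def by (simp add: sum_distrib_left mult_ac \<sigma>(1))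
  qed
  define W where "W = (\<Sum>k<n. cmod (m k))"
  have \<sigma>n: "cmod (\<sigma> m) = 1" for m
  proof -
    have "(cmod (\<sigma> m))\<^sup>2 = 1"
      using arg_cong[OF \<sigma>(2)[of m], of cmod] by (simp add: norm_mult power2_eq_square)
    then show ?thesis using norm_ge_zero[of "\<sigma> m"] by (simp add: power2_eq_1_iff)
  qed
  have W: "cmod (w i j) \<le> W" for i j
    unfolding w_def W_def
  proof (rule order_trans[OF norm_sum sum_mono])
    fix k
    have "cmod (G' k i) * cmod (H' k j) \<le> 1 * 1"
      using norm_dft_le[OF n0] by (intro mult_mono) (auto simp: G'_def H'_def norm_mult \<sigma>n)
    then show "cmod (m k * G' k i * cnj (H' k j)) \<le> cmod (m k)"
      using mult_left_mono[of "cmod (G' k i) * cmod (H' k j)" 1 "cmod (m k)"] by (simp add: norm_mult mult.assoc)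
  qed
  define Zb where "Zb = cmod c * (1 + cmod s)"
  have Zb: "cmod (z i j) \<le> Zb" for i j
  proof -
    have "cmod ((if i = j then 1 else 0) + s * (if Suc i mod n = j then 1 else 0)) \<le> 1 + cmod s"
      by (rule norm_triangle_le) auto
    then show ?thesis by (simp add: z_def Zb_def norm_mult mult_left_mono)
  qed
  have Zb0: "0 \<le> Zb" by (simp add: Zb_def)
  have trace: "(\<Sum>i<n. \<Sum>j<n. z' i j * cnj (w i j)) = (\<Sum>k<n. ?l k * cnj (m k))"
  proof -
    have "(\<Sum>i<n. \<Sum>j<n. z' i j * cnj (w i j)) =
        (\<Sum>i<n. \<Sum>j<n. (\<Sum>k<n. ?l k * G' k i * cnj (H' k j)) * cnj (w i j))"
      by (intro sum.cong refl) (simp only: z' lessThan_iff)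
    also have "\<dots> = (\<Sum>k<n. ?l k * cnj (m k))"
      unfolding w_def by (rule unitary_trace[OF uG' uH'])
    finally show ?thesis .
  qed
  define K where "K = real n * (real n * (2 * Zb * W))"
  have K: "0 \<le> K" using Zb0 by (simp add: K_def W_def sum_nonneg)
  have approx_le: "cmod (\<Sum>k<n. ?l k * cnj (m k)) \<le> \<beta> + K * \<eta>" if \<eta>: "0 < \<eta>" for \<eta>
  proof -
    have "\<forall>\<^sub>F k in sequentially. \<forall>m\<in>{..<n}. dist (diagonal_coefficient k (e m)) 1 < \<eta>"
      using tendstoD[OF diagonal_coefficient_tendsto[OF e] \<eta>] by (intro eventually_ball_finite) auto
    then have "\<forall>\<^sub>F k in sequentially. 1 \<le> k \<and> (\<forall>m\<in>{..<n}. dist (diagonal_coefficient k (e m)) 1 < \<eta>)"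
      using eventually_ge_at_top[of 1] by (rule eventually_conj[rotated])
    then obtain k where k: "1 \<le> k" and near: "\<And>m. m < n \<Longrightarrow> cmod (diagonal_coefficient k (e m) - 1) < \<eta>"
      unfolding eventually_sequentially by (auto simp: dist_norm)
    \<comment> \<open>The cycle is chosen only now, with its second half outside the finite set on
      which the symbol of this T_k exceeds \<eta>.\<close>
    obtain R C where R: "inj_on R {..<n}" and C: "inj_on C {..<n}"
      and I: "\<And>m. m < 2 * n \<Longrightarrow> cycle_edge R C n m \<in> I"
      and E: "\<And>m. m < n \<Longrightarrow> cycle_edge R C n m = e m"
      and far: "\<And>m. n \<le> m \<Longrightarrow> m < 2 * n \<Longrightarrow> cycle_edge R C n m \<notin> {e \<in> I. \<eta> \<le> cmod (diagonal_coefficient k e)}"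
      using cyc[OF finite_large_diagonal_coefficients[OF k \<eta>]] by blast
    have signs: "cmod (2 * diagonal_coefficient k (cycle_edge R C n m) - 1 - (if m < n then 1 else -1)) \<le> 2 * \<eta>"
      if m: "m < 2 * n" for m
    proof (cases "m < n")
      case True
      have "2 * diagonal_coefficient k (e m) - 1 - 1 = 2 * (diagonal_coefficient k (e m) - 1)" by simp
      then have "cmod (2 * diagonal_coefficient k (e m) - 1 - 1) = 2 * cmod (diagonal_coefficient k (e m) - 1)"
        by (simp only: norm_mult) simp
      then show ?thesis using near[OF True] E[OF True] True by simp
    next
      case False
      then show ?thesis using far[of m] I[OF m] m by (simp add: norm_mult)
    qed
    let ?d = "\<lambda>i j. 2 * diagonal_coefficient k (R i, C j) - 1"
    have edge: "z i j \<noteq> 0 \<Longrightarrow> (R i, C j) \<in> I" and err: "cmod (?d i j * z i j - z' i j) \<le> 2 * \<eta> * cmod (z i j)"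
      if i: "i < n" and j: "j < n" for i j
    proof -
      have ne: "Suc i mod n \<noteq> i" using i n by (cases "Suc i = n") auto
      have "(z i j \<noteq> 0 \<longrightarrow> (R i, C j) \<in> I) \<and> cmod (?d i j * z i j - z' i j) \<le> 2 * \<eta> * cmod (z i j)"
      proof -
        consider "j = i" | "j = Suc i mod n" | "j \<noteq> i" "j \<noteq> Suc i mod n" by blast
        then show ?thesis
        proof cases
          case 1
          have ce: "cycle_edge R C n (2 * i) = (R i, C i)" using i by (simp add: cycle_edge_def)
          have "z' i j = (if 2 * i < n then 1 else -1) * z i j"
            using 1 ne \<sigma>(4)[of "2 * i"] by (simp add: z'_def z_def)
          then have "?d i j * z i j - z' i j = (?d i i - (if 2 * i < n then 1 else -1)) * z i j"
            using 1 by (simp only: left_diff_distrib)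
          then have "cmod (?d i j * z i j - z' i j) \<le> 2 * \<eta> * cmod (z i j)"
            using signs[of "2 * i"] i unfolding ce norm_mult by (simp add: norm_mult mult_right_mono)
          then show ?thesis using I[of "2 * i"] i ce 1 by simp
        next
          case 2
          have ce: "cycle_edge R C n (Suc (2 * i)) = (R i, C j)" using 2 by (simp add: cycle_edge_def)
          \<comment> \<open>For i = n - 1 the column index wraps around to 0; there the closing
            condition on \<sigma> is used.\<close>
          have "\<sigma> (2 * j) = \<sigma> (Suc (Suc (2 * i)))"
            using \<sigma>(3) 2 i by (cases "Suc i = n") auto
          then have "\<sigma> (Suc (2 * i)) * \<sigma> (2 * j) = - (if Suc (2 * i) < n then 1 else -1)"
            using \<sigma>(4)[of "Suc (2 * i)"] by (simp add: mult.commute)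
          then have "z' i j = (if Suc (2 * i) < n then 1 else -1) * z i j"
            unfolding z'_def z_def using 2 ne by simp
          then have "?d i j * z i j - z' i j = (?d i j - (if Suc (2 * i) < n then 1 else -1)) * z i j"
            by (simp only: left_diff_distrib)
          then have "cmod (?d i j * z i j - z' i j) \<le> 2 * \<eta> * cmod (z i j)"
            using signs[of "Suc (2 * i)"] i unfolding ce by (simp add: norm_mult mult_right_mono)
          then show ?thesis using I[of "Suc (2 * i)"] i ce by simp
        next
          case 3
          then show ?thesis by (simp add: z_def z'_def)
        qed
      qed
      then show "z i j \<noteq> 0 \<Longrightarrow> (R i, C j) \<in> I" "cmod (?d i j * z i j - z' i j) \<le> 2 * \<eta> * cmod (z i j)"
        by auto
    qed
    have mb: "cmod (\<Sum>i<n. \<Sum>j<n. ?d i j * z i j * cnj (w i j)) \<le> \<beta>"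
      by (rule multiplier_bound[OF k R C edge un un uG' uH' z w_def l m])
    have "cmod (\<Sum>i<n. \<Sum>j<n. (?d i j * z i j - z' i j) * cnj (w i j)) \<le> (\<Sum>i<n. \<Sum>j<n. 2 * \<eta> * Zb * W)"
    proof (intro order_trans[OF norm_sum sum_mono] order_trans[OF norm_sum sum_mono])
      fix i j assume "i \<in> {..<n}" "j \<in> {..<n}"
      then have "cmod (?d i j * z i j - z' i j) \<le> 2 * \<eta> * Zb"
        using err[of i j] mult_left_mono[OF Zb[of i j], of "2 * \<eta>"] \<eta>
        by (meson lessThan_iff less_imp_le mult_pos_pos order_trans zero_less_numeral)
      then show "cmod ((?d i j * z i j - z' i j) * cnj (w i j)) \<le> 2 * \<eta> * Zb * W"
        using W[of i j] \<eta> Zb0 by (simp add: norm_mult mult_mono)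
    qed
    also have "\<dots> = K * \<eta>" by (simp add: K_def)
    finally have er: "cmod (\<Sum>i<n. \<Sum>j<n. (?d i j * z i j - z' i j) * cnj (w i j)) \<le> K * \<eta>" .
    have "(\<Sum>k<n. ?l k * cnj (m k)) =
        (\<Sum>i<n. \<Sum>j<n. ?d i j * z i j * cnj (w i j)) - (\<Sum>i<n. \<Sum>j<n. (?d i j * z i j - z' i j) * cnj (w i j))"
      unfolding trace[symmetric] sum_subtractf[symmetric] by (intro sum.cong refl) (simp add: left_diff_distrib)
    with norm_triangle_le_diff[OF add_mono[OF mb er]] show ?thesis by (simp only:)
  qed
  show ?thesis
  proof (rule field_le_epsilon)
    fix \<epsilon> :: real assume \<epsilon>: "0 < \<epsilon>"
    have "K * (\<epsilon> / (K + 1)) \<le> \<epsilon>" using K \<epsilon> by (simp add: field_simps)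
    then show "cmod (\<Sum>k<n. ?l k * cnj (m k)) \<le> \<beta> + \<epsilon>"
      using approx_le[of "\<epsilon> / (K + 1)"] K \<epsilon> by (simp add: add_nonneg_pos)
  qed
qed

text \<open>Equality would require the root of unity to be -1, which is not an n-th root of unity
  for odd n. For p infinite this replaces the expansion in powers of t.\<close>

lemma unity_root_power_norm_less:
  assumes "odd n"
  shows "cmod (1 - unity_root n ^ k / 2) < 3 / 2"
proof -
  define u where "u = unity_root n ^ k"
  have n: "1 \<le> n" using assms by (cases n) auto
  have u1: "cmod u = 1" by (simp add: u_def norm_power)
  have sq: "(Re u)\<^sup>2 + (Im u)\<^sup>2 = 1" using cmod_power2[of u] u1 by simp
  have "Re u \<noteq> -1"
  proof
    assume re: "Re u = -1"
    then have "u = -1" using sq by (simp add: complex_eq_iff)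
    moreover have "u ^ n = 1"
      unfolding u_def using unity_root_power_self[OF n] by (metis mult.commute power_mult power_one)
    ultimately show False using assms by simp
  qed
  then have re: "-1 < Re u" using abs_Re_le_cmod[of u] u1 by linarith
  have "(cmod (1 - u / 2))\<^sup>2 = (1 - Re u / 2)\<^sup>2 + (Im u / 2)\<^sup>2"
    by (simp add: cmod_power2)
  also have "\<dots> = 5 / 4 - Re u"
    using sq by (simp add: power2_eq_square algebra_simps)
  also have "\<dots> < (3 / 2)\<^sup>2" using re by (simp add: power2_eq_square)
  finally show ?thesis unfolding u_def by (rule power2_less_imp_less) simp
qed

section \<open>Contradiction for infinite and for finite p\<close>

theorem theorem1p7:
  fixes I :: "(nat \<times> nat) set" and p :: ereal
  assumes "1 \<le> p"
    and "p \<notin> {ereal (2 * real n) | n. 1 \<le> n}"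
    and "real_metric_uap scaleC_op
           (schatten_class_on p I :: (nat, nat) ell2_op set) (schatten_norm p)"
  shows "\<forall>c r :: nat. asymptotically_infinite_dist (bipartite_edges I) (Inl c) (Inr r)"
proof (rule ccontr)
  assume "\<not> (\<forall>c r :: nat. asymptotically_infinite_dist (bipartite_edges I) (Inl c) (Inr r))"
  then obtain n e where cycles: "half_fixed_cycles I n e" using half_fixed_cycles_exist by blast
  then have n: "odd n" "0 < n" by (auto simp: half_fixed_cycles_def)
  have ineq: "cmod (\<Sum>k<n. c * (1 - s * unity_root n ^ k) * cnj (m k)) \<le> \<beta>"
    if "0 < \<delta>"
    and "\<And>(x :: (nat, nat) ell2_op) g h. compact_op x \<Longrightarrow>
      schmidt x {..<n} (\<lambda>k. c * (1 + s * unity_root n ^ k)) g h \<Longrightarrow> schatten_norm p x \<le> 1"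
    and "\<And>(x :: (nat, nat) ell2_op) g h. x \<in> schatten_class p \<Longrightarrow> schatten_norm p x \<le> 1 + \<delta> \<Longrightarrow>
      orthonormal_on {..<n} g \<Longrightarrow> orthonormal_on {..<n} h \<Longrightarrow>
      cmod (\<Sum>k<n. cnj (m k) * cinner (g k) (x (h k))) \<le> \<beta>"
    for \<delta> \<beta> :: real and c s :: complex and m
  proof -
    obtain T where T: "approximating_sequence scaleC_op (schatten_class_on p I) (schatten_norm p) T"
      "real_unconditional_const (schatten_class_on p I :: (nat, nat) ell2_op set) (schatten_norm p) T \<le> ennreal (1 + \<delta>)"
      using assms(3) \<open>0 < \<delta>\<close> unfolding real_metric_uap_def by blast
    interpret schatten_approximation p I T \<delta>
      using assms(1) \<open>0 < \<delta>\<close> T by unfold_locales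
    show ?thesis by (rule cycle_inequality[OF cycles that(2,3)])
  qed
  show False
  proof (cases p)
    case PInf
    \<comment> \<open>B is the norm of 1 - S/2, used to normalize it. Its mirror image 1 + S/2 has
      the eigenvalue 3/2 at k = 0.\<close>
    define B where "B = Max ((\<lambda>k. cmod (1 - unity_root n ^ k / 2)) ` {..<n})"
    have B_ge: "cmod (1 - unity_root n ^ k / 2) \<le> B" if "k < n" for k
      unfolding B_def using that by (intro Max_ge) auto
    have "B \<in> (\<lambda>k. cmod (1 - unity_root n ^ k / 2)) ` {..<n}"
      unfolding B_def using n(2) by (intro Max_in) auto
    then have B_less: "B < 3 / 2" using unity_root_power_norm_less[OF n(1)] by auto
    have B0: "0 < B" using B_ge[OF n(2)] by simp
    have "3 / 2 / B \<le> 1 + \<delta>" if \<delta>: "0 < \<delta>" for \<delta>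
    proof -
      \<comment> \<open>Pairing with this m isolates the eigenvalue 3/2 of 1 + S/2.\<close>
      define m :: "nat \<Rightarrow> complex" where "m k = (if k = 0 then 1 else 0)" for k
      have pick: "(\<Sum>k<n. f k * cnj (m k)) = f 0" for f
        using n(2) by (simp add: m_def if_distrib[of cnj] if_distrib[of "(*) _"] cong: if_cong)
      have "cmod (\<Sum>k<n. complex_of_real (1 / B) * (1 - (- 1 / 2) * unity_root n ^ k) * cnj (m k)) \<le> 1 + \<delta>"
      proof (rule ineq[OF \<delta>])
        fix x :: "(nat, nat) ell2_op" and g h :: "nat \<Rightarrow> nat ell2"
        assume x: "schmidt x {..<n} (\<lambda>k. complex_of_real (1 / B) * (1 + (- 1 / 2) * unity_root n ^ k)) g h"
        have "norm x \<le> 1"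
          by (rule norm_finite_schmidt[OF _ x]) (use B_ge B0 in \<open>auto simp: norm_mult norm_divide divide_le_eq_1\<close>)
        then show "schatten_norm p x \<le> 1" using PInf by (simp add: schatten_norm_def)
      next
        fix x :: "(nat, nat) ell2_op" and g h :: "nat \<Rightarrow> nat ell2"
        assume x: "schatten_norm p x \<le> 1 + \<delta>" and g: "orthonormal_on {..<n} g" and h: "orthonormal_on {..<n} h"
        have "cmod (cinner (g 0) (x (h 0))) \<le> norm (g 0) * norm (x (h 0))" by (rule cinner_norm_le)
        also have "\<dots> \<le> norm x"
          using orthonormal_norm[OF g, of 0] orthonormal_norm[OF h, of 0] n(2) norm_blinfun[of x "h 0"] by simp
        also have "\<dots> \<le> 1 + \<delta>" using x PInf by (simp add: schatten_norm_def)
        finally show "cmod (\<Sum>k<n. cnj (m k) * cinner (g k) (x (h k))) \<le> 1 + \<delta>"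
          using pick[of "\<lambda>k. cinner (g k) (x (h k))"] by (simp add: mult.commute)
      qed
      then show ?thesis unfolding pick using B0 by (simp add: norm_mult norm_divide)
    qed
    then have "3 / 2 / B \<le> 1" by (rule field_le_epsilon)
    then show False using B_less B0 by (simp add: field_simps)
  next
    case (real q)
    have q: "1 \<le> q" using assms(1) real by simp
    have q_ne: "q \<noteq> 2 * real i" if "1 \<le> i" for i using assms(2) real that by auto
    define \<Lambda> where "\<Lambda> s = (\<Sum>k<n. cmod (1 + s * unity_root n ^ k) powr q)" for s
    have \<Lambda>0: "0 < \<Lambda> s" and ne0: "1 + s * unity_root n ^ k \<noteq> 0" if s: "cmod s < 1" for s k
    proof -
      have nz: "1 + s * unity_root n ^ k \<noteq> 0" for k
      proof
        assume "1 + s * unity_root n ^ k = 0"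
        then have "s * unity_root n ^ k = -1" by (simp add: add_eq_0_iff)
        then have "cmod (s * unity_root n ^ k) = 1" by simp
        then show False using s by (simp add: norm_mult norm_power)
      qed
      then show "1 + s * unity_root n ^ k \<noteq> 0" .
      show "0 < \<Lambda> s" unfolding \<Lambda>_def using nz n(2) by (intro sum_pos) auto
    qed
    let ?w = "\<lambda>k. unity_root n ^ k"
    \<comment> \<open>Allowing any s in the open unit disc gives both inequalities between the
      values at t and -t.\<close>
    have le: "\<Lambda> (- s) \<le> \<Lambda> s" if s: "cmod s < 1" for s
    proof -
      define \<nu> where "\<nu> s = \<Lambda> s powr (1 / q)" for s
      have s': "cmod (- s) < 1" using s by simp
      have \<nu>0: "0 < \<nu> s" "0 < \<nu> (- s)" using \<Lambda>0[OF s] \<Lambda>0[OF s'] by (simp_all add: \<nu>_def)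
      have \<nu>q: "\<nu> s powr q = \<Lambda> s" "\<nu> (- s) powr q = \<Lambda> (- s)"
        using \<Lambda>0[OF s] \<Lambda>0[OF s'] q by (simp_all add: \<nu>_def powr_powr)
      define c where "c = complex_of_real (1 / \<nu> s)"
      define \<mu> where "\<mu> k = (1 - s * ?w k) / complex_of_real (\<nu> (- s))" for k
      \<comment> \<open>These are the weights of the norming functional of the normalized 1 - sS:
        |m| is the power q - 1 of |\<mu>|, and \<mu> times the conjugate of m is |\<mu>|^q. The
        exponent q - 2 may be negative; |s| < 1 keeps \<mu> away from 0.\<close>
      define m where "m k = \<mu> k * complex_of_real (cmod (\<mu> k) powr (q - 2))" for k
      have \<mu>0: "0 < cmod (\<mu> k)" for k
        using ne0[OF s', of k] \<nu>0 by (simp add: \<mu>_def)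
      have m_norm: "cmod (m k) = cmod (\<mu> k) powr (q - 1)" for k
        using \<mu>0[of k] powr_add[of "cmod (\<mu> k)" 1 "q - 2"] by (simp add: m_def norm_mult)
      have \<mu>m: "\<mu> k * cnj (m k) = complex_of_real (cmod (\<mu> k) powr q)" for k
      proof -
        have "\<mu> k * cnj (m k) = complex_of_real ((cmod (\<mu> k))\<^sup>2 * cmod (\<mu> k) powr (q - 2))"
          by (simp add: m_def complex_norm_square mult.assoc del: of_real_power)
        moreover have "(cmod (\<mu> k))\<^sup>2 * cmod (\<mu> k) powr (q - 2) = cmod (\<mu> k) powr q"
          using \<mu>0[of k] powr_add[of "cmod (\<mu> k)" 2 "q - 2"] by simp
        ultimately show ?thesis by simp
      qed
      have l1: "(\<Sum>k<n. cmod (c * (1 + s * ?w k)) powr q) = 1"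
      proof -
        have "(\<Sum>k<n. cmod (c * (1 + s * ?w k)) powr q) = \<Lambda> s / \<nu> s powr q"
          using \<nu>0 unfolding \<Lambda>_def c_def sum_divide_distrib
          by (intro sum.cong refl) (simp add: norm_mult norm_divide powr_divide)
        then show ?thesis using \<Lambda>0[OF s] \<nu>q by simp
      qed
      have \<mu>1: "(\<Sum>k<n. cmod (\<mu> k) powr q) = 1"
      proof -
        have "(\<Sum>k<n. cmod (\<mu> k) powr q) = \<Lambda> (- s) / \<nu> (- s) powr q"
          using \<nu>0 unfolding \<Lambda>_def \<mu>_def sum_divide_distrib
          by (intro sum.cong refl) (simp add: norm_divide powr_divide)
        then show ?thesis using \<Lambda>0[OF s'] \<nu>q by simp
      qed
      have "(\<Sum>k<n. c * (1 - s * ?w k) * cnj (m k)) = complex_of_real (\<nu> (- s) / \<nu> s)"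
      proof -
        have "(\<Sum>k<n. c * (1 - s * ?w k) * cnj (m k))
            = (\<Sum>k<n. complex_of_real (\<nu> (- s) / \<nu> s) * (\<mu> k * cnj (m k)))"
          using \<nu>0 by (intro sum.cong refl) (simp add: c_def \<mu>_def)
        also have "\<dots> = complex_of_real (\<nu> (- s) / \<nu> s * (\<Sum>k<n. cmod (\<mu> k) powr q))"
          unfolding \<mu>m by (simp add: sum_distrib_left)
        finally show ?thesis unfolding \<mu>1 by simp
      qed
      then have ratio: "cmod (\<Sum>k<n. c * (1 - s * ?w k) * cnj (m k)) = \<nu> (- s) / \<nu> s"
        using \<nu>0 by (simp add: norm_divide del: of_real_divide)
      \<comment> \<open>Young's inequality, tangent at |\<mu> k|, bounds the pairing. Both
        normalized power sums equal 1, so the right-hand side tends to 1 with \<delta>, just as a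
        duality bound 1 + \<delta> would.\<close>
      have bound: "\<nu> (- s) / \<nu> s \<le> (1 + \<delta>) powr q / q + (1 - 1 / q)" if \<delta>: "0 < \<delta>" for \<delta>
        unfolding ratio[symmetric]
      proof (rule ineq[OF \<delta>])
        fix x :: "(nat, nat) ell2_op" and g h :: "nat \<Rightarrow> nat ell2"
        assume x: "compact_op x" "schmidt x {..<n} (\<lambda>k. c * (1 + s * ?w k)) g h"
        have "schatten_norm p x powr q \<le> 1 powr q"
          using schatten_finite_schmidt(2)[OF q x(1) _ x(2)] real unfolding l1 by simp
        then show "schatten_norm p x \<le> 1" by (rule powr_le_cancel_base) (use q in auto)
      next
        fix x :: "(nat, nat) ell2_op" and g h :: "nat \<Rightarrow> nat ell2"
        assume x: "x \<in> schatten_class p" "schatten_norm p x \<le> 1 + \<delta>"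
          and g: "orthonormal_on {..<n} g" and h: "orthonormal_on {..<n} h"
        let ?X = "\<lambda>k. cmod (cinner (g k) (x (h k)))"
        have "cmod (\<Sum>k<n. cnj (m k) * cinner (g k) (x (h k))) \<le> (\<Sum>k<n. ?X k powr q / q + (1 - 1 / q) * cmod (\<mu> k) powr q)"
        proof (rule order_trans[OF norm_sum sum_mono])
          fix k
          show "cmod (cnj (m k) * cinner (g k) (x (h k))) \<le> ?X k powr q / q + (1 - 1 / q) * cmod (\<mu> k) powr q"
            unfolding norm_mult complex_mod_cnj m_norm by (rule young_tangent[OF norm_ge_zero \<mu>0 q])
        qed
        also have "\<dots> = (\<Sum>k<n. ?X k powr q) / q + (1 - 1 / q)"
          using \<mu>1 by (simp add: sum.distrib flip: sum_divide_distrib sum_distrib_left)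
        also have "\<dots> \<le> (1 + \<delta>) powr q / q + (1 - 1 / q)"
        proof -
          have "(\<Sum>k<n. ?X k powr q) \<le> schatten_norm p x powr q"
            using schatten_pairing_le[OF q _ g h] x(1) real by simp
          also have "\<dots> \<le> (1 + \<delta>) powr q" using x(2) q by (intro powr_mono2 schatten_norm_nonneg) auto
          finally show ?thesis using q by (simp add: divide_right_mono)
        qed
        finally show "cmod (\<Sum>k<n. cnj (m k) * cinner (g k) (x (h k))) \<le> (1 + \<delta>) powr q / q + (1 - 1 / q)" .
      qed
      have "((\<lambda>\<delta>. (1 + \<delta>) powr q / q + (1 - 1 / q)) \<longlongrightarrow> (1 + 0) powr q / q + (1 - 1 / q)) (at_right 0)"
        using q by (intro tendsto_intros) auto
      then have "\<nu> (- s) / \<nu> s \<le> (1 + 0) powr q / q + (1 - 1 / q)"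
        by (rule tendsto_lowerbound) (auto intro!: eventually_mono[OF eventually_at_right_less] bound)
      then have "\<nu> (- s) \<le> \<nu> s" using \<nu>0 by (simp add: field_simps)
      then show ?thesis using powr_mono2[of q "\<nu> (- s)" "\<nu> s"] q \<nu>0 \<nu>q by simp
    qed
    obtain t where t: "0 < t" "t < 1" "\<Lambda> (complex_of_real t) \<noteq> \<Lambda> (complex_of_real (- t))"
      using cycle_power_sums_differ[OF n(1), of q] q q_ne unfolding \<Lambda>_def by auto
    then show False
      using le[of "complex_of_real t"] le[of "complex_of_real (- t)"] by simp
  qed (use assms(1) in simp)
qed

end
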